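(* Fix an integer $m\ge2$. Assume that the assertion $\mathsf P(j)$ holds for every integer $j$ with $2\le j<m$. Let $S$ be a finite metric tree with exactly $m$ leaves and let $|S|\ge2s>0$. Then there are a finite positive Borel measure $\eta_{S,s}$ on $X_{S,s}=S\times[0,s]$ and finitely many triples $(u_\beta,S_\beta,t_\beta)$, with $u_\beta>0$, $S_\beta$ a metric subtree of $S$ and $t_\beta$ a real number, such that $$c_{\eta_{S,s}}(x)+\sum_{\beta:\,x\in S_\beta}u_\beta\ge1\qquad(x\in S),$$ $$\pi_*\eta_{S,s}+\sum_\beta u_\beta\Lambda_{S_\beta,t_\beta}\le\Lambda_{S,s},$$ and for every $\beta$, the subtree $S_\beta$ has exactly $m$ leaves and $$0<t_\beta\le s,\qquad |S_\beta|\le\frac{|S|}{2},\qquad |S_\beta|\ge2t_\beta.$$ For $m=2$, the conclusion holds without the assumption on $\mathsf P(j)$.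
   Context: A finite metric tree is the metric realization of a finite combinatorial tree whose edges have positive lengths; $|T|$ is the total edge length and $d_T$ the path metric. A leaf of $T$ is a point $x$ such that $T\setminus\{x\}$ has exactly one component. A metric subtree of $T$ is a nonempty closed connected subset, itself regarded as a metric tree. For $r>0$, $\Lambda_{T,r}=\frac{|T|}{r}U[0,r]$, where $U[0,r]$ is the uniform probability measure on $[0,r]$ (viewed on $\mathbb R_{\ge0}$). On $X_{T,r}=T\times[0,r]$ let $\pi(v,s)=s$. For a finite positive Borel measure $\xi$ on $X_{T,r}$, $c_\xi(x)=\xi(\{(v,s)\in X_{T,r}:d_T(x,v)\le s\})$ for $x\in T$; $\xi$ is a fractional marked-ball cover of $T$ if $c_\xi(x)\ge1$ for all $x\in T$. $\mu\le\mu'$ means $\mu(A)\le\mu'(A)$ for all Borel $A$. For $j\ge2$, $\mathsf P(j)$ is the assertion: for every finite metric tree $T$ with exactly $j$ leaves and every $r>0$ with $|T|\ge2r$, there is a fractional marked-ball cover $\xi$ of $T$ on $X_{T,r}$ with $\pi_*\xi\le\Lambda_{T,r}$. The family of triples may be empty. *)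

theory Defs
  imports "HOL-Analysis.Analysis"
begin

definition simple_graph :: "nat set \<Rightarrow> nat set set \<Rightarrow> bool" where
  "simple_graph V E \<longleftrightarrow> (\<forall>e\<in>E. e \<subseteq> V \<and> card e = 2)"

definition graph_connected :: "nat set \<Rightarrow> nat set set \<Rightarrow> bool" where
  "graph_connected V E \<longleftrightarrow> V \<noteq> {} \<and> (\<forall>a\<in>V. \<forall>b\<in>V. (a, b) \<in> {(c, d). {c, d} \<in> E}\<^sup>*)"

definition graph_cycle :: "nat set set \<Rightarrow> nat list \<Rightarrow> bool" where
  "graph_cycle E xs \<longleftrightarrow> 3 \<le> length xs \<and> distinct xs \<and>
     (\<forall>i<length xs. {xs ! i, xs ! (Suc i mod length xs)} \<in> E)"

definition finite_graph_tree :: "nat set \<Rightarrow> nat set set \<Rightarrow> bool" where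
  "finite_graph_tree V E \<longleftrightarrow>
     finite V \<and> simple_graph V E \<and> graph_connected V E \<and> (\<nexists>xs. graph_cycle E xs)"

(* The metric realization, in barycentric coordinates: the point of the edge {a, b} dividing it
   in the ratio t : 1 - t is the function with value 1 - t at a, t at b and 0 elsewhere. *)

definition supp :: "(nat \<Rightarrow> real) \<Rightarrow> nat set" where
  "supp p = {v. p v \<noteq> 0}"

definition realization :: "nat set \<Rightarrow> nat set set \<Rightarrow> (nat \<Rightarrow> real) set" where
  "realization V E =
     {p. (\<forall>v. 0 \<le> p v) \<and> (\<Sum>v\<in>V. p v) = 1 \<and> supp p \<in> (\<lambda>v. {v}) ` V \<union> E}"

(* polygonal_path V E l p q L: there is a path of length L from p to q composed of finitely many
   segments, each contained in one closed edge. If p and q lie on e = {a, b}, then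
   p a - q a = - (p b - q b), so the segment between them has length l e * \<bar>p a - q a\<bar>, which
   is half of l e times the sum of \<bar>p v - q v\<bar> over v in e. *)

inductive polygonal_path ::
  "nat set \<Rightarrow> nat set set \<Rightarrow> (nat set \<Rightarrow> real) \<Rightarrow> (nat \<Rightarrow> real) \<Rightarrow> (nat \<Rightarrow> real) \<Rightarrow> real \<Rightarrow> bool"
  for V E l where
  trivial: "p \<in> realization V E \<Longrightarrow> polygonal_path V E l p p 0"
| segment: "polygonal_path V E l p q L \<Longrightarrow> q' \<in> realization V E \<Longrightarrow> e \<in> E \<Longrightarrow>
    supp q \<subseteq> e \<Longrightarrow> supp q' \<subseteq> e \<Longrightarrow>
    polygonal_path V E l p q' (L + l e / 2 * (\<Sum>v\<in>e. \<bar>q v - q' v\<bar>))"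

definition path_dist ::
  "nat set \<Rightarrow> nat set set \<Rightarrow> (nat set \<Rightarrow> real) \<Rightarrow> (nat \<Rightarrow> real) \<Rightarrow> (nat \<Rightarrow> real) \<Rightarrow> real" where
  "path_dist V E l p q = Inf {L. polygonal_path V E l p q L}"

definition tree_model ::
  "'a metric \<Rightarrow> nat set \<Rightarrow> nat set set \<Rightarrow> (nat set \<Rightarrow> real) \<Rightarrow> bool" where
  "tree_model M V E l \<longleftrightarrow> finite_graph_tree V E \<and> (\<forall>e\<in>E. 0 < l e) \<and>
     (\<exists>f. bij_betw f (mspace M) (realization V E) \<and>
       (\<forall>x\<in>mspace M. \<forall>y\<in>mspace M. mdist M x y = path_dist V E l (f x) (f y)))"

definition finite_metric_tree :: "'a metric \<Rightarrow> bool" where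
  "finite_metric_tree M \<longleftrightarrow> (\<exists>V E l. tree_model M V E l)"

(* All models of a given finite metric tree have the same total edge length. *)

definition tree_length :: "'a metric \<Rightarrow> real" where
  "tree_length M = (THE L. \<exists>V E l. tree_model M V E l \<and> L = (\<Sum>e\<in>E. l e))"

definition tree_leaves :: "'a metric \<Rightarrow> 'a set" where
  "tree_leaves M = {x \<in> mspace M.
     card (connected_components_of (subtopology (mtopology_of M) (mspace M - {x}))) = 1}"

(* A metric subtree A of T is regarded as a metric tree through submetric T A; in a tree the
   path metric of a connected subset is the restriction of the path metric. *)

definition metric_subtree :: "'a set \<Rightarrow> 'a metric \<Rightarrow> bool" where
  "metric_subtree A T \<longleftrightarrow>
     A \<noteq> {} \<and> closedin (mtopology_of T) A \<and> connectedin (mtopology_of T) A"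

definition Lam :: "'a metric \<Rightarrow> real \<Rightarrow> real measure" where
  "Lam T r = scale_measure (ennreal (tree_length T / r)) (uniform_measure lborel {0..r})"

definition marked_borel :: "'a metric \<Rightarrow> real \<Rightarrow> ('a \<times> real) measure" where
  "marked_borel T r = sigma (mspace T \<times> {0..r})
     {U. openin (prod_topology (mtopology_of T) (top_of_set {0..r})) U}"

definition finite_borel_measure_on :: "'a metric \<Rightarrow> real \<Rightarrow> ('a \<times> real) measure \<Rightarrow> bool" where
  "finite_borel_measure_on T r \<xi> \<longleftrightarrow> finite_measure \<xi> \<and> sets \<xi> = sets (marked_borel T r)"

definition cover_fun :: "'a metric \<Rightarrow> real \<Rightarrow> ('a \<times> real) measure \<Rightarrow> 'a \<Rightarrow> real" where
  "cover_fun T r \<xi> x = measure \<xi> {(v, s) \<in> mspace T \<times> {0..r}. mdist T x v \<le> s}"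

definition fractional_marked_ball_cover ::
  "'a metric \<Rightarrow> real \<Rightarrow> ('a \<times> real) measure \<Rightarrow> bool" where
  "fractional_marked_ball_cover T r \<xi> \<longleftrightarrow>
     finite_borel_measure_on T r \<xi> \<and> (\<forall>x\<in>mspace T. 1 \<le> cover_fun T r \<xi> x)"

(* The marginal is a measure on the real line, concentrated on {0..r}. *)

definition mark_marginal :: "('a \<times> real) measure \<Rightarrow> real measure" where
  "mark_marginal \<xi> = distr \<xi> borel snd"

(* Every finite metric tree is isometric to one with points of type nat => real, namely to the
   realization of any of its models, so it suffices to quantify over metrics on this type. *)

definition P_assertion :: "nat \<Rightarrow> bool" where
  "P_assertion j \<longleftrightarrow>
     (\<forall>(T :: (nat \<Rightarrow> real) metric) r.
        finite_metric_tree T \<and> card (tree_leaves T) = j \<and> 0 < r \<and> 2 * r \<le> tree_length T \<longrightarrow>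
        (\<exists>\<xi>. fractional_marked_ball_cover T r \<xi> \<and>
             (\<forall>A\<in>sets borel. emeasure (mark_marginal \<xi>) A \<le> emeasure (Lam T r) A)))"

end

theory Submission
  imports Defs
begin

text \<open>
  Write \<open>\<ell>\<close> for the length of the tree \<open>S\<close>. The measure \<open>Lam S s\<close> has the constant density \<open>\<ell> / s\<^sup>2\<close> on
  \<open>{0..s}\<close>, and the task is to cover every point of \<open>S\<close> once with this budget. Schemes that consist of a
  marked measure and weighted sub-trees can be added and rescaled together with their budgets
  (\<open>achievable\<close>), so it suffices to find good schemes and to mix them.

  If \<open>4 * \<tau> \<le> \<ell>\<close>, the density \<open>\<ell> / \<tau>\<^sup>2\<close> on \<open>{0..\<tau>}\<close> covers \<open>S\<close> once (\<open>achievable_long\<close>). The tree is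
  cut at a centroid. Omitting one branch at a time yields sub-trees of length at least \<open>\<ell> / 2 \<ge> 2 * \<tau>\<close>.
  Those with fewer than \<open>m\<close> leaves are covered by the assertion for smaller numbers of leaves; the
  remaining ones have length \<open>\<ell> / 2\<close> and become triples.

  If \<open>\<ell> < 4 * s\<close>, let \<open>D\<close> be the length of a longest path, with ends \<open>a\<close> and \<open>b\<close>. If
  \<open>D < 2 * s\<close>, the marks above \<open>D / 2\<close> pay for balls around the midpoint, each of which contains \<open>S\<close>, and
  \<open>s\<close> is replaced by \<open>D / 2\<close>. So let \<open>D = 2 * (s + t)\<close> with \<open>0 \<le> t < s\<close>. Marks below \<open>t\<close> are used as for
  long trees. A mark \<open>r\<close> above \<open>t\<close> is used half for the ball of radius \<open>r\<close> whose centre is the point of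
  the path at distance \<open>r\<close> from \<open>a\<close>, half for the symmetric ball at \<open>b\<close>. A point at height \<open>h\<close> above the
  point of the path at distance \<open>w\<close> from \<open>a\<close> then receives the coverage
  \<open>1 + (\<ell> - D) * (s - t) / (2 * s\<^sup>2) - \<ell> * \<zeta> / (4 * s\<^sup>2)\<close>, where \<open>\<zeta>\<close> is the length of the part of the interval
  between \<open>w - h\<close> and \<open>w + h\<close> that lies between \<open>2 * t\<close> and \<open>2 * s\<close> (\<open>achievable_balls_from_ends\<close>). Thus points on
  the path are covered sufficiently, and only points of branches may be covered too little.

  To repair this, at each vertex \<open>u\<close> where branches leave the path, \<open>S\<close> is cut into a left and a right
  part that overlap in the branches at \<open>u\<close>. Both parts have fewer leaves than \<open>S\<close>. Covering both of
  them serves every point once and the branches at \<open>u\<close> twice, and it costs \<open>\<ell>\<close>, the length of the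
  overlap and a surcharge if the parts are short (\<open>achievable_part\<close>). With the weight \<open>\<ell> * \<zeta> / (4 * s\<^sup>2)\<close> this
  compensates the deficit at \<open>u\<close>. The overlaps have total length at most \<open>\<ell> - D\<close>, and an elementary
  inequality (\<open>zone_price\<close>) shows that the gain \<open>(\<ell> - D) * (s - t) / (2 * s\<^sup>2)\<close> pays for all overlaps and
  surcharges (\<open>achievable_medium\<close>).

  The geometry rests on one device: with a root chosen, each edge defines the set of vertices that it
  separates from the root, and the mass of a point in this set is a coordinate. The path metric is the
  sum of the coordinate differences weighted by the edge lengths (\<open>path_dist_eq\<close>), so positions, heights
  and distances are sums over edges. Length and number of leaves, which are defined from the metric
  alone, are those of any model (\<open>tree_length_eq\<close>, \<open>card_tree_leaves\<close>).
\<close>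

section \<open>Cutting a finite tree at an edge\<close>

definition adj :: "nat set set \<Rightarrow> (nat \<times> nat) set" where
  "adj E = {(c, d). {c, d} \<in> E}"

text \<open>With a root \<open>a\<close> fixed, the vertices that an edge separates from the root form the part of the
  tree below that edge. Distances, sub-trees and the chain of edges between two vertices are all
  expressed through these sets.\<close>

definition far :: "nat set \<Rightarrow> nat set set \<Rightarrow> nat \<Rightarrow> nat set \<Rightarrow> nat set" where
  "far V E a e = {v \<in> V. (a, v) \<notin> (adj (E - {e}))\<^sup>*}"

lemma adj_rtrancl_sym:
  assumes "(x, y) \<in> (adj E)\<^sup>*"
  shows "(y, x) \<in> (adj E)\<^sup>*"
proof -
  have "sym (adj E)"
    by (auto simp: sym_def adj_def insert_commute)
  then show ?thesis
    using assms sym_rtrancl symD by metis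
qed

lemma adj_rtrancl_mono: "(x, y) \<in> (adj E)\<^sup>* \<Longrightarrow> E \<subseteq> E' \<Longrightarrow> (x, y) \<in> (adj E')\<^sup>*"
  by (rule subsetD[OF rtrancl_mono]) (auto simp: adj_def)

text \<open>A cycle is given by a list without repetition, so a connection is first made injective.\<close>

lemma rtrancl_distinct_walk:
  assumes "(x, y) \<in> r\<^sup>*"
  shows "\<exists>xs. xs \<noteq> [] \<and> distinct xs \<and> hd xs = x \<and> last xs = y \<and>
    (\<forall>i. Suc i < length xs \<longrightarrow> (xs ! i, xs ! Suc i) \<in> r)"
  using assms
proof (induction rule: converse_rtrancl_induct)
  case base
  show ?case
    by (rule exI[of _ "[y]"]) auto
next
  case (step x z)
  then obtain xs where xs: "xs \<noteq> []" "distinct xs" "hd xs = z" "last xs = y"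
    "\<And>i. Suc i < length xs \<Longrightarrow> (xs ! i, xs ! Suc i) \<in> r"
    by blast
  show ?case
  proof (cases "x \<in> set xs")
    case True
    then obtain k where k: "k < length xs" "xs ! k = x"
      by (auto simp: in_set_conv_nth)
    have "hd (drop k xs) = x" "last (drop k xs) = y"
      using k xs by (auto simp: hd_drop_conv_nth)
    moreover have "(drop k xs ! i, drop k xs ! Suc i) \<in> r" if "Suc i < length (drop k xs)" for i
      using xs(5)[of "k + i"] that k by simp
    ultimately show ?thesis
      using k xs by (intro exI[of _ "drop k xs"]) auto
  next
    case False
    have "((x # xs) ! i, (x # xs) ! Suc i) \<in> r" if "Suc i < length (x # xs)" for i
      using that xs step(1) by (cases i) (auto simp: hd_conv_nth)
    then show ?thesis
      using False xs by (intro exI[of _ "x # xs"]) auto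
  qed
qed

locale graph_tree =
  fixes V :: "nat set" and E :: "nat set set"
  assumes tree: "finite_graph_tree V E"
begin

abbreviation fr :: "nat \<Rightarrow> nat set \<Rightarrow> nat set" where
  "fr \<equiv> far V E"

lemma finite_V [simp]: "finite V"
  using tree by (auto simp: finite_graph_tree_def)

lemma edge_card: "e \<in> E \<Longrightarrow> e \<subseteq> V \<and> card e = 2"
  using tree by (auto simp: finite_graph_tree_def simple_graph_def)

lemma finite_E [simp]: "finite E"
  by (rule finite_subset[of _ "Pow V"]) (use edge_card in auto)

lemma edge_ends:
  assumes "e \<in> E"
  obtains u w where "e = {u, w}" "u \<noteq> w" "u \<in> V" "w \<in> V"
  using edge_card[OF assms] by (auto simp: card_2_iff)

lemma edge_other_end:
  assumes "e \<in> E" "u \<in> e"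
  obtains w where "e = {u, w}" "u \<noteq> w" "u \<in> V" "w \<in> V"
proof -
  obtain x y where "e = {x, y}" "x \<noteq> y" "x \<in> V" "y \<in> V"
    using assms(1) by (rule edge_ends)
  then show ?thesis
    using assms(2) that by (metis insertE insert_commute singletonD)
qed

lemma V_nonempty: "V \<noteq> {}"
  using tree by (auto simp: finite_graph_tree_def graph_connected_def)

lemma connected: "x \<in> V \<Longrightarrow> y \<in> V \<Longrightarrow> (x, y) \<in> (adj E)\<^sup>*"
  using tree by (auto simp: finite_graph_tree_def graph_connected_def adj_def)

lemma no_edge_self: "{x, x} \<notin> E" "{x} \<notin> E"
  using edge_card[of "{x}"] by auto

lemma adj_rtrancl_in_V:
  assumes "(x, y) \<in> (adj E')\<^sup>*" "x \<in> V" "E' \<subseteq> E"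
  shows "y \<in> V"
  using assms(1)
proof (induction rule: rtrancl_induct)
  case base
  show ?case
    by (rule assms(2))
next
  case (step y z)
  then show ?case
    using assms(3) edge_card by (auto simp: adj_def)
qed

text \<open>Every edge of a tree is a bridge: a detour between its ends would close up to a cycle.\<close>

lemma bridge:
  assumes "{u, w} \<in> E"
  shows "(u, w) \<notin> (adj (E - {{u, w}}))\<^sup>*"
proof
  assume "(u, w) \<in> (adj (E - {{u, w}}))\<^sup>*"
  from rtrancl_distinct_walk[OF this] obtain xs where xs: "xs \<noteq> []" "distinct xs" "hd xs = u"
    "last xs = w" "\<And>i. Suc i < length xs \<Longrightarrow> (xs ! i, xs ! Suc i) \<in> adj (E - {{u, w}})"
    by blast
  have first: "xs ! 0 = u" and final: "xs ! (length xs - 1) = w"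
    using xs by (auto simp: hd_conv_nth last_conv_nth)
  have "u \<noteq> w"
    using assms no_edge_self by auto
  then have "length xs \<noteq> 1"
    using first final by auto
  moreover have "length xs \<noteq> 2"
    using xs(5)[of 0] first final by (auto simp: adj_def)
  moreover have "length xs \<noteq> 0"
    using xs(1) by simp
  ultimately have len: "3 \<le> length xs"
    by linarith
  have "{xs ! i, xs ! (Suc i mod length xs)} \<in> E" if "i < length xs" for i
  proof (cases "Suc i < length xs")
    case True
    then show ?thesis
      using xs(5)[of i] by (auto simp: adj_def)
  next
    case False
    then have "Suc i = length xs"
      using that by simp
    then have "i = length xs - 1" "Suc i mod length xs = 0"
      by auto
    then show ?thesis
      using assms first final by (simp add: insert_commute)
  qed
  then have "graph_cycle E xs"
    using len xs(2) by (auto simp: graph_cycle_def)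
  then show False
    using tree by (auto simp: finite_graph_tree_def)
qed

lemma reach_one_end:
  assumes "{u, w} \<in> E" "x \<in> V"
  shows "(u, x) \<in> (adj (E - {{u, w}}))\<^sup>* \<or> (w, x) \<in> (adj (E - {{u, w}}))\<^sup>*"
proof -
  have "u \<in> V"
    using assms edge_card by auto
  from connected[OF this assms(2)] show ?thesis
  proof (induction rule: rtrancl_induct)
    case base
    show ?case
      by auto
  next
    case (step y z)
    show ?case
    proof (cases "{y, z} = {u, w}")
      case True
      then have "z = u \<or> z = w"
        by (auto simp: doubleton_eq_iff)
      then show ?thesis
        by auto
    next
      case False
      then have "(y, z) \<in> adj (E - {{u, w}})"
        using step(2) by (auto simp: adj_def)
      then show ?thesis
        using step(3) by (meson rtrancl.rtrancl_into_rtrancl)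
    qed
  qed
qed

lemma far_subset: "fr a e \<subseteq> V"
  by (auto simp: far_def)

lemma finite_far [simp]: "finite (fr a e)"
  by (rule finite_subset[OF far_subset]) simp

lemma root_not_far: "a \<notin> fr a e"
  by (auto simp: far_def)

lemma far_eq_comp:
  assumes "{u, w} \<in> E" "(a, u) \<in> (adj (E - {{u, w}}))\<^sup>*" "v \<in> V"
  shows "v \<in> fr a {u, w} \<longleftrightarrow> (w, v) \<in> (adj (E - {{u, w}}))\<^sup>*"
proof
  assume "v \<in> fr a {u, w}"
  then have "(u, v) \<notin> (adj (E - {{u, w}}))\<^sup>*"
    using rtrancl_trans[OF assms(2)] by (auto simp: far_def)
  then show "(w, v) \<in> (adj (E - {{u, w}}))\<^sup>*"
    using reach_one_end[OF assms(1,3)] by blast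
next
  assume w: "(w, v) \<in> (adj (E - {{u, w}}))\<^sup>*"
  have "(a, v) \<notin> (adj (E - {{u, w}}))\<^sup>*"
  proof
    assume "(a, v) \<in> (adj (E - {{u, w}}))\<^sup>*"
    then have "(u, w) \<in> (adj (E - {{u, w}}))\<^sup>*"
      using assms(2) w adj_rtrancl_sym by (meson rtrancl_trans)
    then show False
      using bridge[OF assms(1)] by blast
  qed
  then show "v \<in> fr a {u, w}"
    using assms(3) by (auto simp: far_def)
qed

lemma far_ends:
  assumes "a \<in> V" "e \<in> E"
  obtains u w where "e = {u, w}" "u \<in> V" "w \<in> V" "u \<notin> fr a e" "w \<in> fr a e"
    "u \<noteq> w" "(a, u) \<in> (adj (E - {e}))\<^sup>*"
proof -
  note result = that
  have *: thesis if e: "e = {u, w}" and r: "(u, a) \<in> (adj (E - {{u, w}}))\<^sup>*" for u w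
  proof -
    have r': "(a, u) \<in> (adj (E - {{u, w}}))\<^sup>*"
      using r by (rule adj_rtrancl_sym)
    have "u \<in> V" "w \<in> V" "u \<noteq> w"
      using assms(2) e edge_card no_edge_self by auto
    moreover have "w \<in> fr a e"
      using far_eq_comp[of u w a w] r' assms(2) e calculation by auto
    moreover have "u \<notin> fr a e"
      using r' e by (auto simp: far_def)
    ultimately show thesis
      using result[of u w] e r' by blast
  qed
  obtain u w where e: "e = {u, w}"
    using assms(2) by (rule edge_ends)
  have "(u, a) \<in> (adj (E - {{u, w}}))\<^sup>* \<or> (w, a) \<in> (adj (E - {{u, w}}))\<^sup>*"
    using reach_one_end assms e by blast
  then show thesis
    using *[of u w] *[of w u] e by (metis insert_commute)
qed

lemma same_side_far:
  assumes "(v, v') \<in> (adj (E - {e}))\<^sup>*" "v \<in> V"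
  shows "v \<in> fr a e \<longleftrightarrow> v' \<in> fr a e"
proof -
  have "v' \<in> V"
    using adj_rtrancl_in_V assms by blast
  then show ?thesis
    using assms adj_rtrancl_sym unfolding far_def by (auto dest: rtrancl_trans)
qed

lemma other_edge_far:
  assumes "e \<in> E" "e' \<in> E" "e' \<noteq> e"
  shows "e' \<subseteq> fr a e \<or> e' \<inter> fr a e = {}"
proof -
  obtain x y where e': "e' = {x, y}" "x \<in> V" "y \<in> V"
    using assms(2) by (rule edge_ends)
  then have "(x, y) \<in> (adj (E - {e}))\<^sup>*"
    using assms by (auto simp: adj_def)
  from same_side_far[OF this e'(2)] show ?thesis
    using e' by auto
qed

lemma other_edge_meets_far:
  "e \<in> E \<Longrightarrow> e' \<in> E \<Longrightarrow> e' \<noteq> e \<Longrightarrow> x \<in> e' \<Longrightarrow> x \<in> fr a e \<Longrightarrow> e' \<subseteq> fr a e"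
  using other_edge_far by blast

lemma far_conn:
  assumes "a \<in> V" "e \<in> E" "v \<in> fr a e" "v' \<in> fr a e"
  shows "(v, v') \<in> (adj (E - {e}))\<^sup>*"
proof -
  obtain u w where uw: "e = {u, w}" "(a, u) \<in> (adj (E - {e}))\<^sup>*"
    using assms(1,2) by (rule far_ends)
  have "(w, v) \<in> (adj (E - {e}))\<^sup>*" "(w, v') \<in> (adj (E - {e}))\<^sup>*"
    using far_eq_comp[of u w a] uw assms far_subset by blast+
  then show ?thesis
    using adj_rtrancl_sym by (meson rtrancl_trans)
qed

lemma near_conn:
  assumes "v \<in> V - fr a e" "v' \<in> V - fr a e"
  shows "(v, v') \<in> (adj (E - {e}))\<^sup>*"
proof -
  have "(a, v) \<in> (adj (E - {e}))\<^sup>*" "(a, v') \<in> (adj (E - {e}))\<^sup>*"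
    using assms by (auto simp: far_def)
  then show ?thesis
    using adj_rtrancl_sym by (meson rtrancl_trans)
qed

lemma conn_avoiding:
  assumes "(v, v') \<in> (adj (E - {e}))\<^sup>*" "v \<in> W" "W = fr a e \<or> W = V - fr a e"
    and "e \<in> E" "a \<in> V"
  shows "(v, v') \<in> (adj {e' \<in> E. e' \<subseteq> W})\<^sup>* \<and> v' \<in> W"
  using assms(1)
proof (induction rule: rtrancl_induct)
  case base
  show ?case
    using assms(2) by auto
next
  case (step y z)
  have yz: "{y, z} \<in> E" "{y, z} \<noteq> e"
    using step(2) by (auto simp: adj_def)
  have "{y, z} \<subseteq> W"
    using other_edge_far[OF assms(4) yz, of a] edge_card[OF yz(1)] assms(3) step(3) by auto
  then show ?case
    using step yz by (auto simp: adj_def intro: rtrancl.rtrancl_into_rtrancl)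
qed

lemma far_conn_inside:
  assumes "a \<in> V" "e \<in> E" "v \<in> fr a e" "v' \<in> fr a e"
  shows "(v, v') \<in> (adj {e' \<in> E. e' \<subseteq> fr a e})\<^sup>*"
  using conn_avoiding[OF far_conn[OF assms] assms(3)] assms by blast

lemma near_conn_inside:
  assumes "a \<in> V" "e \<in> E" "v \<in> V - fr a e" "v' \<in> V - fr a e"
  shows "(v, v') \<in> (adj {e' \<in> E. e' \<subseteq> V - fr a e})\<^sup>*"
  using conn_avoiding[OF near_conn[OF assms(3,4)] assms(3)] assms by blast

text \<open>An edge other than \<open>e\<close> has both ends on the same side of \<open>e\<close>, so one side of \<open>e\<close> can be left
  only through \<open>e\<close> itself. Hence the far sides of the edges form a laminar family.\<close>

lemma far_subset_of_edge:
  assumes "a \<in> V" "e \<in> E" "e' \<in> E" "e' \<subseteq> fr a e" "e' \<noteq> e"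
  shows "fr a e' \<subseteq> fr a e"
proof
  fix v
  assume v: "v \<in> fr a e'"
  show "v \<in> fr a e"
  proof (rule ccontr)
    assume "v \<notin> fr a e"
    then have "(a, v) \<in> (adj {e' \<in> E. e' \<subseteq> V - fr a e})\<^sup>*"
      using near_conn_inside[OF assms(1,2)] v far_subset assms(1) root_not_far by blast
    moreover have "{e' \<in> E. e' \<subseteq> V - fr a e} \<subseteq> E - {e'}"
    proof -
      have "e' \<noteq> {}"
        using edge_card[OF assms(3)] by auto
      then show ?thesis
        using assms(4) by blast
    qed
    ultimately have "(a, v) \<in> (adj (E - {e'}))\<^sup>*"
      by (rule adj_rtrancl_mono)
    then show False
      using v by (auto simp: far_def)
  qed
qed

lemma far_subset_or_disjoint:
  assumes "a \<in> V" "e \<in> E" "e' \<in> E" "e' \<inter> fr a e = {}"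
  shows "fr a e \<subseteq> fr a e' \<or> fr a e \<inter> fr a e' = {}"
proof -
  have "v' \<in> fr a e'" if v: "v \<in> fr a e" "v \<in> fr a e'" "v' \<in> fr a e" for v v'
  proof -
    have "{e'' \<in> E. e'' \<subseteq> fr a e} \<subseteq> E - {e'}"
    proof -
      have "e' \<noteq> {}"
        using edge_card[OF assms(3)] by auto
      then show ?thesis
        using assms(4) by blast
    qed
    then have "(v, v') \<in> (adj (E - {e'}))\<^sup>*"
      using far_conn_inside[OF assms(1,2) v(1,3)] adj_rtrancl_mono by blast
    then show ?thesis
      using same_side_far v far_subset by blast
  qed
  then show ?thesis
    by blast
qed

lemma laminar:
  assumes "a \<in> V" "e \<in> E" "e' \<in> E"
  shows "fr a e \<subseteq> fr a e' \<or> fr a e' \<subseteq> fr a e \<or> fr a e \<inter> fr a e' = {}"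
proof (cases "e = e'")
  case False
  then show ?thesis
    using other_edge_far[of e e' a] far_subset_of_edge[of a e e'] far_subset_or_disjoint[of a e e']
      assms by blast
qed auto

text \<open>The edge at \<open>x\<close> in the direction of \<open>y\<close>: after crossing it, \<open>y\<close> is reached without using it
  again.\<close>

lemma first_step:
  assumes "x \<in> V" "y \<in> V" "x \<noteq> y"
  obtains z where "{x, z} \<in> E" "(z, y) \<in> (adj (E - {{x, z}}))\<^sup>*" "z \<in> V" "z \<noteq> x"
proof -
  have "y = x \<or> (\<exists>z. {x, z} \<in> E \<and> (z, y) \<in> (adj (E - {{x, z}}))\<^sup>*)"
    using connected[OF assms(1,2)]
  proof (induction rule: rtrancl_induct)
    case base
    show ?case
      by simp
  next
    case (step y z)
    have yz: "{y, z} \<in> E"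
      using step(2) by (auto simp: adj_def)
    show ?case
    proof (cases "y = x")
      case True
      then show ?thesis
        using yz by blast
    next
      case False
      then obtain c where c: "{x, c} \<in> E" "(c, y) \<in> (adj (E - {{x, c}}))\<^sup>*"
        using step(3) by blast
      show ?thesis
      proof (cases "{y, z} = {x, c}")
        case True
        then have "z = x \<or> z = c"
          by (auto simp: doubleton_eq_iff)
        then show ?thesis
          using c by blast
      next
        case False
        then have "(y, z) \<in> adj (E - {{x, c}})"
          using yz by (auto simp: adj_def)
        then show ?thesis
          using c by (meson rtrancl.rtrancl_into_rtrancl)
      qed
    qed
  qed
  then obtain z where z: "{x, z} \<in> E" "(z, y) \<in> (adj (E - {{x, z}}))\<^sup>*"
    using assms(3) by blast
  moreover have "z \<in> V" "z \<noteq> x"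
    using z(1) edge_card no_edge_self by auto
  ultimately show ?thesis
    using that by blast
qed

lemma far_of_step:
  assumes "a \<in> V" "{x, z} \<in> E" "(z, y) \<in> (adj (E - {{x, z}}))\<^sup>*" "y \<in> V"
  shows "x \<in> fr a {x, z} \<longleftrightarrow> y \<notin> fr a {x, z}"
proof -
  have "z \<in> V"
    using assms(2) edge_card by auto
  then have "z \<in> fr a {x, z} \<longleftrightarrow> y \<in> fr a {x, z}"
    using same_side_far[OF assms(3)] by blast
  moreover obtain u w where "{x, z} = {u, w}" "u \<notin> fr a {x, z}" "w \<in> fr a {x, z}"
    using assms(1,2) by (rule far_ends)
  then have "x \<in> fr a {x, z} \<longleftrightarrow> z \<notin> fr a {x, z}"
    by (auto simp: doubleton_eq_iff)
  ultimately show ?thesis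
    by blast
qed

end

section \<open>The path metric as a sum over edges\<close>

definition vertex_pt :: "nat \<Rightarrow> nat \<Rightarrow> real" where
  "vertex_pt v = (\<lambda>x. if x = v then 1 else 0)"

definition edge_pt :: "nat \<Rightarrow> nat \<Rightarrow> real \<Rightarrow> nat \<Rightarrow> real" where
  "edge_pt x y \<theta> = (\<lambda>v. (1 - \<theta>) * vertex_pt x v + \<theta> * vertex_pt y v)"

text \<open>The barycentric mass of a point below an edge is the coordinate of the point transversal to
  that edge: it is constant on every other edge and runs affinely through the unit interval on the
  edge itself.\<close>

definition below :: "nat set \<Rightarrow> nat set set \<Rightarrow> nat \<Rightarrow> nat set \<Rightarrow> (nat \<Rightarrow> real) \<Rightarrow> real" where
  "below V E a e p = (\<Sum>v\<in>far V E a e. p v)"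

text \<open>The coordinates, scaled by the edge lengths, place the tree in a space with the sum norm. This
  sum turns out to be the path metric, for every choice of the root.\<close>

definition edge_dist ::
  "nat set \<Rightarrow> nat set set \<Rightarrow> (nat set \<Rightarrow> real) \<Rightarrow> nat \<Rightarrow> (nat \<Rightarrow> real) \<Rightarrow> (nat \<Rightarrow> real) \<Rightarrow> real" where
  "edge_dist V E l a p q = (\<Sum>e\<in>E. l e * \<bar>below V E a e p - below V E a e q\<bar>)"

lemma supp_vertex_pt [simp]: "supp (vertex_pt v) = {v}"
  by (auto simp: supp_def vertex_pt_def)

locale metric_graph_tree = graph_tree +
  fixes l :: "nat set \<Rightarrow> real"
  assumes l_pos: "e \<in> E \<Longrightarrow> 0 < l e"
begin

abbreviation R :: "(nat \<Rightarrow> real) set" where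
  "R \<equiv> realization V E"

abbreviation nn :: "nat \<Rightarrow> nat set \<Rightarrow> (nat \<Rightarrow> real) \<Rightarrow> real" where
  "nn \<equiv> below V E"

abbreviation ed :: "nat \<Rightarrow> (nat \<Rightarrow> real) \<Rightarrow> (nat \<Rightarrow> real) \<Rightarrow> real" where
  "ed \<equiv> edge_dist V E l"

lemma l_nonneg: "e \<in> E \<Longrightarrow> 0 \<le> l e"
  using l_pos by (simp add: less_imp_le)

lemma R_nonneg: "p \<in> R \<Longrightarrow> 0 \<le> p v"
  and R_sum: "p \<in> R \<Longrightarrow> (\<Sum>v\<in>V. p v) = 1"
  by (auto simp: realization_def)

lemma R_supp_subset: "p \<in> R \<Longrightarrow> supp p \<subseteq> V"
  using edge_card by (auto simp: realization_def)

lemma R_supp_nonempty: "p \<in> R \<Longrightarrow> supp p \<noteq> {}"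
  using edge_card[of "{}"] by (auto simp: realization_def)

lemma vertex_pt_R: "v \<in> V \<Longrightarrow> vertex_pt v \<in> R"
  by (auto simp: realization_def) (auto simp: vertex_pt_def)

lemma edge_pt_R:
  assumes "{x, y} \<in> E" "0 \<le> \<theta>" "\<theta> \<le> 1"
  shows "edge_pt x y \<theta> \<in> R"
proof -
  have xy: "x \<in> V" "y \<in> V" "x \<noteq> y"
    using assms(1) edge_card no_edge_self by auto
  have "(\<Sum>v\<in>V. edge_pt x y \<theta> v) = (1 - \<theta>) * (\<Sum>v\<in>V. vertex_pt x v) + \<theta> * (\<Sum>v\<in>V. vertex_pt y v)"
    by (simp add: edge_pt_def sum.distrib sum_distrib_left)
  also have "\<dots> = 1"
    using R_sum vertex_pt_R xy by simp
  finally have sum: "(\<Sum>v\<in>V. edge_pt x y \<theta> v) = 1" .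
  have "supp (edge_pt x y \<theta>) = (if \<theta> = 0 then {x} else if \<theta> = 1 then {y} else {x, y})"
    using xy by (auto simp: supp_def edge_pt_def vertex_pt_def)
  then have "supp (edge_pt x y \<theta>) \<in> (\<lambda>v. {v}) ` V \<union> E"
    using xy assms(1) by auto
  then show ?thesis
    using sum assms by (auto simp: realization_def edge_pt_def vertex_pt_def)
qed

lemma supp_edge_pt: "supp (edge_pt x y \<theta>) \<subseteq> {x, y}"
  by (auto simp: supp_def edge_pt_def vertex_pt_def)

lemma edge_pt_of_supp:
  assumes "p \<in> R" "supp p \<subseteq> {x, y}" "x \<noteq> y" "x \<in> V" "y \<in> V"
  shows "p = edge_pt x y (p y)" "p x = 1 - p y" "0 \<le> p y" "p y \<le> 1"
proof -
  have "(\<Sum>v\<in>V. p v) = (\<Sum>v\<in>{x, y}. p v)"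
    using assms by (intro sum.mono_neutral_right) (auto simp: supp_def)
  then show x: "p x = 1 - p y"
    using R_sum[OF assms(1)] assms(3) by simp
  show "p = edge_pt x y (p y)"
  proof
    fix v
    show "p v = edge_pt x y (p y) v"
      using x assms(2,3) by (cases "v = x \<or> v = y")
        (auto simp: edge_pt_def vertex_pt_def supp_def)
  qed
  show "0 \<le> p y" "p y \<le> 1"
    using R_nonneg[OF assms(1), of x] R_nonneg[OF assms(1), of y] x by linarith+
qed

lemma vertex_pt_of_supp:
  assumes "p \<in> R" "supp p = {v}"
  shows "p = vertex_pt v"
proof -
  have v: "v \<in> V"
    using R_supp_subset[OF assms(1)] assms(2) by auto
  have "(\<Sum>x\<in>V. p x) = (\<Sum>x\<in>{v}. p x)"
    using assms v by (intro sum.mono_neutral_right) (auto simp: supp_def)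
  then have "p v = 1"
    using R_sum[OF assms(1)] by simp
  moreover have "p x = 0" if "x \<noteq> v" for x
    using assms(2) that by (auto simp: supp_def)
  ultimately show ?thesis
    by (intro ext) (simp add: vertex_pt_def)
qed

lemma R_cases:
  assumes "p \<in> R"
  obtains (vertex) v where "v \<in> V" "p = vertex_pt v"
    | (edge) "supp p \<in> E"
proof -
  have "supp p \<in> (\<lambda>v. {v}) ` V \<or> supp p \<in> E"
    using assms by (simp add: realization_def)
  then show ?thesis
    using vertex vertex_pt_of_supp[OF assms] edge by blast
qed

lemma nn_vertex: "v \<in> V \<Longrightarrow> nn a e (vertex_pt v) = (if v \<in> fr a e then 1 else 0)"
proof -
  have "(\<Sum>x\<in>fr a e. vertex_pt v x) = (\<Sum>x\<in>fr a e. if x = v then 1 else 0)"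
    by (rule sum.cong) (auto simp: vertex_pt_def)
  also have "\<dots> = (if v \<in> fr a e then 1 else 0)"
    by (rule sum.delta) (rule finite_far)
  finally show ?thesis
    unfolding below_def .
qed

lemma nn_edge_pt:
  "nn a e (edge_pt x y \<theta>) = (1 - \<theta>) * nn a e (vertex_pt x) + \<theta> * nn a e (vertex_pt y)"
  unfolding below_def edge_pt_def sum.distrib sum_distrib_left ..

lemma nn_nonneg: "p \<in> R \<Longrightarrow> 0 \<le> nn a e p"
  unfolding below_def by (rule sum_nonneg) (use R_nonneg in auto)

lemma nn_le_1: "p \<in> R \<Longrightarrow> nn a e p \<le> 1"
  unfolding below_def using sum_mono2[OF finite_V far_subset, of a e p] R_nonneg R_sum by simp

lemma nn_one:
  assumes "p \<in> R" "supp p \<subseteq> fr a e"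
  shows "nn a e p = 1"
proof -
  have "(\<Sum>v\<in>V. p v) = (\<Sum>v\<in>fr a e. p v)"
    using assms far_subset by (intro sum.mono_neutral_right) (auto simp: supp_def)
  then show ?thesis
    using R_sum assms by (simp add: below_def)
qed

lemma nn_zero:
  assumes "supp p \<inter> fr a e = {}"
  shows "nn a e p = 0"
  unfolding below_def using assms by (intro sum.neutral) (auto simp: supp_def)

lemma nn_pos_meets: "0 < nn a e p \<Longrightarrow> supp p \<inter> fr a e \<noteq> {}"
  using nn_zero by force

lemma nn_pos_of_meets:
  assumes "p \<in> R" "v \<in> supp p" "v \<in> fr a e"
  shows "0 < nn a e p"
proof -
  have "0 < p v"
    using R_nonneg[OF assms(1), of v] assms(2) by (simp add: supp_def)
  then show ?thesis
    unfolding below_def using R_nonneg[OF assms(1)] assms(3)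
    by (intro sum_pos2[of _ v]) auto
qed

lemma nn_zero_iff: "p \<in> R \<Longrightarrow> nn a e p = 0 \<longleftrightarrow> supp p \<inter> fr a e = {}"
  using nn_zero[of p a e] nn_pos_of_meets[of p _ a e] by fastforce

lemma nn_one_iff:
  assumes "p \<in> R"
  shows "nn a e p = 1 \<longleftrightarrow> supp p \<subseteq> fr a e"
proof
  assume one: "nn a e p = 1"
  show "supp p \<subseteq> fr a e"
  proof
    fix v
    assume v: "v \<in> supp p"
    show "v \<in> fr a e"
    proof (rule ccontr)
      assume "v \<notin> fr a e"
      then have "(\<Sum>x\<in>insert v (fr a e). p x) = p v + 1"
        using one by (simp add: below_def)
      moreover have "(\<Sum>x\<in>insert v (fr a e). p x) \<le> (\<Sum>x\<in>V. p x)"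
        using v R_supp_subset[OF assms] far_subset R_nonneg[OF assms]
        by (intro sum_mono2) auto
      ultimately show False
        using v R_sum[OF assms] R_nonneg[OF assms, of v] by (simp add: supp_def)
    qed
  qed
qed (use nn_one assms in blast)

lemma nn_root: "a \<in> V \<Longrightarrow> nn a e (vertex_pt a) = 0"
  using root_not_far by (simp add: nn_vertex)

lemma nn_const_on_edge:
  assumes "e \<in> E" "e' \<in> E" "e' \<noteq> e" "p \<in> R" "q \<in> R" "supp p \<subseteq> e" "supp q \<subseteq> e"
  shows "nn a e' p = nn a e' q"
proof (cases "e \<subseteq> fr a e'")
  case True
  then have "nn a e' p = 1" "nn a e' q = 1"
    using assms by (auto intro!: nn_one)
  then show ?thesis
    by simp
next
  case False
  then have "e \<inter> fr a e' = {}"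
    using other_edge_far[of e' e a] assms by blast
  then have "nn a e' p = 0" "nn a e' q = 0"
    using assms by (auto intro!: nn_zero)
  then show ?thesis
    by simp
qed

lemma nn_frac_supp:
  assumes "e \<in> E" "p \<in> R" "0 < nn a e p" "nn a e p < 1"
  shows "supp p = e"
  using assms(2)
proof (cases rule: R_cases)
  case (vertex v)
  then show ?thesis
    using assms(3,4) by (simp add: nn_vertex split: if_splits)
next
  case edge
  show ?thesis
  proof (rule ccontr)
    assume "supp p \<noteq> e"
    then have "supp p \<subseteq> fr a e \<or> supp p \<inter> fr a e = {}"
      using other_edge_far assms(1) edge by blast
    then show False
      using nn_one nn_zero assms by fastforce
  qed
qed

lemma nn_on_edge:
  assumes "e = {u, w}" "u \<notin> fr a e" "w \<in> fr a e" "p \<in> R" "supp p \<subseteq> e"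
  shows "nn a e p = p w"
proof -
  have "(\<Sum>v\<in>fr a e. p v) = (\<Sum>v\<in>{w}. p v)"
    using assms by (intro sum.mono_neutral_right) (auto simp: supp_def)
  then show ?thesis
    by (simp add: below_def)
qed

lemma ed_sym: "ed a p q = ed a q p"
  by (simp add: edge_dist_def abs_minus_commute)

lemma ed_self [simp]: "ed a p p = 0"
  by (simp add: edge_dist_def)

lemma ed_triangle: "ed a p r \<le> ed a p q + ed a q r"
  unfolding edge_dist_def sum.distrib[symmetric] distrib_left[symmetric]
  by (rule sum_mono) (use l_nonneg in \<open>auto intro!: mult_left_mono\<close>)

lemma ed_ge_edge: "e \<in> E \<Longrightarrow> l e * \<bar>nn a e p - nn a e q\<bar> \<le> ed a p q"
  unfolding edge_dist_def
  by (rule member_le_sum) (use l_nonneg in auto)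

lemma ed_within_edge:
  assumes "e \<in> E" "p \<in> R" "q \<in> R" "supp p \<subseteq> e" "supp q \<subseteq> e"
  shows "ed a p q = l e * \<bar>nn a e p - nn a e q\<bar>"
proof -
  have "ed a p q = (\<Sum>e'\<in>{e}. l e' * \<bar>nn a e' p - nn a e' q\<bar>)"
    unfolding edge_dist_def using assms nn_const_on_edge[of e _ p q a]
    by (intro sum.mono_neutral_right) auto
  then show ?thesis
    by simp
qed

lemma ed_segment:
  assumes "a \<in> V" "e \<in> E" "p \<in> R" "q \<in> R" "supp p \<subseteq> e" "supp q \<subseteq> e"
  shows "ed a p q = l e / 2 * (\<Sum>v\<in>e. \<bar>p v - q v\<bar>)"
proof -
  obtain u w where uw: "e = {u, w}" "u \<in> V" "w \<in> V" "u \<notin> fr a e" "w \<in> fr a e" "u \<noteq> w"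
    using assms(1,2) by (rule far_ends)
  have "p u = 1 - p w" "q u = 1 - q w"
    using edge_pt_of_supp assms uw by blast+
  then have "(\<Sum>v\<in>e. \<bar>p v - q v\<bar>) = 2 * \<bar>p w - q w\<bar>"
    using uw by simp
  then show ?thesis
    using ed_within_edge[OF assms(2-6)] nn_on_edge[OF uw(1,4,5)] assms by simp
qed

text \<open>A segment inside an edge changes only the coordinate of that edge, so a path is at least as
  long as the distance measured in coordinates.\<close>

lemma polygonal_path_lower:
  assumes "polygonal_path V E l p q L" "a \<in> V"
  shows "p \<in> R \<and> q \<in> R \<and> ed a p q \<le> L"
  using assms(1)
proof (induction rule: polygonal_path.induct)
  case (trivial p)
  then show ?case
    by simp
next
  case (segment p q L q' e)
  have "ed a q q' = l e / 2 * (\<Sum>v\<in>e. \<bar>q v - q' v\<bar>)"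
    by (rule ed_segment) (use segment assms(2) in auto)
  then show ?case
    using segment ed_triangle[of a p q' q] by linarith
qed

lemma polygonal_path_trans:
  assumes "polygonal_path V E l q r L'" "polygonal_path V E l p q L"
  shows "polygonal_path V E l p r (L + L')"
  using assms
proof (induction rule: polygonal_path.induct)
  case (trivial p')
  then show ?case
    by simp
next
  case (segment q r L' r' e)
  then show ?case
    using polygonal_path.segment[of V E l p r "L + L'" r' e] by (simp add: add.assoc)
qed

lemma polygonal_path_one:
  assumes "a \<in> V" "e \<in> E" "p \<in> R" "q \<in> R" "supp p \<subseteq> e" "supp q \<subseteq> e"
  shows "polygonal_path V E l p q (ed a p q)"
  using polygonal_path.segment[OF polygonal_path.trivial[OF assms(3)] assms(4,2,5,6), of l]
  unfolding ed_segment[OF assms] add_0 .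

text \<open>A point between two others with respect to every coordinate is passed without a detour.\<close>

lemma ed_via:
  assumes "\<And>e. e \<in> E \<Longrightarrow> nn a e p = nn a e c \<or> nn a e c = nn a e q"
  shows "ed a p q = ed a p c + ed a c q"
  unfolding edge_dist_def sum.distrib[symmetric]
proof (rule sum.cong)
  fix e
  assume "e \<in> E"
  then show "l e * \<bar>nn a e p - nn a e q\<bar> =
      l e * \<bar>nn a e p - nn a e c\<bar> + l e * \<bar>nn a e c - nn a e q\<bar>"
    using assms[of e] by auto
qed simp

text \<open>The step towards \<open>y\<close> changes a single coordinate and gives it the value that it has at \<open>y\<close>.
  Repeating such steps produces a path that attains the lower bound.\<close>

lemma step_vertices:
  assumes "a \<in> V" "x \<in> V" "y \<in> V" "x \<noteq> y"
  obtains z where "{x, z} \<in> E" "z \<in> V" "x \<noteq> z"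
    "nn a {x, z} (vertex_pt x) \<noteq> nn a {x, z} (vertex_pt y)"
    "nn a {x, z} (vertex_pt z) = nn a {x, z} (vertex_pt y)"
    "\<And>e. e \<in> E \<Longrightarrow> e \<noteq> {x, z} \<Longrightarrow> nn a e (vertex_pt z) = nn a e (vertex_pt x)"
proof -
  obtain z where z: "{x, z} \<in> E" "(z, y) \<in> (adj (E - {{x, z}}))\<^sup>*" "z \<in> V" "z \<noteq> x"
    using first_step[OF assms(2,3,4)] by blast
  have "x \<in> fr a {x, z} \<longleftrightarrow> y \<notin> fr a {x, z}"
    using far_of_step assms z by blast
  moreover have "z \<in> fr a {x, z} \<longleftrightarrow> y \<in> fr a {x, z}"
    using same_side_far[OF z(2,3)] by blast
  moreover have "nn a e (vertex_pt z) = nn a e (vertex_pt x)" if "e \<in> E" "e \<noteq> {x, z}" for e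
    by (rule nn_const_on_edge[of "{x, z}"]) (use that z assms vertex_pt_R in auto)
  ultimately show ?thesis
    using that[of z] z assms by (simp add: nn_vertex)
qed

lemma polygonal_path_vertices:
  assumes "a \<in> V" "x \<in> V" "y \<in> V"
  shows "polygonal_path V E l (vertex_pt x) (vertex_pt y) (ed a (vertex_pt x) (vertex_pt y))"
  using assms(2)
proof (induction "card {e \<in> E. nn a e (vertex_pt x) \<noteq> nn a e (vertex_pt y)}" arbitrary: x
    rule: less_induct)
  case less
  show ?case
  proof (cases "x = y")
    case True
    then show ?thesis
      using polygonal_path.trivial vertex_pt_R assms by simp
  next
    case False
    obtain z where z: "{x, z} \<in> E" "z \<in> V" "x \<noteq> z"
      "nn a {x, z} (vertex_pt x) \<noteq> nn a {x, z} (vertex_pt y)"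
      "nn a {x, z} (vertex_pt z) = nn a {x, z} (vertex_pt y)"
      "\<And>e. e \<in> E \<Longrightarrow> e \<noteq> {x, z} \<Longrightarrow> nn a e (vertex_pt z) = nn a e (vertex_pt x)"
      using step_vertices[OF assms(1) less(2) assms(3) False] by blast
    have "{e \<in> E. nn a e (vertex_pt z) \<noteq> nn a e (vertex_pt y)}
      \<subset> {e \<in> E. nn a e (vertex_pt x) \<noteq> nn a e (vertex_pt y)}"
    proof (rule psubsetI)
      show "{e \<in> E. nn a e (vertex_pt z) \<noteq> nn a e (vertex_pt y)}
        \<subseteq> {e \<in> E. nn a e (vertex_pt x) \<noteq> nn a e (vertex_pt y)}"
        using z(5,6) by force
      show "{e \<in> E. nn a e (vertex_pt z) \<noteq> nn a e (vertex_pt y)}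
        \<noteq> {e \<in> E. nn a e (vertex_pt x) \<noteq> nn a e (vertex_pt y)}"
        using z(1,4,5) by blast
    qed
    then have "polygonal_path V E l (vertex_pt z) (vertex_pt y) (ed a (vertex_pt z) (vertex_pt y))"
      using less(1) z(2) by (simp add: psubset_card_mono)
    moreover have "polygonal_path V E l (vertex_pt x) (vertex_pt z) (ed a (vertex_pt x) (vertex_pt z))"
      by (rule polygonal_path_one[OF assms(1) z(1)]) (use z less(2) vertex_pt_R in auto)
    moreover have "ed a (vertex_pt x) (vertex_pt y) =
        ed a (vertex_pt x) (vertex_pt z) + ed a (vertex_pt z) (vertex_pt y)"
    proof (rule ed_via)
      fix e
      assume "e \<in> E"
      then show "nn a e (vertex_pt x) = nn a e (vertex_pt z) \<or>
          nn a e (vertex_pt z) = nn a e (vertex_pt y)"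
        using z(5) z(6)[of e] by (cases "e = {x, z}") auto
    qed
    ultimately show ?thesis
      using polygonal_path_trans by simp
  qed
qed

text \<open>A path from a point of an edge to a point outside this edge leaves through the end that lies
  on the side of the target.\<close>

lemma exit_vertex:
  assumes "a \<in> V" "p \<in> R" "q \<in> R" "\<not> (\<exists>e\<in>E. supp p \<subseteq> e \<and> supp q \<subseteq> e)"
  obtains c where "c \<in> V" "polygonal_path V E l p (vertex_pt c) (ed a p (vertex_pt c))"
    "polygonal_path V E l (vertex_pt c) p (ed a (vertex_pt c) p)"
    "ed a p q = ed a p (vertex_pt c) + ed a (vertex_pt c) q"
  using assms(2)
proof (cases rule: R_cases)
  case (vertex v)
  then show ?thesis
    using that[of v] polygonal_path.trivial assms by auto
next
  case edge
  let ?e = "supp p"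
  obtain u w where uw: "?e = {u, w}" "u \<in> V" "w \<in> V" "u \<notin> fr a ?e" "w \<in> fr a ?e" "u \<noteq> w"
    using assms(1) edge by (rule far_ends)
  have "supp q \<noteq> ?e"
    using assms(4) edge by blast
  then have "nn a ?e q = 0 \<or> nn a ?e q = 1"
    using nn_frac_supp[OF edge assms(3), of a] nn_nonneg[OF assms(3), of a ?e]
      nn_le_1[OF assms(3), of a ?e] by linarith
  moreover have "nn a ?e (vertex_pt u) = 0" "nn a ?e (vertex_pt w) = 1" "u \<in> ?e" "w \<in> ?e"
    using uw by (auto simp only: nn_vertex if_True if_False)
  ultimately obtain c where c: "c \<in> ?e" "c \<in> V" "nn a ?e (vertex_pt c) = nn a ?e q"
    using uw(2,3) by metis
  have "ed a p q = ed a p (vertex_pt c) + ed a (vertex_pt c) q"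
  proof (rule ed_via)
    fix e
    assume "e \<in> E"
    then show "nn a e p = nn a e (vertex_pt c) \<or> nn a e (vertex_pt c) = nn a e q"
      using c nn_const_on_edge[OF edge, of e p "vertex_pt c" a] assms vertex_pt_R
      by (cases "e = ?e") auto
  qed
  then show ?thesis
    using that[of c] polygonal_path_one[OF assms(1) edge] assms vertex_pt_R c by auto
qed

lemma polygonal_path_upper:
  assumes "a \<in> V" "p \<in> R" "q \<in> R"
  shows "polygonal_path V E l p q (ed a p q)"
proof -
  have from_vertex: "polygonal_path V E l (vertex_pt c) q (ed a (vertex_pt c) q)"
    if c: "c \<in> V" for c
  proof (cases "\<exists>e\<in>E. supp (vertex_pt c) \<subseteq> e \<and> supp q \<subseteq> e")
    case True
    then show ?thesis
      using polygonal_path_one assms vertex_pt_R c by blast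
  next
    case False
    then have "\<not> (\<exists>e\<in>E. supp q \<subseteq> e \<and> supp (vertex_pt c) \<subseteq> e)"
      by blast
    then obtain d where d: "d \<in> V" "polygonal_path V E l (vertex_pt d) q (ed a (vertex_pt d) q)"
      "ed a q (vertex_pt c) = ed a q (vertex_pt d) + ed a (vertex_pt d) (vertex_pt c)"
      using exit_vertex[OF assms(1,3) vertex_pt_R[OF c]] by blast
    then show ?thesis
      using polygonal_path_trans[OF d(2) polygonal_path_vertices[OF assms(1) c d(1)]]
        ed_sym[of a] by (simp add: add.commute)
  qed
  show ?thesis
  proof (cases "\<exists>e\<in>E. supp p \<subseteq> e \<and> supp q \<subseteq> e")
    case True
    then show ?thesis
      using polygonal_path_one assms by blast
  next
    case False
    then obtain c where c: "c \<in> V" "polygonal_path V E l p (vertex_pt c) (ed a p (vertex_pt c))"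
      "ed a p q = ed a p (vertex_pt c) + ed a (vertex_pt c) q"
      using exit_vertex[OF assms] by blast
    then show ?thesis
      using polygonal_path_trans[OF from_vertex] by simp
  qed
qed

theorem path_dist_eq:
  assumes "a \<in> V" "p \<in> R" "q \<in> R"
  shows "path_dist V E l p q = ed a p q"
  unfolding path_dist_def
  by (rule cInf_eq_minimum)
    (use polygonal_path_upper[OF assms] polygonal_path_lower[OF _ assms(1)] in auto)

end

section \<open>Total length and leaves are determined by any model\<close>

definition graph_leaves :: "nat set \<Rightarrow> nat set set \<Rightarrow> nat set" where
  "graph_leaves V E = {v \<in> V. card {e \<in> E. v \<in> e} = 1}"

context metric_graph_tree
begin

text \<open>Seen from the root \<open>v\<close>, the far sides of the edges at \<open>v\<close> are the branches at \<open>v\<close>.\<close>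

lemma root_branches_disjoint:
  assumes "v \<in> V" "e1 \<in> E" "e2 \<in> E" "e1 \<noteq> e2" "v \<in> e1" "v \<in> e2"
  shows "fr v e1 \<inter> fr v e2 = {}"
proof -
  have not_sub: "\<not> fr v e \<subseteq> fr v e'" if e: "e \<in> E" and "e' \<in> E" "e \<noteq> e'" "v \<in> e" "v \<in> e'" for e e'
  proof
    assume sub: "fr v e \<subseteq> fr v e'"
    obtain u w where "e = {u, w}" "w \<in> fr v e"
      using assms(1) e by (rule far_ends)
    then have "e \<subseteq> fr v e'"
      using other_edge_meets_far[of e' e w v] that sub by auto
    then show False
      using that root_not_far by auto
  qed
  then show ?thesis
    using laminar[OF assms(1-3)] assms by metis
qed

lemma root_branch_unique:
  assumes "v \<in> V" "e1 \<in> E" "e2 \<in> E" "e1 \<noteq> e2" "v \<in> e1" "v \<in> e2" "p \<in> R" "0 < nn v e1 p"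
  shows "nn v e2 p = 0"
proof (rule nn_zero, rule ccontr)
  assume meets2: "supp p \<inter> fr v e2 \<noteq> {}"
  obtain x where x: "x \<in> supp p" "x \<in> fr v e1"
    using nn_pos_meets[OF assms(8)] by auto
  obtain y where y: "y \<in> supp p" "y \<in> fr v e2"
    using meets2 by auto
  have disj: "fr v e1 \<inter> fr v e2 = {}"
    by (rule root_branches_disjoint) (use assms in auto)
  then have "x \<noteq> y"
    using x y by auto
  then have edge: "supp p \<in> E"
    using assms(7) x y by (auto simp: realization_def)
  show False
  proof (cases "supp p = e1")
    case True
    obtain u w where uw: "e1 = {u, w}" "w \<in> fr v e1"
      using assms(1,2) by (rule far_ends)
    have "y \<in> {u, w}" "v \<in> {u, w}"
      using y(1) assms(5) unfolding True uw(1)[symmetric] by blast+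
    moreover have "v \<noteq> w" "y \<noteq> w" "y \<noteq> v"
      using uw(2) disj y(2) root_not_far by blast+
    ultimately show False
      by blast
  next
    case False
    then have "supp p \<subseteq> fr v e1"
      using other_edge_meets_far[OF assms(2) edge _ x] by auto
    then show False
      using disj y by auto
  qed
qed

lemma root_branch_exists:
  assumes "v \<in> V" "p \<in> R" "p \<noteq> vertex_pt v"
  obtains e where "e \<in> E" "v \<in> e" "0 < nn v e p"
proof -
  have "supp p \<noteq> {v}"
    using vertex_pt_of_supp assms by blast
  then obtain y where y: "y \<in> supp p" "y \<noteq> v"
    using R_supp_nonempty[OF assms(2)] by blast
  then have "y \<in> V"
    using R_supp_subset[OF assms(2)] by blast
  then obtain z where z: "{v, z} \<in> E" "(z, y) \<in> (adj (E - {{v, z}}))\<^sup>*"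
    using first_step[OF assms(1) \<open>y \<in> V\<close>] y(2) by blast
  then have "y \<in> fr v {v, z}"
    using far_of_step[OF assms(1) z \<open>y \<in> V\<close>] root_not_far by blast
  then have "0 < nn v {v, z} p"
    using nn_pos_of_meets assms(2) y by blast
  then show ?thesis
    using that z by auto
qed

lemma vertex_in_edge:
  assumes "E \<noteq> {}" "v \<in> V"
  obtains e where "e \<in> E" "v \<in> e"
proof -
  obtain e where e: "e \<in> E"
    using assms by auto
  obtain u w where "e = {u, w}" "u \<noteq> w" "u \<in> V" "w \<in> V"
    using e by (rule edge_ends)
  then obtain y where "y \<in> V" "y \<noteq> v"
    by metis
  then obtain z where "{v, z} \<in> E"
    using first_step[OF assms(2) \<open>y \<in> V\<close>] by blast
  then show ?thesis
    using that by blast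
qed

lemma supp_in_edge:
  assumes "E \<noteq> {}" "p \<in> R"
  obtains e where "e \<in> E" "supp p \<subseteq> e"
  using assms(2)
proof (cases rule: R_cases)
  case (vertex v)
  then show ?thesis
    using vertex_in_edge[OF assms(1)] that by auto
next
  case edge
  then show ?thesis
    using that by blast
qed

lemma R_no_edges: "E = {} \<Longrightarrow> p \<in> R \<Longrightarrow> q \<in> R \<Longrightarrow> p = q"
proof -
  assume *: "E = {}" "p \<in> R" "q \<in> R"
  obtain v w where "v \<in> V" "p = vertex_pt v" "w \<in> V" "q = vertex_pt w"
    using R_cases[OF *(2)] R_cases[OF *(3)] *(1) by (metis empty_iff)
  then show "p = q"
    using first_step[of v w] *(1) by blast
qed

lemma ed_edge_pt:
  assumes "a \<in> V" "{x, y} \<in> E" "0 \<le> \<theta>" "\<theta> \<le> 1" "0 \<le> \<theta>'" "\<theta>' \<le> 1"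
  shows "ed a (edge_pt x y \<theta>) (edge_pt x y \<theta>') = l {x, y} * \<bar>\<theta> - \<theta>'\<bar>"
proof -
  have xy: "x \<noteq> y"
    using assms(2) no_edge_self by auto
  have "ed a (edge_pt x y \<theta>) (edge_pt x y \<theta>') =
      l {x, y} / 2 * (\<Sum>v\<in>{x, y}. \<bar>edge_pt x y \<theta> v - edge_pt x y \<theta>' v\<bar>)"
    by (rule ed_segment) (use assms edge_pt_R supp_edge_pt in auto)
  also have "(\<Sum>v\<in>{x, y}. \<bar>edge_pt x y \<theta> v - edge_pt x y \<theta>' v\<bar>) = 2 * \<bar>\<theta> - \<theta>'\<bar>"
    using xy by (auto simp: edge_pt_def vertex_pt_def)
  finally show ?thesis
    by simp
qed

end

locale tree_metric = metric_graph_tree V E l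
  for V :: "nat set" and E :: "nat set set" and l :: "nat set \<Rightarrow> real" +
  fixes M :: "'a metric" and f :: "'a \<Rightarrow> nat \<Rightarrow> real"
  assumes bij_f: "bij_betw f (mspace M) (realization V E)"
    and dist_path: "x \<in> mspace M \<Longrightarrow> y \<in> mspace M \<Longrightarrow> mdist M x y = path_dist V E l (f x) (f y)"

lemma tree_model_iff: "tree_model M V E l \<longleftrightarrow> (\<exists>f. tree_metric V E l M f)"
  unfolding tree_model_def tree_metric_def tree_metric_axioms_def metric_graph_tree_def
    metric_graph_tree_axioms_def graph_tree_def by blast

context tree_metric
begin

definition g :: "(nat \<Rightarrow> real) \<Rightarrow> 'a" where
  "g = inv_into (mspace M) f"

abbreviation X :: "'a topology" where
  "X \<equiv> mtopology_of M"

lemma f_R [simp]: "x \<in> mspace M \<Longrightarrow> f x \<in> R"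
  using bij_f by (auto simp: bij_betw_def)

lemma g_in [simp]: "p \<in> R \<Longrightarrow> g p \<in> mspace M"
  and fg [simp]: "p \<in> R \<Longrightarrow> f (g p) = p"
  using bij_f by (auto simp: g_def bij_betw_def inv_into_into f_inv_into_f)

lemma gf [simp]: "x \<in> mspace M \<Longrightarrow> g (f x) = x"
  using bij_f by (auto simp: g_def bij_betw_def)

lemma f_inj: "x \<in> mspace M \<Longrightarrow> y \<in> mspace M \<Longrightarrow> f x = f y \<Longrightarrow> x = y"
  using gf by metis

lemma dist_ed: "a \<in> V \<Longrightarrow> x \<in> mspace M \<Longrightarrow> y \<in> mspace M \<Longrightarrow> mdist M x y = ed a (f x) (f y)"
  by (simp add: dist_path path_dist_eq)

lemma dist_g: "a \<in> V \<Longrightarrow> p \<in> R \<Longrightarrow> q \<in> R \<Longrightarrow> mdist M (g p) (g q) = ed a p q"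
  by (simp add: dist_ed)

lemma continuous_map_nn:
  assumes "e \<in> E" "a \<in> V"
  shows "continuous_map X euclideanreal (\<lambda>x. nn a e (f x))"
proof -
  have "dist (nn a e (f x)) (nn a e (f y)) \<le> 1 / l e * mdist M x y"
    if "x \<in> mspace M" "y \<in> mspace M" for x y
    using ed_ge_edge[OF assms(1), of a "f x" "f y"] dist_ed[OF assms(2) that] l_pos[OF assms(1)]
    by (simp add: dist_real_def field_simps)
  then have "Lipschitz_continuous_map M euclidean_metric (\<lambda>x. nn a e (f x))"
    unfolding Lipschitz_continuous_map_def by (auto intro!: exI[of _ "1 / l e"])
  then show ?thesis
    using Lipschitz_continuous_imp_continuous_map by fastforce
qed

lemma edge_path_continuous:
  assumes "{x, y} \<in> E"
  shows "continuous_map (top_of_set {0..1}) X (\<lambda>\<theta>. g (edge_pt x y \<theta>))"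
proof -
  have "x \<in> V"
    using assms edge_card by auto
  then have "mdist M (g (edge_pt x y \<theta>)) (g (edge_pt x y \<theta>')) \<le> l {x, y} * dist \<theta> \<theta>'"
    if "\<theta> \<in> {0..1}" "\<theta>' \<in> {0..1}" for \<theta> \<theta>'
    using that assms by (simp add: dist_g edge_pt_R ed_edge_pt dist_real_def)
  then have "Lipschitz_continuous_map (submetric euclidean_metric {0..1}) M (\<lambda>\<theta>. g (edge_pt x y \<theta>))"
    unfolding Lipschitz_continuous_map_def using assms
    by (auto simp: edge_pt_R intro!: exI[of _ "l {x, y}"])
  then show ?thesis
    using Lipschitz_continuous_imp_continuous_map by (fastforce simp: mtopology_of_submetric)
qed

lemma edge_path_connected:
  assumes "{x, y} \<in> E" "connected A" "A \<subseteq> {0..1}"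
  shows "connectedin X ((\<lambda>\<theta>. g (edge_pt x y \<theta>)) ` A)"
  by (rule connectedin_continuous_map_image[OF edge_path_continuous[OF assms(1)]])
    (use assms in \<open>simp add: connectedin_subtopology\<close>)

definition spanned :: "nat set \<Rightarrow> 'a set" where
  "spanned W = {x \<in> mspace M. supp (f x) \<subseteq> W}"

lemma edge_segment:
  assumes "{x, y} \<in> E"
  shows "(\<lambda>\<theta>. g (edge_pt x y \<theta>)) ` {0..1} = spanned {x, y}"
proof -
  have xy: "x \<in> V" "y \<in> V" "x \<noteq> y"
    using assms edge_card no_edge_self by auto
  have "z \<in> (\<lambda>\<theta>. g (edge_pt x y \<theta>)) ` {0..1}" if "z \<in> spanned {x, y}" for z
  proof -
    have z: "z \<in> mspace M" "f z \<in> R" "supp (f z) \<subseteq> {x, y}"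
      using that by (auto simp: spanned_def)
    show ?thesis
      using edge_pt_of_supp[OF z(2,3)] xy gf[OF z(1)] by (intro image_eqI[of _ _ "f z y"]) auto
  qed
  then show ?thesis
    using supp_edge_pt assms by (auto simp: spanned_def edge_pt_R) blast
qed

lemma spanned_connected:
  assumes "W \<subseteq> V" "\<And>x y. x \<in> W \<Longrightarrow> y \<in> W \<Longrightarrow> (x, y) \<in> (adj {e \<in> E. e \<subseteq> W})\<^sup>*"
  shows "connectedin X (spanned W)"
proof -
  define Y where "Y = subtopology X (spanned W)"
  have sub: "spanned W \<subseteq> topspace X"
    by (auto simp: spanned_def)
  have in_edge: "connected_component_of Y z z'"
    if "e \<in> E" "e \<subseteq> W" "z \<in> spanned e" "z' \<in> spanned e" for e z z'
  proof -
    obtain x y where e: "e = {x, y}"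
      using \<open>e \<in> E\<close> by (rule edge_ends)
    have "connectedin X (spanned e)"
      using edge_segment[of x y] edge_path_connected[of x y "{0..1}"] that(1) e by simp
    moreover have "spanned e \<subseteq> spanned W"
      using that by (auto simp: spanned_def)
    ultimately show ?thesis
      using that unfolding connected_component_of_def Y_def by (auto simp: connectedin_subtopology)
  qed
  have vertices: "connected_component_of Y (g (vertex_pt x)) (g (vertex_pt y))"
    if "x \<in> W" "y \<in> W" for x y
    using assms(2)[OF that]
  proof (induction rule: rtrancl_induct)
    case base
    have "g (vertex_pt x) \<in> spanned W"
      using that assms(1) vertex_pt_R by (auto simp: spanned_def subset_iff)
    then show ?case
      using sub by (auto simp: connected_component_of_refl Y_def)
  next
    case (step y z)
    then have "{y, z} \<in> E" "{y, z} \<subseteq> W"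
      by (auto simp: adj_def)
    then have "connected_component_of Y (g (vertex_pt y)) (g (vertex_pt z))"
      using assms(1) vertex_pt_R by (intro in_edge[of "{y, z}"]) (auto simp: spanned_def subset_iff)
    then show ?case
      using step connected_component_of_trans by metis
  qed
  have to_vertex: "\<exists>x\<in>W. connected_component_of Y z (g (vertex_pt x))" if z: "z \<in> spanned W" for z
  proof -
    have fz: "f z \<in> R" "supp (f z) \<subseteq> W" "z \<in> mspace M"
      using z by (auto simp: spanned_def)
    from fz(1) show ?thesis
    proof (cases rule: R_cases)
      case (vertex v)
      then have v: "g (vertex_pt v) = z" "v \<in> W"
        using gf[OF fz(3)] fz(2) by auto
      have "connected_component_of Y z (g (vertex_pt v))"
        unfolding v(1) using z sub by (auto simp: connected_component_of_refl Y_def)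
      then show ?thesis
        using v(2) by blast
    next
      case edge
      obtain x y where xy: "supp (f z) = {x, y}" "x \<in> V"
        using edge by (rule edge_ends)
      then have "connected_component_of Y z (g (vertex_pt x))"
        using fz edge by (intro in_edge[of "{x, y}"]) (auto simp: spanned_def vertex_pt_R)
      then show ?thesis
        using xy fz by auto
    qed
  qed
  have "connected_component_of Y z z'" if z: "z \<in> spanned W" and z': "z' \<in> spanned W" for z z'
  proof -
    obtain x where x: "x \<in> W" "connected_component_of Y z (g (vertex_pt x))"
      using to_vertex[OF z] by blast
    obtain y where y: "y \<in> W" "connected_component_of Y z' (g (vertex_pt y))"
      using to_vertex[OF z'] by blast
    from x(2) vertices[OF x(1) y(1)] have "connected_component_of Y z (g (vertex_pt y))"
      by (rule connected_component_of_trans)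
    moreover from y(2) have "connected_component_of Y (g (vertex_pt y)) z'"
      by (simp add: connected_component_of_sym)
    ultimately show ?thesis
      by (rule connected_component_of_trans)
  qed
  then have "connected_space Y"
    by (auto simp: connected_space_iff_connected_component Y_def)
  then show ?thesis
    using sub by (simp add: connectedin_def Y_def)
qed

text \<open>Points that are \<open>\<epsilon>\<close>-separated: on an edge of length \<open>l e\<close> there is room for at least
  \<open>l e / \<epsilon> - 2\<close> of them even if they keep the distance \<open>\<epsilon>\<close> from the ends, and at most for
  \<open>l e / \<epsilon> + 1\<close>. The packing numbers thus determine the total length up to \<open>O(\<epsilon>)\<close>.\<close>

lemma separated_points:
  assumes "0 < \<epsilon>"
  obtains I :: "(nat set \<times> nat) set" and q where "finite I" "(\<Sum>e\<in>E. l e / \<epsilon> - 2) \<le> card I"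
    "\<And>i. i \<in> I \<Longrightarrow> q i \<in> mspace M"
    "\<And>i j. i \<in> I \<Longrightarrow> j \<in> I \<Longrightarrow> i \<noteq> j \<Longrightarrow> \<epsilon> \<le> mdist M (q i) (q j)"
proof -
  obtain a where a: "a \<in> V"
    using V_nonempty by auto
  define K where "K e = nat (\<lfloor>l e / \<epsilon>\<rfloor> - 1)" for e
  define I where "I = Sigma E (\<lambda>e. {1..K e})"
  have pt_ex: "\<exists>p\<in>R. nn a e p = \<theta>" if e: "e \<in> E" and "0 \<le> \<theta>" "\<theta> \<le> 1" for e \<theta>
  proof -
    obtain u w where uw: "e = {u, w}" "u \<in> V" "w \<in> V" "u \<notin> fr a e" "w \<in> fr a e"
      using a e by (rule far_ends)
    then show ?thesis
      using that by (intro bexI[of _ "edge_pt u w \<theta>"]) (simp_all add: nn_edge_pt nn_vertex edge_pt_R)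
  qed
  define q where "q i = (SOME p. p \<in> R \<and> nn a (fst i) p = snd i * \<epsilon> / l (fst i))" for i :: "nat set \<times> nat"
  have K: "real k * \<epsilon> \<le> l e - \<epsilon>" if "e \<in> E" "k \<in> {1..K e}" for e k
  proof -
    have "real k \<le> l e / \<epsilon> - 1"
      using that unfolding K_def by (auto simp: le_nat_iff) linarith
    then show ?thesis
      using assms by (simp add: field_simps)
  qed
  have q: "q (e, k) \<in> R" "nn a e (q (e, k)) = k * \<epsilon> / l e" if "e \<in> E" "k \<in> {1..K e}" for e k
  proof -
    have "\<exists>p. p \<in> R \<and> nn a e p = k * \<epsilon> / l e"
      using pt_ex[OF that(1), of "k * \<epsilon> / l e"] K[OF that] l_pos[OF that(1)] assms
      by (auto simp: field_simps)
    from someI_ex[OF this] show "q (e, k) \<in> R" "nn a e (q (e, k)) = k * \<epsilon> / l e"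
      by (auto simp: q_def)
  qed
  have sep: "\<epsilon> \<le> ed a (q (e, k)) (q (e', k'))"
    if e: "e \<in> E" "k \<in> {1..K e}" and e': "e' \<in> E" "k' \<in> {1..K e'}" and ne: "(e, k) \<noteq> (e', k')"
    for e k e' k'
  proof -
    have le: "0 < l e"
      using l_pos e by auto
    have "\<epsilon> \<le> l e * \<bar>nn a e (q (e, k)) - nn a e (q (e', k'))\<bar>"
    proof (cases "e = e'")
      case True
      then have "1 \<le> \<bar>real k - real k'\<bar>"
        using ne by auto
      then have "\<epsilon> \<le> \<bar>real k - real k'\<bar> * \<epsilon>"
        using assms by simp
      also have "\<dots> = \<bar>(real k - real k') * \<epsilon>\<bar>"
        using assms by (simp add: abs_mult)
      also have "\<dots> = l e * \<bar>real k * \<epsilon> / l e - real k' * \<epsilon> / l e\<bar>"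
        using le by (simp add: left_diff_distrib flip: diff_divide_distrib)
      finally show ?thesis
        using q e e' True by simp
    next
      case False
      have "nn a e (q (e', k')) = 0 \<or> nn a e (q (e', k')) = 1"
      proof (rule ccontr)
        assume "\<not> ?thesis"
        then have "0 < nn a e (q (e', k'))" "nn a e (q (e', k')) < 1"
          using nn_nonneg[OF q(1)[OF e'], of a e] nn_le_1[OF q(1)[OF e'], of a e] by auto
        then have s1: "supp (q (e', k')) = e"
          using nn_frac_supp e q(1) e' by blast
        have "0 < nn a e' (q (e', k'))" "nn a e' (q (e', k')) < 1"
          unfolding q(2)[OF e'] using K[OF e'] l_pos[OF e'(1)] assms e'(2) by auto
        then have "supp (q (e', k')) = e'"
          using nn_frac_supp e' q(1) by blast
        then show False
          using s1 False by auto
      qed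
      moreover have "\<epsilon> \<le> real k * \<epsilon>"
        using e(2) assms by simp
      moreover have "l e * nn a e (q (e, k)) = real k * \<epsilon>"
        using q(2)[OF e] le by simp
      then have "l e * \<bar>nn a e (q (e, k)) - 0\<bar> = real k * \<epsilon>"
        "l e * \<bar>nn a e (q (e, k)) - 1\<bar> = l e - real k * \<epsilon>"
        using nn_nonneg[OF q(1)[OF e], of a e] nn_le_1[OF q(1)[OF e], of a e]
        by (simp_all add: algebra_simps)
      ultimately show ?thesis
        using K[OF e] by auto
    qed
    also have "\<dots> \<le> ed a (q (e, k)) (q (e', k'))"
      by (rule ed_ge_edge) (rule e)
    finally show ?thesis .
  qed
  have "(\<Sum>e\<in>E. l e / \<epsilon> - 2) \<le> (\<Sum>e\<in>E. real (K e))"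
  proof (rule sum_mono)
    fix e
    show "l e / \<epsilon> - 2 \<le> real (K e)"
      unfolding K_def by linarith
  qed
  also have "\<dots> = card I"
    by (simp add: I_def)
  finally have card: "(\<Sum>e\<in>E. l e / \<epsilon> - 2) \<le> card I" .
  show ?thesis
  proof (rule that[of I "\<lambda>i. g (q i)"])
    show "finite I"
      by (simp add: I_def)
    show "(\<Sum>e\<in>E. l e / \<epsilon> - 2) \<le> card I"
      by (rule card)
    show "g (q i) \<in> mspace M" if "i \<in> I" for i
      using that q by (auto simp: I_def)
    show "\<epsilon> \<le> mdist M (g (q i)) (g (q j))" if ij: "i \<in> I" "j \<in> I" "i \<noteq> j" for i j
    proof -
      obtain e k e' k' where "i = (e, k)" "j = (e', k')"
        by (metis surj_pair)
      then show ?thesis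
        using ij sep[of e k e' k'] q dist_g[OF a] by (auto simp: I_def)
    qed
  qed
qed

lemma separated_bound:
  assumes "0 < \<epsilon>" "finite I" "\<And>i. i \<in> I \<Longrightarrow> q i \<in> mspace M"
    and sep: "\<And>i j. i \<in> I \<Longrightarrow> j \<in> I \<Longrightarrow> i \<noteq> j \<Longrightarrow> \<epsilon> \<le> mdist M (q i) (q j)"
  shows "card I \<le> 1 + (\<Sum>e\<in>E. l e / \<epsilon> + 1)"
proof (cases "E = {}")
  case True
  have "i = j" if "i \<in> I" "j \<in> I" for i j
  proof -
    have "q i = q j"
      using f_inj R_no_edges[OF True, of "f (q i)" "f (q j)"] assms(3) that by auto
    moreover have "mdist M (q j) (q j) = 0"
      using V_nonempty dist_ed[of _ "q j" "q j"] assms(3)[OF that(2)] by auto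
    ultimately show ?thesis
      using sep[OF that] assms(1) by auto
  qed
  then have "card I \<le> 1"
    using assms(2) by (auto simp: card_le_Suc0_iff_eq)
  then show ?thesis
    using True by simp
next
  case False
  obtain a where a: "a \<in> V"
    using V_nonempty by auto
  define c where "c i = (SOME e. e \<in> E \<and> supp (f (q i)) \<subseteq> e)" for i
  have c: "c i \<in> E \<and> supp (f (q i)) \<subseteq> c i" if "i \<in> I" for i
    unfolding c_def by (rule someI_ex) (use supp_in_edge[OF False f_R[OF assms(3)[OF that]]] in blast)
  define k where "k i = nat \<lfloor>nn a (c i) (f (q i)) * l (c i) / \<epsilon>\<rfloor>" for i
  define J where "J = Sigma E (\<lambda>e. {0..nat \<lfloor>l e / \<epsilon>\<rfloor>})"
  have "inj_on (\<lambda>i. (c i, k i)) I"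
  proof (rule inj_onI, rule ccontr)
    fix i j
    assume ij: "i \<in> I" "j \<in> I" "(c i, k i) = (c j, k j)" "i \<noteq> j"
    let ?e = "c i"
    let ?x = "nn a ?e (f (q i)) * l ?e / \<epsilon>" and ?y = "nn a ?e (f (q j)) * l ?e / \<epsilon>"
    have le: "0 < l ?e"
      using l_pos c ij by auto
    have "0 \<le> ?x" "0 \<le> ?y"
      using nn_nonneg[OF f_R] assms ij le by auto
    moreover have "nat \<lfloor>?x\<rfloor> = nat \<lfloor>?y\<rfloor>"
      using ij(3) unfolding k_def by (metis prod.inject)
    ultimately have "\<lfloor>?x\<rfloor> = \<lfloor>?y\<rfloor>"
      by (simp add: eq_nat_nat_iff)
    then have "\<bar>?x - ?y\<bar> < 1"
      by linarith
    moreover have "?x - ?y = (l ?e * (nn a ?e (f (q i)) - nn a ?e (f (q j)))) / \<epsilon>"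
      by (simp add: right_diff_distrib diff_divide_distrib mult.commute)
    ultimately have "l ?e * \<bar>nn a ?e (f (q i)) - nn a ?e (f (q j))\<bar> < \<epsilon>"
      using assms(1) le by (simp add: abs_mult)
    moreover have "mdist M (q i) (q j) = l ?e * \<bar>nn a ?e (f (q i)) - nn a ?e (f (q j))\<bar>"
      using dist_ed[OF a] ed_within_edge[of ?e] c[OF ij(1)] c[OF ij(2)] ij assms(3) by auto
    ultimately show False
      using sep[OF ij(1,2,4)] by simp
  qed
  moreover have "(\<lambda>i. (c i, k i)) ` I \<subseteq> J"
  proof -
    have "k i \<le> nat \<lfloor>l (c i) / \<epsilon>\<rfloor>" if "i \<in> I" for i
    proof -
      have "nn a (c i) (f (q i)) * l (c i) \<le> 1 * l (c i)"
        using nn_le_1[OF f_R[OF assms(3)[OF that]]] c[OF that] l_nonneg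
        by (intro mult_right_mono) auto
      then show ?thesis
        unfolding k_def using assms(1) by (intro nat_mono floor_mono divide_right_mono) auto
    qed
    then show ?thesis
      using c by (auto simp: J_def)
  qed
  moreover have "finite J"
    by (simp add: J_def)
  ultimately have "card I \<le> card J"
    using card_inj_on_le by blast
  also have "card J = (\<Sum>e\<in>E. nat \<lfloor>l e / \<epsilon>\<rfloor> + 1)"
    by (simp add: J_def)
  finally have "real (card I) \<le> (\<Sum>e\<in>E. real (nat \<lfloor>l e / \<epsilon>\<rfloor> + 1))"
    by (metis of_nat_le_iff of_nat_sum)
  also have "\<dots> \<le> (\<Sum>e\<in>E. l e / \<epsilon> + 1)"
  proof (rule sum_mono)
    fix e
    assume "e \<in> E"
    then have "0 \<le> l e / \<epsilon>"
      using l_nonneg assms(1) by simp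
    then show "real (nat \<lfloor>l e / \<epsilon>\<rfloor> + 1) \<le> l e / \<epsilon> + 1"
      by simp
  qed
  finally show ?thesis
    by simp
qed

end

text \<open>Comparing the packing bounds of the two models at scale \<open>\<epsilon>\<close> costs a bounded number of points,
  that is, a length of order \<open>\<epsilon>\<close>.\<close>

lemma length_le_of_models:
  assumes "tree_metric V E l M f" "tree_metric V' E' l' M f'"
  shows "(\<Sum>e\<in>E. l e) \<le> (\<Sum>e\<in>E'. l' e)"
proof -
  interpret A: tree_metric V E l M f
    by (rule assms(1))
  interpret B: tree_metric V' E' l' M f'
    by (rule assms(2))
  define C where "C = 1 + real (card E') + 2 * real (card E)"
  have bound: "(\<Sum>e\<in>E. l e) \<le> (\<Sum>e\<in>E'. l' e) + \<epsilon> * C" if eps: "0 < \<epsilon>" for \<epsilon>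
  proof -
    obtain I :: "(nat set \<times> nat) set" and q where I: "finite I" "(\<Sum>e\<in>E. l e / \<epsilon> - 2) \<le> card I"
      "\<And>i. i \<in> I \<Longrightarrow> q i \<in> mspace M"
      "\<And>i j. i \<in> I \<Longrightarrow> j \<in> I \<Longrightarrow> i \<noteq> j \<Longrightarrow> \<epsilon> \<le> mdist M (q i) (q j)"
      using A.separated_points[OF eps] by blast
    have "(\<Sum>e\<in>E. l e / \<epsilon> - 2) \<le> 1 + (\<Sum>e\<in>E'. l' e / \<epsilon> + 1)"
      using B.separated_bound[of \<epsilon> I q, OF eps I(1,3,4)] I(2) by linarith
    then have "(\<Sum>e\<in>E. l e) / \<epsilon> - 2 * card E \<le> 1 + (\<Sum>e\<in>E'. l' e) / \<epsilon> + card E'"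
      by (simp add: sum_subtractf sum.distrib sum_divide_distrib)
    then have "(\<Sum>e\<in>E. l e) / \<epsilon> \<le> (\<Sum>e\<in>E'. l' e) / \<epsilon> + C"
      by (simp add: C_def)
    then have "(\<Sum>e\<in>E. l e) / \<epsilon> * \<epsilon> \<le> ((\<Sum>e\<in>E'. l' e) / \<epsilon> + C) * \<epsilon>"
      using eps by (intro mult_right_mono) auto
    then show ?thesis
      using eps by (simp add: algebra_simps)
  qed
  have "0 < C"
    by (simp add: C_def)
  show ?thesis
  proof (rule field_le_epsilon)
    fix d :: real
    assume "0 < d"
    then show "(\<Sum>e\<in>E. l e) \<le> (\<Sum>e\<in>E'. l' e) + d"
      using bound[of "d / C"] \<open>0 < C\<close> by simp
  qed
qed

theorem tree_length_eq:
  assumes "tree_model M V E l"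
  shows "tree_length M = (\<Sum>e\<in>E. l e)"
  unfolding tree_length_def
proof (rule the_equality)
  show "\<exists>V' E' l'. tree_model M V' E' l' \<and> (\<Sum>e\<in>E. l e) = (\<Sum>e\<in>E'. l' e)"
    using assms by blast
next
  fix L
  assume "\<exists>V E l. tree_model M V E l \<and> L = (\<Sum>e\<in>E. l e)"
  then show "L = (\<Sum>e\<in>E. l e)"
    using assms length_le_of_models by (metis antisym tree_model_iff)
qed

context tree_metric
begin

text \<open>A point that is alone on its level of a continuous function, with values on both sides, cuts
  the space. At an interior point of an edge the coordinate of that edge serves, at a vertex where two
  edges meet a combination of the coordinates of its edges.\<close>

lemma not_connected_at_level:
  assumes "continuous_map X euclideanreal \<phi>" "y \<in> mspace M" "z \<in> mspace M"
    and "\<phi> y < \<phi> x" "\<phi> x < \<phi> z" "\<And>y. y \<in> mspace M \<Longrightarrow> \<phi> y = \<phi> x \<Longrightarrow> y = x"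
  shows "\<not> connectedin X (mspace M - {x})"
proof
  assume "connectedin X (mspace M - {x})"
  then have "connected (\<phi> ` (mspace M - {x}))"
    using connectedin_continuous_map_image[OF assms(1)] by simp
  moreover have "\<phi> y \<in> \<phi> ` (mspace M - {x})" "\<phi> z \<in> \<phi> ` (mspace M - {x})"
    using assms by auto
  ultimately have "\<phi> x \<in> \<phi> ` (mspace M - {x})"
    using assms(4,5) by (meson connectedD_interval less_imp_le)
  then show False
    using assms(6) by force
qed

lemma not_connected_edge_point:
  assumes "x \<in> mspace M" "supp (f x) \<in> E"
  shows "\<not> connectedin X (mspace M - {x})"
proof -
  obtain a where a: "a \<in> V"
    using V_nonempty by auto
  let ?e = "supp (f x)"
  obtain u w where uw: "?e = {u, w}" "u \<in> V" "w \<in> V" "u \<notin> fr a ?e" "w \<in> fr a ?e" "u \<noteq> w"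
    using a assms(2) by (rule far_ends)
  have fx: "f x \<in> R"
    using assms by simp
  have nx: "nn a ?e (f x) = f x w"
    by (rule nn_on_edge[OF uw(1,4,5) fx]) simp
  have "f x u \<noteq> 0" "f x w \<noteq> 0"
    using uw(1) unfolding supp_def by blast+
  then have w: "0 < f x w" "f x w < 1"
    using R_nonneg[OF fx, of w] R_nonneg[OF fx, of u] edge_pt_of_supp(2)[OF fx, of u w] uw by auto
  show ?thesis
  proof (rule not_connected_at_level[OF continuous_map_nn[OF assms(2) a],
        of "g (vertex_pt u)" "g (vertex_pt w)"])
    show "g (vertex_pt u) \<in> mspace M" "g (vertex_pt w) \<in> mspace M"
      using uw vertex_pt_R by auto
    show "nn a ?e (f (g (vertex_pt u))) < nn a ?e (f x)"
      using w nx uw vertex_pt_R by (simp add: nn_vertex)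
    show "nn a ?e (f x) < nn a ?e (f (g (vertex_pt w)))"
      using w nx uw vertex_pt_R by (simp add: nn_vertex)
    show "y = x" if y: "y \<in> mspace M" "nn a ?e (f y) = nn a ?e (f x)" for y
    proof -
      have s: "supp (f y) = {u, w}"
        using nn_frac_supp[OF assms(2) f_R[OF y(1)], of a] y(2) nx w uw(1) by simp
      then have "nn a ?e (f y) = f y w"
        using nn_on_edge[OF uw(1,4,5) f_R[OF y(1)]] uw(1) by simp
      then have "f y = f x"
        using edge_pt_of_supp(1)[OF f_R[OF y(1)], of u w] edge_pt_of_supp(1)[OF fx, of u w] s uw nx y
        by (metis subset_refl)
      then show "y = x"
        using f_inj y assms by blast
    qed
  qed
qed

lemma not_connected_inner_vertex:
  assumes "x \<in> mspace M" "f x = vertex_pt v" "v \<in> V" "e1 \<in> E" "e2 \<in> E" "e1 \<noteq> e2" "v \<in> e1" "v \<in> e2"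
  shows "\<not> connectedin X (mspace M - {x})"
proof -
  \<comment> \<open>Positive on the branch of \<open>e1\<close>, negative on all other branches, zero only at \<open>x\<close>.\<close>
  define \<phi> where "\<phi> y = nn v e1 (f y) - (\<Sum>e \<in> {e \<in> E. v \<in> e} - {e1}. nn v e (f y))" for y
  have pos: "\<phi> y > 0" if "y \<in> mspace M" "0 < nn v e1 (f y)" for y
  proof -
    have "nn v e (f y) = 0" if "e \<in> {e \<in> E. v \<in> e} - {e1}" for e
      using root_branch_unique[of v e1 e "f y"] assms that \<open>y \<in> mspace M\<close> \<open>0 < nn v e1 (f y)\<close> by auto
    then show ?thesis
      using that by (simp add: \<phi>_def)
  qed
  have neg: "\<phi> y < 0" if y: "y \<in> mspace M" and e: "e \<in> E" "v \<in> e" "e \<noteq> e1" "0 < nn v e (f y)" for y e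
  proof -
    have "nn v e1 (f y) = 0"
      using root_branch_unique[of v e e1 "f y"] assms e y by auto
    moreover have "0 < (\<Sum>e \<in> {e \<in> E. v \<in> e} - {e1}. nn v e (f y))"
      using e y nn_nonneg by (intro sum_pos2[of _ e]) auto
    ultimately show ?thesis
      by (simp add: \<phi>_def)
  qed
  have zero: "\<phi> x = 0"
    using nn_root assms by (simp add: \<phi>_def)
  have end_pt: "\<exists>y\<in>mspace M. 0 < nn v e (f y)" if e: "e \<in> E" for e
  proof -
    obtain u w where "w \<in> V" "w \<in> fr v e"
      using assms(3) e by (rule far_ends)
    then show ?thesis
      using vertex_pt_R by (intro bexI[of _ "g (vertex_pt w)"]) (auto simp: nn_vertex)
  qed
  obtain y where y: "y \<in> mspace M" "0 < nn v e2 (f y)"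
    using end_pt assms by blast
  obtain z where z: "z \<in> mspace M" "0 < nn v e1 (f z)"
    using end_pt assms by blast
  show ?thesis
  proof (rule not_connected_at_level[of \<phi> y z])
    show "continuous_map X euclideanreal \<phi>"
      unfolding \<phi>_def by (intro continuous_map_diff continuous_map_sum continuous_map_nn) (use assms in auto)
    show "\<phi> y < \<phi> x" "\<phi> x < \<phi> z"
      using zero pos[OF z] neg[OF y(1), of e2] y assms by auto
    show "y' = x" if y': "y' \<in> mspace M" "\<phi> y' = \<phi> x" for y'
    proof (rule ccontr)
      assume "y' \<noteq> x"
      then have "f y' \<noteq> vertex_pt v"
        using f_inj assms y' by metis
      then obtain e where "e \<in> E" "v \<in> e" "0 < nn v e (f y')"
        using root_branch_exists[OF assms(3) f_R[OF y'(1)]] by blast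
      then show False
        using pos[of y'] neg[of y' e] y' zero by fastforce
    qed
  qed (use y z in auto)
qed

text \<open>Without the leaf \<open>v\<close> there remain the part spanned by the other vertices and the half-open last
  edge, which meet at the neighbour of \<open>v\<close>.\<close>

lemma connected_leaf:
  assumes "x \<in> mspace M" "f x = vertex_pt v" "v \<in> V" "{e \<in> E. v \<in> e} = {e}"
  shows "connectedin X (mspace M - {x})" "mspace M - {x} \<noteq> {}"
proof -
  have e: "e \<in> E" "v \<in> e"
    using assms(4) by auto
  obtain c where c: "e = {v, c}" "v \<noteq> c" "c \<in> V"
    using e by (rule edge_other_end)
  have vc: "{v, c} \<in> E"
    using e c by simp
  have far: "fr v e = V - {v}"
  proof -
    have "y \<in> fr v e" if y: "y \<in> V" "y \<noteq> v" for y
    proof -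
      obtain z where z: "{v, z} \<in> E" "(z, y) \<in> (adj (E - {{v, z}}))\<^sup>*"
        using first_step[OF assms(3) y(1)] y(2) by blast
      then have "{v, z} \<in> {e \<in> E. v \<in> e}"
        by simp
      then have "{v, z} = e"
        unfolding assms(4) by simp
      then show ?thesis
        using far_of_step[OF assms(3) z y(1)] root_not_far by auto
    qed
    then show ?thesis
      using far_subset root_not_far by blast
  qed
  have "connectedin X (spanned (V - {v}))"
    by (rule spanned_connected) (use far_conn_inside[OF assms(3) e(1)] far in auto)
  moreover have "connectedin X ((\<lambda>\<theta>. g (edge_pt v c \<theta>)) ` {0<..1})"
    by (rule edge_path_connected) (use vc in auto)
  moreover have c_in: "g (vertex_pt c) \<in> spanned (V - {v}) \<inter> (\<lambda>\<theta>. g (edge_pt v c \<theta>)) ` {0<..1}"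
  proof -
    have "edge_pt v c 1 = vertex_pt c"
      by (simp add: edge_pt_def)
    then have "g (vertex_pt c) \<in> (\<lambda>\<theta>. g (edge_pt v c \<theta>)) ` {0<..1}"
      by (intro image_eqI[of _ _ 1]) auto
    then show ?thesis
      using c vertex_pt_R by (auto simp: spanned_def)
  qed
  moreover have "spanned (V - {v}) \<union> (\<lambda>\<theta>. g (edge_pt v c \<theta>)) ` {0<..1} = mspace M - {x}"
  proof (rule antisym)
    have "g (edge_pt v c \<theta>) \<noteq> x" if "0 < \<theta>" "\<theta> \<le> 1" for \<theta>
    proof
      assume "g (edge_pt v c \<theta>) = x"
      then have "edge_pt v c \<theta> = vertex_pt v"
        using fg[OF edge_pt_R[OF vc, of \<theta>]] that assms(2) by simp
      then have "edge_pt v c \<theta> c = vertex_pt v c"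
        by simp
      then show False
        using that c by (simp add: edge_pt_def vertex_pt_def)
    qed
    then have "(\<lambda>\<theta>. g (edge_pt v c \<theta>)) ` {0<..1} \<subseteq> mspace M - {x}"
      using g_in[OF edge_pt_R[OF vc]] by (intro image_subsetI DiffI) simp_all
    moreover have "x \<notin> spanned (V - {v})"
      using assms(2) by (simp add: spanned_def)
    then have "spanned (V - {v}) \<subseteq> mspace M - {x}"
      by (auto simp: spanned_def)
    ultimately show "spanned (V - {v}) \<union> (\<lambda>\<theta>. g (edge_pt v c \<theta>)) ` {0<..1} \<subseteq> mspace M - {x}"
      by blast
    show "mspace M - {x} \<subseteq> spanned (V - {v}) \<union> (\<lambda>\<theta>. g (edge_pt v c \<theta>)) ` {0<..1}"
    proof
      fix y
      assume y: "y \<in> mspace M - {x}"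
      show "y \<in> spanned (V - {v}) \<union> (\<lambda>\<theta>. g (edge_pt v c \<theta>)) ` {0<..1}"
      proof (cases "v \<in> supp (f y)")
        case False
        then show ?thesis
          using y R_supp_subset[of "f y"] by (auto simp: spanned_def)
      next
        case True
        have "supp (f y) \<noteq> {v}"
        proof
          assume "supp (f y) = {v}"
          then have "f y = f x"
            using vertex_pt_of_supp[of "f y" v] y assms(2) by simp
          then show False
            using f_inj[of y x] y assms(1) by simp
        qed
        then have "supp (f y) \<in> E"
          using True f_R[of y] y by (auto simp: realization_def)
        then have "supp (f y) \<in> {e \<in> E. v \<in> e}"
          using True by simp
        then have s: "supp (f y) = {v, c}"
          unfolding assms(4) c(1) by simp
        have fy: "f y = edge_pt v c (f y c)" "0 \<le> f y c" "f y c \<le> 1"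
          using edge_pt_of_supp[of "f y" v c] y s c assms(3) by auto
        moreover have "f y c \<noteq> 0"
          using s unfolding supp_def by blast
        ultimately show ?thesis
          using gf[of y] y by (intro UnI2 image_eqI[of _ _ "f y c"]) auto
      qed
    qed
  qed
  ultimately show "connectedin X (mspace M - {x})"
    by (metis connectedin_Un emptyE)
  have "g (vertex_pt c) \<noteq> x"
  proof
    assume "g (vertex_pt c) = x"
    then have "vertex_pt c v = vertex_pt v v"
      using fg[OF vertex_pt_R[OF c(3)]] assms(2) by simp
    then show False
      using c(2) by (simp add: vertex_pt_def)
  qed
  then show "mspace M - {x} \<noteq> {}"
    using g_in[OF vertex_pt_R[OF c(3)]] by blast
qed

lemma tree_leaves_iff:
  assumes "E \<noteq> {}" "x \<in> mspace M"
  shows "x \<in> tree_leaves M \<longleftrightarrow> (\<exists>v\<in>graph_leaves V E. f x = vertex_pt v)"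
proof -
  have one: "card (connected_components_of (subtopology X (mspace M - {x}))) = 1 \<longleftrightarrow>
      connectedin X (mspace M - {x}) \<and> mspace M - {x} \<noteq> {}"
  proof -
    have "topspace (subtopology X (mspace M - {x})) = mspace M - {x}"
      by auto
    then have "subtopology X (mspace M - {x}) = trivial_topology \<longleftrightarrow> mspace M - {x} = {}"
      by (metis null_topspace_iff_trivial)
    then show ?thesis
      by (simp add: card_1_singleton_iff connected_components_of_eq_singleton connectedin_def)
  qed
  have leaf: "x \<in> tree_leaves M \<longleftrightarrow> connectedin X (mspace M - {x}) \<and> mspace M - {x} \<noteq> {}"
    using assms(2) unfolding one[symmetric] by (simp add: tree_leaves_def)
  from f_R[OF assms(2)] show ?thesis
  proof (cases rule: R_cases)
    case (vertex v)
    have v: "w = v" if "vertex_pt v = vertex_pt w" for w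
      using fun_cong[OF that, of v] by (simp add: vertex_pt_def split: if_splits)
    obtain e1 where e1: "e1 \<in> E" "v \<in> e1"
      using vertex_in_edge[OF assms(1) vertex(1)] by blast
    show ?thesis
    proof (cases "card {e \<in> E. v \<in> e} = 1")
      case True
      then obtain e where e: "{e \<in> E. v \<in> e} = {e}"
        by (auto simp: card_1_singleton_iff)
      have "v \<in> graph_leaves V E"
        using vertex(1) True by (simp add: graph_leaves_def)
      then show ?thesis
        using leaf connected_leaf[OF assms(2) vertex(2,1) e] vertex(2) by blast
    next
      case False
      have "\<exists>e2\<in>E. v \<in> e2 \<and> e2 \<noteq> e1"
      proof (rule ccontr)
        assume "\<not> ?thesis"
        then have "{e \<in> E. v \<in> e} = {e1}"
          using e1 by blast
        then show False
          using False by simp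
      qed
      then obtain e2 where e2: "e2 \<in> E" "v \<in> e2" "e2 \<noteq> e1"
        by blast
      have "\<not> connectedin X (mspace M - {x})"
        by (rule not_connected_inner_vertex[OF assms(2) vertex(2,1) e1(1) e2(1)]) (use e1 e2 in auto)
      moreover have "v \<notin> graph_leaves V E"
        using False by (simp add: graph_leaves_def)
      ultimately show ?thesis
        using leaf v vertex(2) by metis
    qed
  next
    case edge
    have "supp (f x) \<noteq> {v}" for v
      using edge_card[OF edge] by auto
    then have "f x \<noteq> vertex_pt v" for v
      by (metis supp_vertex_pt)
    then show ?thesis
      using leaf not_connected_edge_point[OF assms(2) edge] by auto
  qed
qed

theorem card_tree_leaves:
  assumes "E \<noteq> {}"
  shows "card (tree_leaves M) = card (graph_leaves V E)"
proof -
  have inj: "inj_on (\<lambda>v. g (vertex_pt v)) (graph_leaves V E)"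
  proof (rule inj_onI)
    fix v w
    assume *: "v \<in> graph_leaves V E" "w \<in> graph_leaves V E" "g (vertex_pt v) = g (vertex_pt w)"
    then have "vertex_pt v = vertex_pt w"
      using fg[OF vertex_pt_R] by (metis (no_types, lifting) graph_leaves_def mem_Collect_eq)
    from fun_cong[OF this, of v] show "v = w"
      by (simp add: vertex_pt_def split: if_splits)
  qed
  have "tree_leaves M = (\<lambda>v. g (vertex_pt v)) ` graph_leaves V E"
  proof (rule set_eqI, rule iffI)
    fix x
    assume x: "x \<in> tree_leaves M"
    then have "x \<in> mspace M"
      by (simp add: tree_leaves_def)
    then show "x \<in> (\<lambda>v. g (vertex_pt v)) ` graph_leaves V E"
      using tree_leaves_iff[OF assms] x by (metis gf image_eqI)
  next
    fix x
    assume "x \<in> (\<lambda>v. g (vertex_pt v)) ` graph_leaves V E"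
    then obtain v where v: "v \<in> graph_leaves V E" "x = g (vertex_pt v)"
      by blast
    then have "vertex_pt v \<in> R"
      by (auto simp: graph_leaves_def vertex_pt_R)
    then show "x \<in> tree_leaves M"
      using tree_leaves_iff[OF assms, of x] v by auto
  qed
  then show ?thesis
    using card_image[OF inj] by simp
qed

end

section \<open>Sub-trees\<close>

definition inner_edges :: "nat set set \<Rightarrow> nat set \<Rightarrow> nat set set" where
  "inner_edges E W = {e \<in> E. e \<subseteq> W}"

text \<open>A sub-tree together with its length and its number of leaves, read off from some model.\<close>

definition piece :: "'a metric \<Rightarrow> 'a set \<Rightarrow> real \<Rightarrow> nat \<Rightarrow> bool" where
  "piece M B L j \<longleftrightarrow> metric_subtree B M \<and>
     (\<exists>W E l. tree_model (submetric M B) W E l \<and> E \<noteq> {} \<and>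
        L = (\<Sum>e\<in>E. l e) \<and> j = card (graph_leaves W E))"

context graph_tree
begin

lemma far_other_root:
  assumes "a \<in> V" "e \<in> E" "b \<in> fr a e"
  shows "fr b e = V - fr a e"
proof -
  have "b \<in> V"
    using assms(3) far_subset by blast
  have "x \<in> fr b e \<longleftrightarrow> x \<notin> fr a e" if "x \<in> V" for x
  proof
    assume x: "x \<in> fr b e"
    show "x \<notin> fr a e"
      using far_conn[OF assms(1,2,3), of x] x by (auto simp: far_def)
  next
    assume "x \<notin> fr a e"
    then have "(a, x) \<in> (adj (E - {e}))\<^sup>*"
      using that by (simp add: far_def)
    moreover have "(a, b) \<notin> (adj (E - {e}))\<^sup>*"
      using assms(3) by (simp add: far_def)
    ultimately have "(b, x) \<notin> (adj (E - {e}))\<^sup>*"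
      using adj_rtrancl_sym rtrancl_trans by metis
    then show "x \<in> fr b e"
      using that by (simp add: far_def)
  qed
  then show ?thesis
    using far_subset by blast
qed

lemma far_same_root:
  assumes "a \<in> V" "b \<in> V - fr a e"
  shows "fr b e = fr a e"
proof -
  have "(a, b) \<in> (adj (E - {e}))\<^sup>*"
    using assms(2) by (simp add: far_def)
  then have "(a, x) \<in> (adj (E - {e}))\<^sup>* \<longleftrightarrow> (b, x) \<in> (adj (E - {e}))\<^sup>*" for x
    using adj_rtrancl_sym rtrancl_trans by metis
  then show ?thesis
    by (simp add: far_def)
qed

lemma leaf_in_far:
  assumes "a \<in> V" "e \<in> E"
  obtains y where "y \<in> fr a e" "y \<in> graph_leaves V E"
proof -
  define C where "C = insert e (inner_edges E (fr a e))"
  have "finite C" "C \<noteq> {}" "C \<subseteq> E"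
    using assms by (auto simp: C_def inner_edges_def)
  then obtain e' where e': "e' \<in> C" "\<And>e''. e'' \<in> C \<Longrightarrow> card (fr a e') \<le> card (fr a e'')"
    by (meson arg_min_if_finite arg_min_least finite_subset)
  have e'E: "e' \<in> E"
    using e'(1) \<open>C \<subseteq> E\<close> by blast
  obtain u w where uw: "e' = {u, w}" "w \<in> V" "w \<in> fr a e'"
    using assms(1) e'E by (rule far_ends)
  have sub: "fr a e' \<subseteq> fr a e"
    using far_subset_of_edge[OF assms e'E] e'(1) by (cases "e' = e") (auto simp: C_def inner_edges_def)
  have only: "e'' = e'" if e'': "e'' \<in> E" "w \<in> e''" for e''
  proof (rule ccontr)
    assume ne: "e'' \<noteq> e'"
    have in': "e'' \<subseteq> fr a e'"
      by (rule other_edge_meets_far[OF e'E e''(1) ne e''(2) uw(3)])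
    have "fr a e'' \<subseteq> fr a e'"
      by (rule far_subset_of_edge[OF assms(1) e'E e''(1) in' ne])
    moreover obtain u' w' where "e'' = {u', w'}" "u' \<notin> fr a e''"
      using assms(1) e''(1) by (rule far_ends)
    then have "u' \<in> fr a e' - fr a e''"
      using in' by blast
    ultimately have "card (fr a e'') < card (fr a e')"
      by (intro psubset_card_mono) auto
    moreover have "e'' \<in> C"
      using in' sub e''(1) by (auto simp: C_def inner_edges_def)
    ultimately show False
      using e'(2) by fastforce
  qed
  have "w \<in> e'"
    using uw(1) by simp
  then have "{e'' \<in> E. w \<in> e''} = {e'}"
    using only e'E by blast
  then have "w \<in> graph_leaves V E"
    using uw(2) by (simp add: graph_leaves_def)
  then show ?thesis
    using that[of w] uw(3) sub by blast
qed

lemma finite_graph_leaves [simp]: "finite (graph_leaves V E)"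
  by (simp add: graph_leaves_def)

lemma two_leaves:
  assumes "E \<noteq> {}"
  shows "2 \<le> card (graph_leaves V E)"
proof -
  obtain e where e: "e \<in> E"
    using assms by auto
  obtain a where a: "a \<in> V"
    using V_nonempty by auto
  obtain y where y: "y \<in> fr a e" "y \<in> graph_leaves V E"
    using a e by (rule leaf_in_far)
  have yV: "y \<in> V"
    using y(1) far_subset by blast
  obtain z where z: "z \<in> fr y e" "z \<in> graph_leaves V E"
    using yV e by (rule leaf_in_far)
  have "z \<noteq> y"
    using z(1) root_not_far by blast
  then have "card {y, z} = 2"
    by simp
  moreover have "card {y, z} \<le> card (graph_leaves V E)"
    by (rule card_mono) (use y z in auto)
  ultimately show ?thesis
    by simp
qed

lemma near_edges_at:
  assumes "e \<in> E" "y \<in> V - fr a e" "y \<notin> e"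
  shows "{e' \<in> inner_edges E (V - fr a e). y \<in> e'} = {e' \<in> E. y \<in> e'}"
proof -
  have "e' \<subseteq> V - fr a e" if "e' \<in> E" "y \<in> e'" for e'
  proof -
    have "e' \<noteq> e"
      using that assms(3) by blast
    then have "e' \<inter> fr a e = {}"
      using other_edge_far[OF assms(1) that(1)] that(2) assms(2) by blast
    then show ?thesis
      using edge_card[OF that(1)] by blast
  qed
  then show ?thesis
    by (auto simp: inner_edges_def)
qed

lemma near_leaves:
  assumes "a \<in> V" "e \<in> E" "u \<in> e" "u \<notin> fr a e"
  shows "graph_leaves (V - fr a e) (inner_edges E (V - fr a e)) \<subseteq> insert u (graph_leaves V E - fr a e)"
proof
  fix y
  assume y: "y \<in> graph_leaves (V - fr a e) (inner_edges E (V - fr a e))"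
  have yV: "y \<in> V - fr a e"
    using y by (simp add: graph_leaves_def)
  show "y \<in> insert u (graph_leaves V E - fr a e)"
  proof (cases "y \<in> e")
    case True
    obtain u' w where "e = {u', w}" "u' \<notin> fr a e" "w \<in> fr a e"
      using assms(1,2) by (rule far_ends)
    then have "y = u"
      using True assms(3,4) yV by blast
    then show ?thesis
      by simp
  next
    case False
    have "card {e' \<in> inner_edges E (V - fr a e). y \<in> e'} = 1"
      using y by (simp add: graph_leaves_def)
    then have "y \<in> graph_leaves V E"
      using yV unfolding near_edges_at[OF assms(2) yV False] by (simp add: graph_leaves_def)
    then show ?thesis
      using yV by blast
  qed
qed

text \<open>Cutting off the far side of an edge makes at most the remaining end of that edge a new leaf, and
  it removes at least one old leaf.\<close>

lemma card_near_leaves_le: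
  assumes "a \<in> V" "e \<in> E"
  shows "card (graph_leaves (V - fr a e) (inner_edges E (V - fr a e))) \<le> card (graph_leaves V E)"
proof -
  obtain u w where uw: "e = {u, w}" "u \<notin> fr a e"
    using assms by (rule far_ends)
  have "u \<in> e"
    using uw(1) by simp
  obtain y where y: "y \<in> fr a e" "y \<in> graph_leaves V E"
    using assms by (rule leaf_in_far)
  have "card (graph_leaves (V - fr a e) (inner_edges E (V - fr a e)))
      \<le> card (insert u (graph_leaves V E - fr a e))"
    by (rule card_mono) (use near_leaves[OF assms \<open>u \<in> e\<close> uw(2)] in auto)
  also have "\<dots> \<le> Suc (card (graph_leaves V E - fr a e))"
    by (simp add: card_insert_le_m1 card_insert_if)
  also have "card (graph_leaves V E - fr a e) < card (graph_leaves V E)"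
    by (rule psubset_card_mono) (use y in auto)
  finally show ?thesis
    by simp
qed

text \<open>If two further edges meet at the remaining end, it does not become a leaf. This is how the
  induction on the number of leaves makes progress.\<close>

lemma card_near_leaves_less:
  assumes "a \<in> V" "e \<in> E" "u \<in> e" "u \<notin> fr a e"
    and "e1 \<in> E" "e2 \<in> E" "e1 \<noteq> e2" "e1 \<noteq> e" "e2 \<noteq> e" "u \<in> e1" "u \<in> e2"
  shows "card (graph_leaves (V - fr a e) (inner_edges E (V - fr a e))) < card (graph_leaves V E)"
proof -
  obtain y where y: "y \<in> fr a e" "y \<in> graph_leaves V E"
    using assms(1,2) by (rule leaf_in_far)
  have inner: "e' \<in> {e' \<in> inner_edges E (V - fr a e). u \<in> e'}" if "e' \<in> E" "e' \<noteq> e" "u \<in> e'" for e'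
    using other_edge_far[OF assms(2) that(1,2), of a] that edge_card[OF that(1)] assms(4)
    by (auto simp: inner_edges_def)
  have "u \<notin> graph_leaves (V - fr a e) (inner_edges E (V - fr a e))"
  proof
    assume "u \<in> graph_leaves (V - fr a e) (inner_edges E (V - fr a e))"
    then obtain e' where e': "{e' \<in> inner_edges E (V - fr a e). u \<in> e'} = {e'}"
      by (auto simp: graph_leaves_def card_1_singleton_iff)
    have "e1 \<in> {e'}" "e2 \<in> {e'}"
      using inner[OF assms(5,8,10)] inner[OF assms(6,9,11)] unfolding e' by blast+
    then show False
      using assms(7) by simp
  qed
  then have "graph_leaves (V - fr a e) (inner_edges E (V - fr a e)) \<subseteq> graph_leaves V E - fr a e"
    using near_leaves[OF assms(1-4)] by blast
  then have "graph_leaves (V - fr a e) (inner_edges E (V - fr a e)) \<subset> graph_leaves V E"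
    using y by blast
  then show ?thesis
    by (intro psubset_card_mono) auto
qed

text \<open>When the cut is made inside an edge, the edge itself has to be kept. In the resulting branch
  its near end is a leaf.\<close>

lemma branch_edges:
  assumes "a \<in> V" "e \<in> E" "e = {u, w}" "u \<notin> fr a e" "w \<in> fr a e"
  shows "inner_edges E (insert u (fr a e)) = insert e (inner_edges E (fr a e))"
    "{e' \<in> inner_edges E (insert u (fr a e)). u \<in> e'} = {e}"
proof -
  have *: "e' \<subseteq> fr a e" if "e' \<in> E" "e' \<noteq> e" "e' \<subseteq> insert u (fr a e)" for e'
  proof -
    have "e' \<noteq> {u}" "e' \<noteq> {}"
      using edge_card[OF that(1)] by auto
    then have "e' \<inter> fr a e \<noteq> {}"
      using that(3) by blast
    then show ?thesis
      using other_edge_far[OF assms(2) that(1,2), of a] by blast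
  qed
  show "inner_edges E (insert u (fr a e)) = insert e (inner_edges E (fr a e))"
    using * assms by (auto simp: inner_edges_def)
  then show "{e' \<in> inner_edges E (insert u (fr a e)). u \<in> e'} = {e}"
    using assms(3,4) by (auto simp: inner_edges_def)
qed

lemma branch_connected:
  assumes "a \<in> V" "e \<in> E" "e = {u, w}" "u \<notin> fr a e" "w \<in> fr a e"
    and "x \<in> insert u (fr a e)" "y \<in> insert u (fr a e)"
  shows "(x, y) \<in> (adj (inner_edges E (insert u (fr a e))))\<^sup>*"
proof -
  have to_w: "(x, w) \<in> (adj (inner_edges E (insert u (fr a e))))\<^sup>*" if "x \<in> insert u (fr a e)" for x
  proof (cases "x = u")
    case True
    then have "(x, w) \<in> adj (inner_edges E (insert u (fr a e)))"
      using assms(2,3,5) by (auto simp: adj_def inner_edges_def)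
    then show ?thesis
      by blast
  next
    case False
    then have "(x, w) \<in> (adj {e' \<in> E. e' \<subseteq> fr a e})\<^sup>*"
      using that far_conn_inside[OF assms(1,2) _ assms(5)] by blast
    then show ?thesis
      by (rule adj_rtrancl_mono) (auto simp: inner_edges_def)
  qed
  have "(x, w) \<in> (adj (inner_edges E (insert u (fr a e))))\<^sup>*"
    "(y, w) \<in> (adj (inner_edges E (insert u (fr a e))))\<^sup>*"
    using to_w assms by blast+
  then show ?thesis
    using adj_rtrancl_sym by (meson rtrancl_trans)
qed

lemma card_branch_leaves_le:
  assumes "a \<in> V" "e \<in> E" "e = {u, w}" "u \<notin> fr a e" "w \<in> fr a e"
  shows "card (graph_leaves (insert u (fr a e)) (inner_edges E (insert u (fr a e))))
    \<le> card (graph_leaves V E)"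
proof -
  have "w \<in> V"
    using assms(5) far_subset by blast
  then obtain y where y: "y \<in> fr w e" "y \<in> graph_leaves V E"
    using assms(2) by (rule leaf_in_far)
  then have y': "y \<notin> fr a e"
    using far_other_root[OF assms(1,2,5)] by blast
  have sub: "graph_leaves (insert u (fr a e)) (inner_edges E (insert u (fr a e)))
      \<subseteq> insert u (graph_leaves V E \<inter> fr a e)"
  proof
    fix x
    assume x: "x \<in> graph_leaves (insert u (fr a e)) (inner_edges E (insert u (fr a e)))"
    show "x \<in> insert u (graph_leaves V E \<inter> fr a e)"
    proof (cases "x = u")
      case False
      then have xf: "x \<in> fr a e"
        using x by (simp add: graph_leaves_def)
      have "{e' \<in> inner_edges E (insert u (fr a e)). x \<in> e'} = {e' \<in> E. x \<in> e'}"
        using other_edge_meets_far[OF assms(2) _ _ _ xf] assms(3,5) by (auto simp: inner_edges_def) 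
      then have "x \<in> graph_leaves V E"
        using x xf far_subset unfolding graph_leaves_def by auto
      then show ?thesis
        using xf by simp
    qed simp
  qed
  have "card (graph_leaves (insert u (fr a e)) (inner_edges E (insert u (fr a e))))
      \<le> card (insert u (graph_leaves V E \<inter> fr a e))"
    by (rule card_mono) (use sub in auto)
  also have "\<dots> \<le> Suc (card (graph_leaves V E \<inter> fr a e))"
    by (simp add: card_insert_if)
  also have "card (graph_leaves V E \<inter> fr a e) < card (graph_leaves V E)"
    by (rule psubset_card_mono) (use y y' in auto)
  finally show ?thesis
    by simp
qed

lemma edge_partition:
  assumes "a \<in> V" "e \<in> E"
  shows "E = insert e (inner_edges E (fr a e) \<union> inner_edges E (V - fr a e))"
    "e \<notin> inner_edges E (fr a e)" "e \<notin> inner_edges E (V - fr a e)"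
    "inner_edges E (fr a e) \<inter> inner_edges E (V - fr a e) = {}"
proof -
  obtain u w where uw: "e = {u, w}" "u \<notin> fr a e" "w \<in> fr a e"
    using assms by (rule far_ends)
  show "E = insert e (inner_edges E (fr a e) \<union> inner_edges E (V - fr a e))"
    using other_edge_far[OF assms(2), of _ a] edge_card assms(2) unfolding inner_edges_def by blast
  show "e \<notin> inner_edges E (fr a e)" "e \<notin> inner_edges E (V - fr a e)"
    using uw by (auto simp: inner_edges_def)
  show "inner_edges E (fr a e) \<inter> inner_edges E (V - fr a e) = {}"
  proof (rule ccontr)
    assume "inner_edges E (fr a e) \<inter> inner_edges E (V - fr a e) \<noteq> {}"
    then obtain e' where "e' \<in> E" "e' \<subseteq> fr a e" "e' \<subseteq> V - fr a e"
      by (auto simp: inner_edges_def)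
    then have "e' \<in> E" "e' = {}"
      by blast+
    then show False
      using edge_card by fastforce
  qed
qed

lemma sum_edge_partition:
  fixes l :: "nat set \<Rightarrow> real"
  assumes "a \<in> V" "e \<in> E"
  shows "(\<Sum>e'\<in>E. l e') =
    l e + (\<Sum>e'\<in>inner_edges E (fr a e). l e') + (\<Sum>e'\<in>inner_edges E (V - fr a e). l e')"
proof -
  have fin: "finite (inner_edges E W)" for W
    by (simp add: inner_edges_def)
  have "(\<Sum>e'\<in>E. l e') = (\<Sum>e'\<in>insert e (inner_edges E (fr a e) \<union> inner_edges E (V - fr a e)). l e')"
    using edge_partition(1)[OF assms] by simp
  then show ?thesis
    using edge_partition(2-4)[OF assms] fin by (simp add: sum.union_disjoint)
qed

lemma finite_inner_edges [simp]: "finite (inner_edges E W)"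
  by (simp add: inner_edges_def)

lemma subgraph_tree:
  assumes "W \<subseteq> V" "W \<noteq> {}" "\<And>x y. x \<in> W \<Longrightarrow> y \<in> W \<Longrightarrow> (x, y) \<in> (adj (inner_edges E W))\<^sup>*"
  shows "finite_graph_tree W (inner_edges E W)"
proof -
  have "\<not> graph_cycle (inner_edges E W) xs" for xs
  proof
    assume "graph_cycle (inner_edges E W) xs"
    then have "graph_cycle E xs"
      by (auto simp: graph_cycle_def inner_edges_def)
    then show False
      using tree by (auto simp: finite_graph_tree_def)
  qed
  moreover have "finite W"
    using assms(1) finite_V finite_subset by blast
  moreover have "graph_connected W (inner_edges E W)"
    using assms(2,3) by (simp add: graph_connected_def adj_def)
  moreover have "simple_graph W (inner_edges E W)"
    using edge_card by (simp add: simple_graph_def inner_edges_def)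
  ultimately show ?thesis
    by (simp add: finite_graph_tree_def)
qed

end

context metric_graph_tree
begin

lemma realization_subgraph:
  assumes "W \<subseteq> V"
  shows "realization W (inner_edges E W) = {p \<in> R. supp p \<subseteq> W}"
proof (rule set_eqI)
  fix p
  have sums: "(\<Sum>v\<in>V. p v) = (\<Sum>v\<in>W. p v)" if "supp p \<subseteq> W"
    using assms that by (intro sum.mono_neutral_right) (auto simp: supp_def)
  show "p \<in> realization W (inner_edges E W) \<longleftrightarrow> p \<in> {p \<in> R. supp p \<subseteq> W}"
  proof (cases "supp p \<subseteq> W")
    case True
    then have "supp p \<in> (\<lambda>v. {v}) ` W \<union> inner_edges E W \<longleftrightarrow> supp p \<in> (\<lambda>v. {v}) ` V \<union> E"
      using assms by (auto simp: inner_edges_def)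
    then show ?thesis
      using True sums by (simp add: realization_def)
  next
    case False
    then show ?thesis
      by (auto simp: realization_def inner_edges_def)
  qed
qed

lemma subgraph_metric_graph_tree:
  assumes "W \<subseteq> V" "W \<noteq> {}" "\<And>x y. x \<in> W \<Longrightarrow> y \<in> W \<Longrightarrow> (x, y) \<in> (adj (inner_edges E W))\<^sup>*"
  shows "metric_graph_tree W (inner_edges E W) l"
  using subgraph_tree[OF assms] l_pos
  by (simp add: metric_graph_tree_def graph_tree_def metric_graph_tree_axioms_def inner_edges_def)

text \<open>A connected part contains the paths between its points: an edge outside the part does not
  separate two of its points, and an inner edge separates the same points in the part and in the tree.\<close>

lemma path_dist_subgraph:
  assumes W: "W \<subseteq> V" "W \<noteq> {}" "\<And>x y. x \<in> W \<Longrightarrow> y \<in> W \<Longrightarrow> (x, y) \<in> (adj (inner_edges E W))\<^sup>*"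
    and p: "p \<in> R" "supp p \<subseteq> W" and q: "q \<in> R" "supp q \<subseteq> W"
  shows "path_dist W (inner_edges E W) l p q = path_dist V E l p q"
proof -
  interpret sub: metric_graph_tree W "inner_edges E W" l
    by (rule subgraph_metric_graph_tree[OF W])
  obtain a where a: "a \<in> W"
    using W(2) by auto
  then have aV: "a \<in> V"
    using W(1) by auto
  have far: "far W (inner_edges E W) a e = fr a e \<inter> W" if e: "e \<in> inner_edges E W" for e
  proof (rule antisym)
    have eE: "e \<in> E"
      using e by (simp add: inner_edges_def)
    have mono: "inner_edges E W - {e} \<subseteq> E - {e}"
      by (auto simp: inner_edges_def)
    obtain u w where uw: "e = {u, w}" "w \<in> far W (inner_edges E W) a e" "w \<in> W"
      "(a, u) \<in> (adj (inner_edges E W - {e}))\<^sup>*"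
      using a e by (rule sub.far_ends)
    have "(a, u) \<in> (adj (E - {e}))\<^sup>*"
      using adj_rtrancl_mono[OF uw(4) mono] .
    then have "u \<notin> fr a e"
      by (simp add: far_def)
    moreover obtain u' w' where "e = {u', w'}" "w' \<in> fr a e"
      using aV eE by (rule far_ends)
    ultimately have w: "w \<in> fr a e"
      using uw(1) by (metis doubleton_eq_iff)
    show "far W (inner_edges E W) a e \<subseteq> fr a e \<inter> W"
    proof
      fix x
      assume x: "x \<in> far W (inner_edges E W) a e"
      have "(w, x) \<in> (adj (inner_edges E W - {e}))\<^sup>*"
        by (rule sub.far_conn[OF a e uw(2) x])
      then have "(w, x) \<in> (adj (E - {e}))\<^sup>*"
        using mono by (rule adj_rtrancl_mono)
      then have "x \<in> fr a e"
        using same_side_far[of w x e a] w uw(3) W(1) by blast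
      then show "x \<in> fr a e \<inter> W"
        using x sub.far_subset by blast
    qed
    show "fr a e \<inter> W \<subseteq> far W (inner_edges E W) a e"
      using adj_rtrancl_mono[OF _ mono] by (auto simp: far_def)
  qed
  have nn_sub: "below W (inner_edges E W) a e r = nn a e r"
    if "e \<in> inner_edges E W" "supp r \<subseteq> W" for e r
    unfolding below_def far[OF that(1)] using that(2)
    by (intro sum.mono_neutral_left) (auto simp: supp_def)
  have outside: "nn a e r = 0" if "e \<in> E - inner_edges E W" "supp r \<subseteq> W" for e r
  proof (rule nn_zero)
    have "x \<notin> fr a e" if "x \<in> W" for x
    proof -
      have "(a, x) \<in> (adj (E - {e}))\<^sup>*"
        by (rule adj_rtrancl_mono[OF W(3)[OF a that]])
          (use \<open>e \<in> E - inner_edges E W\<close> in \<open>auto simp: inner_edges_def\<close>)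
      then show ?thesis
        by (simp add: far_def)
    qed
    then show "supp r \<inter> fr a e = {}"
      using that(2) by blast
  qed
  have "edge_dist W (inner_edges E W) l a p q = (\<Sum>e\<in>inner_edges E W. l e * \<bar>nn a e p - nn a e q\<bar>)"
    unfolding edge_dist_def using nn_sub p(2) q(2) by (intro sum.cong) auto
  also have "\<dots> = ed a p q"
    unfolding edge_dist_def using outside p(2) q(2)
    by (intro sum.mono_neutral_left) (auto simp: inner_edges_def)
  finally show ?thesis
    using sub.path_dist_eq[OF a] path_dist_eq[OF aV p(1) q(1)] p q realization_subgraph[OF W(1)] by simp
qed

end

context tree_metric
begin

lemma spanned_V: "spanned V = mspace M"
  unfolding spanned_def using R_supp_subset[OF f_R] by blast

lemma whole_connected: "connectedin X (mspace M)"
proof -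
  have "{e \<in> E. e \<subseteq> V} = E"
    using edge_card by blast
  then show ?thesis
    using spanned_connected[of V] connected by (simp add: spanned_V)
qed

lemma spanned_closed:
  assumes "W \<subseteq> V"
  shows "closedin X (spanned W)"
proof -
  have haus: "Hausdorff_space X"
    by (simp add: mtopology_of_def Metric_space.Hausdorff_space_mtopology)
  have edge: "closedin X (spanned e)" if "e \<in> E" for e
  proof -
    obtain x y where e: "e = {x, y}"
      using \<open>e \<in> E\<close> by (rule edge_ends)
    have "compactin X ((\<lambda>\<theta>. g (edge_pt x y \<theta>)) ` {0..1})"
      by (rule image_compactin[OF _ edge_path_continuous]) (use that e in \<open>auto simp: compactin_subtopology\<close>)
    then show ?thesis
      using edge_segment[of x y] that e haus by (simp add: compactin_imp_closedin)
  qed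
  have vertex: "closedin X {g (vertex_pt v)}" if "v \<in> W" for v
    using haus that assms vertex_pt_R by (intro closedin_Hausdorff_singleton) auto
  have "x \<in> (\<Union>e\<in>inner_edges E W. spanned e) \<union> (\<Union>v\<in>W. {g (vertex_pt v)})"
    if x: "x \<in> mspace M" "supp (f x) \<subseteq> W" for x
    using f_R[OF x(1)]
  proof (cases rule: R_cases)
    case (vertex v)
    then have "x = g (vertex_pt v)" "v \<in> W"
      using gf[OF x(1)] x(2) by auto
    then show ?thesis
      by blast
  next
    case edge
    then show ?thesis
      using x by (auto simp: spanned_def inner_edges_def)
  qed
  then have "spanned W \<subseteq> (\<Union>e\<in>inner_edges E W. spanned e) \<union> (\<Union>v\<in>W. {g (vertex_pt v)})"
    unfolding spanned_def by blast
  moreover have "spanned e \<subseteq> spanned W" if "e \<in> inner_edges E W" for e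
    using that by (auto simp: spanned_def inner_edges_def)
  moreover have "g (vertex_pt v) \<in> spanned W" if "v \<in> W" for v
    using that assms vertex_pt_R[of v] by (auto simp: spanned_def)
  ultimately have "spanned W = (\<Union>e\<in>inner_edges E W. spanned e) \<union> (\<Union>v\<in>W. {g (vertex_pt v)})"
    by blast
  moreover have "closedin X (\<Union>e\<in>inner_edges E W. spanned e)"
    using edge by (intro closedin_Union) (auto simp: inner_edges_def)
  moreover have "closedin X (\<Union>v\<in>W. {g (vertex_pt v)})"
    using vertex finite_subset[OF assms finite_V] by (intro closedin_Union) auto
  ultimately show ?thesis
    by (simp add: closedin_Un)
qed

lemma subgraph_tree_metric:
  assumes "W \<subseteq> V" "W \<noteq> {}" "\<And>x y. x \<in> W \<Longrightarrow> y \<in> W \<Longrightarrow> (x, y) \<in> (adj (inner_edges E W))\<^sup>*"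
  shows "tree_metric W (inner_edges E W) l (submetric M (spanned W)) f"
proof -
  have "bij_betw f (spanned W) (realization W (inner_edges E W))"
  proof (rule bij_betwI')
    show "f x = f y \<longleftrightarrow> x = y" if "x \<in> spanned W" "y \<in> spanned W" for x y
      using f_inj that by (auto simp: spanned_def)
    show "f x \<in> realization W (inner_edges E W)" if "x \<in> spanned W" for x
      using that by (simp add: realization_subgraph[OF assms(1)] spanned_def)
    show "\<exists>x\<in>spanned W. p = f x" if "p \<in> realization W (inner_edges E W)" for p
      using that by (intro bexI[of _ "g p"]) (simp_all add: realization_subgraph[OF assms(1)] spanned_def)
  qed
  moreover have "spanned W \<inter> mspace M = spanned W"
    by (auto simp: spanned_def)
  moreover have "mdist M x y = path_dist W (inner_edges E W) l (f x) (f y)"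
    if "x \<in> spanned W" "y \<in> spanned W" for x y
    using path_dist_subgraph[OF assms, of "f x" "f y"] that by (simp add: dist_path spanned_def)
  ultimately show ?thesis
    using subgraph_metric_graph_tree[OF assms] by (simp add: tree_metric_def tree_metric_axioms_def)
qed

lemma metric_subtree_of_model:
  assumes "tree_metric W E' l' (submetric M B) f'" "closedin X B"
  shows "metric_subtree B M"
proof -
  interpret sub: tree_metric W E' l' "submetric M B" f'
    by (rule assms(1))
  have B: "B \<subseteq> mspace M"
    using closedin_subset[OF assms(2)] by simp
  obtain v where "v \<in> W"
    using sub.V_nonempty by auto
  then have "sub.g (vertex_pt v) \<in> mspace (submetric M B)"
    using sub.vertex_pt_R sub.g_in by blast
  then have "B \<noteq> {}"
    by auto
  moreover have "connectedin X B"
    using sub.whole_connected B by (simp add: mtopology_of_submetric connectedin_subtopology Int_absorb2)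
  ultimately show ?thesis
    using assms(2) by (simp add: metric_subtree_def)
qed

lemma near_piece:
  assumes "a \<in> V" "e \<in> E" "inner_edges E (V - fr a e) \<noteq> {}"
  shows "piece M (spanned (V - fr a e)) (\<Sum>e'\<in>inner_edges E (V - fr a e). l e')
    (card (graph_leaves (V - fr a e) (inner_edges E (V - fr a e))))"
proof -
  have "tree_metric (V - fr a e) (inner_edges E (V - fr a e)) l (submetric M (spanned (V - fr a e))) f"
  proof (rule subgraph_tree_metric)
    show "V - fr a e \<noteq> {}"
      using assms(1) root_not_far by blast
    show "(x, y) \<in> (adj (inner_edges E (V - fr a e)))\<^sup>*" if "x \<in> V - fr a e" "y \<in> V - fr a e" for x y
      using near_conn_inside[OF assms(1,2) that] by (simp add: inner_edges_def)
  qed auto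
  then show ?thesis
    using metric_subtree_of_model spanned_closed assms(3) unfolding piece_def tree_model_iff by blast
qed

text \<open>Shortening a leaf edge does not change the graph, only the length of that edge. With the
  coordinate \<open>f x u\<close> of the leaf \<open>u\<close> this is an affine rescaling.\<close>

lemma trimmed_tree_metric:
  assumes e: "e = {u, w}" "e \<in> E" "{e' \<in> E. u \<in> e'} = {e}" and \<tau>: "0 < \<tau>" "\<tau> < l e"
  defines "B \<equiv> {x \<in> mspace M. l e * f x u \<le> l e - \<tau>}"
  obtains f' where "tree_metric V E (l(e := l e - \<tau>)) (submetric M B) f'" "metric_subtree B M"
proof -
  define k where "k = l e / (l e - \<tau>)"
  have k: "0 < k" "k * (l e - \<tau>) = l e" "1 \<le> k"
    using \<tau> by (auto simp: k_def)
  have uw: "u \<in> V" "w \<in> V" "u \<noteq> w"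
    using edge_card[OF e(2)] e(1) no_edge_self e(2) by auto
  have wu: "{w, u} \<in> E" "e = {w, u}"
    using e by (simp_all add: insert_commute)
  have at_u: "supp p \<subseteq> e" "p = edge_pt w u (p u)" "p u \<le> 1" if p: "p \<in> R" "p u \<noteq> 0" for p
  proof -
    show s: "supp p \<subseteq> e"
      using p(1)
    proof (cases rule: R_cases)
      case (vertex v)
      then have "v = u"
        using p(2) by (simp add: vertex_pt_def split: if_splits)
      then show ?thesis
        using vertex e(1) by simp
    next
      case edge
      then have "supp p \<in> {e' \<in> E. u \<in> e'}"
        using p(2) by (simp add: supp_def)
      then show ?thesis
        unfolding e(3) by simp
    qed
    show "p = edge_pt w u (p u)" "p u \<le> 1"
      using edge_pt_of_supp[of p w u] p(1) s uw e(1) by (auto simp: insert_commute)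
  qed
  have edge_u: "edge_pt w u \<theta> u = \<theta>" for \<theta>
    using uw(3) by (simp add: edge_pt_def vertex_pt_def)
  have far_u: "fr w e = {u}"
  proof -
    obtain u' w' where *: "e = {u', w'}" "w' \<in> fr w e"
      using uw(2) e(2) by (rule far_ends)
    then have "u \<in> fr w e"
      using e(1) root_not_far[of w e] by (metis doubleton_eq_iff)
    moreover have "v = u" if "v \<in> fr w e" for v
      using far_conn[OF uw(2) e(2) \<open>u \<in> fr w e\<close> that]
    proof (cases rule: converse_rtranclE)
      case (step y)
      then have "{u, y} \<in> {e' \<in> E. u \<in> e'}" "{u, y} \<noteq> e"
        by (auto simp: adj_def)
      then show ?thesis
        unfolding e(3) by simp
    qed simp
    ultimately show ?thesis
      by blast
  qed
  have nn_e: "nn w e p = p u" for p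
    by (simp add: below_def far_u)
  define \<rho> where "\<rho> c p = (if p u = 0 then p else edge_pt w u (c * p u))" for c :: real and p :: "nat \<Rightarrow> real"
  have \<rho>_u: "\<rho> c p u = c * p u" for c p
    by (simp add: \<rho>_def edge_u)
  have \<rho>_R: "\<rho> c p \<in> R" if "p \<in> R" "0 \<le> c" "c * p u \<le> 1" for c p
    using that wu(1) R_nonneg[OF that(1), of u] by (auto simp: \<rho>_def intro!: edge_pt_R)
  have \<rho>_nn: "nn w e' (\<rho> c p) = nn w e' p" if p: "p \<in> R" "0 \<le> c" "c * p u \<le> 1" and e': "e' \<in> E" "e' \<noteq> e" for c p e'
  proof (cases "p u = 0")
    case False
    have "supp (\<rho> c p) \<subseteq> e"
      using False supp_edge_pt[of w u] wu(2) by (simp add: \<rho>_def)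
    then show ?thesis
      using nn_const_on_edge[OF e(2) e' \<rho>_R[OF p] p(1)] at_u(1)[OF p(1) False] by blast
  qed (simp add: \<rho>_def)
  have \<rho>_inv: "\<rho> (1 / c) (\<rho> c p) = p" if "p \<in> R" "0 < c" for c p
  proof (cases "p u = 0")
    case False
    then have "\<rho> (1 / c) (\<rho> c p) = edge_pt w u (p u)"
      using that(2) by (simp add: \<rho>_def edge_u)
    also have "\<dots> = p"
      by (rule at_u(2)[OF that(1) False, symmetric])
    finally show ?thesis .
  qed (simp add: \<rho>_def)
  have B_bound: "k * f x u \<le> 1" if "x \<in> B" for x
  proof -
    have "k * (l e * f x u) \<le> k * (l e - \<tau>)"
      using that k(1) by (intro mult_left_mono) (auto simp: B_def)
    then have "l e * (k * f x u) \<le> l e * 1"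
      using k(2) by (simp add: algebra_simps)
    then show ?thesis
      using l_pos[OF e(2)] by (simp only: mult_le_cancel_left_pos)
  qed
  let ?l = "l(e := l e - \<tau>)"
  let ?f = "\<lambda>x. \<rho> k (f x)"
  interpret new: metric_graph_tree V E ?l
    using tree l_pos \<tau> by unfold_locales auto
  have BM: "B \<subseteq> mspace M"
    by (auto simp: B_def)
  have fB: "?f x \<in> R" if "x \<in> B" for x
    by (rule \<rho>_R) (use that BM B_bound k in auto)
  have bij: "bij_betw ?f B R"
  proof (rule bij_betwI')
    show "?f x = ?f y \<longleftrightarrow> x = y" if "x \<in> B" "y \<in> B" for x y
    proof
      assume "?f x = ?f y"
      then have "\<rho> (1 / k) (?f x) = \<rho> (1 / k) (?f y)"
        by simp
      then have "f x = f y"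
        using \<rho>_inv[OF f_R k(1), of x] \<rho>_inv[OF f_R k(1), of y] that BM by (metis subsetD)
      then show "x = y"
        using f_inj that BM by blast
    qed simp
    show "?f x \<in> R" if "x \<in> B" for x
      by (rule fB[OF that])
    show "\<exists>x\<in>B. p = ?f x" if p: "p \<in> R" for p
    proof -
      have p1: "p u \<le> 1"
        using at_u(3)[OF p] by (cases "p u = 0") auto
      have "1 / k * p u \<le> 1"
        using p1 k(1,3) by (simp add: field_simps)
      then have R': "\<rho> (1 / k) p \<in> R"
        using \<rho>_R[OF p, of "1 / k"] k(1) by simp
      have "l e * (1 / k * p u) \<le> l e - \<tau>"
      proof -
        have "l e * (1 / k) = l e - \<tau>"
          using k(1,2) by (simp add: field_simps)
        then have "l e * (1 / k * p u) = (l e - \<tau>) * p u"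
          by (metis mult.assoc)
        also have "\<dots> \<le> (l e - \<tau>) * 1"
          using p1 \<tau> by (intro mult_left_mono) auto
        finally show ?thesis
          by simp
      qed
      then have "g (\<rho> (1 / k) p) \<in> B"
        using R' by (simp add: B_def \<rho>_u)
      moreover have "?f (g (\<rho> (1 / k) p)) = p"
        using R' \<rho>_inv[OF p, of "1 / k"] k(1) by simp
      ultimately show ?thesis
        by metis
    qed
  qed
  have dist: "mdist M x y = path_dist V E ?l (?f x) (?f y)" if xy: "x \<in> B" "y \<in> B" for x y
  proof -
    have "l e' * \<bar>nn w e' (f x) - nn w e' (f y)\<bar> = ?l e' * \<bar>nn w e' (?f x) - nn w e' (?f y)\<bar>"
      if e': "e' \<in> E" for e'
    proof (cases "e' = e")
      case True
      have "k * f x u - k * f y u = k * (f x u - f y u)"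
        by (simp add: right_diff_distrib)
      then have "(l e - \<tau>) * \<bar>k * f x u - k * f y u\<bar> = (k * (l e - \<tau>)) * \<bar>f x u - f y u\<bar>"
        using k(1) by (simp add: abs_mult)
      then show ?thesis
        using True k(2) by (simp add: nn_e \<rho>_u)
    next
      case False
      have BR: "f z \<in> R" if "z \<in> B" for z
        using that BM f_R by blast
      have "nn w e' (?f x) = nn w e' (f x)" "nn w e' (?f y) = nn w e' (f y)"
        using \<rho>_nn[OF BR[OF xy(1)] less_imp_le[OF k(1)] B_bound[OF xy(1)] e' False]
          \<rho>_nn[OF BR[OF xy(2)] less_imp_le[OF k(1)] B_bound[OF xy(2)] e' False] .
      then show ?thesis
        using False by (simp only: fun_upd_apply if_False)
    qed
    then have "ed w (f x) (f y) = new.ed w (?f x) (?f y)"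
      unfolding edge_dist_def by (intro sum.cong) auto
    moreover have "x \<in> mspace M" "y \<in> mspace M"
      using xy BM by blast+
    ultimately show ?thesis
      using dist_ed[OF uw(2), of x y] new.path_dist_eq[OF uw(2) fB[OF xy(1)] fB[OF xy(2)]] by simp
  qed
  have tm: "tree_metric V E ?l (submetric M B) ?f"
    using new.metric_graph_tree_axioms bij dist BM
    by (simp add: tree_metric_def tree_metric_axioms_def Int_absorb2)
  have "B = {x \<in> topspace X. nn w e (f x) \<in> {..(l e - \<tau>) / l e}}"
    using l_pos[OF e(2)] by (auto simp: B_def nn_e field_simps)
  then have "closedin X B"
    using closedin_continuous_map_preimage[OF continuous_map_nn[OF e(2) uw(2)], of "{..(l e - \<tau>) / l e}"]
    by simp
  then show ?thesis
    using that tm metric_subtree_of_model[OF tm] by blast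
qed

end

section \<open>Schemes of marked balls and sub-trees\<close>

text \<open>A sub-tree of the required kind is used at a certain level and with a certain weight. The
  resources that a scheme consumes are recorded as a density on the marks, and its effect as a lower
  bound for the coverage; in this form schemes can be added and rescaled.\<close>

definition triples_ok :: "'a metric \<Rightarrow> nat \<Rightarrow> real \<Rightarrow> (real \<times> 'a set \<times> real) list \<Rightarrow> bool" where
  "triples_ok S m s tr \<longleftrightarrow> (\<forall>(u, B, t)\<in>set tr. 0 < u \<and> metric_subtree B S \<and>
     card (tree_leaves (submetric S B)) = m \<and> 0 < t \<and> t \<le> s \<and>
     tree_length (submetric S B) \<le> tree_length S / 2 \<and> 2 * t \<le> tree_length (submetric S B))"

definition achievable ::
  "'a metric \<Rightarrow> nat \<Rightarrow> real \<Rightarrow> (real \<Rightarrow> ennreal) \<Rightarrow> ('a \<Rightarrow> real) \<Rightarrow> bool" where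
  "achievable S m s \<psi> c \<longleftrightarrow> \<psi> \<in> borel_measurable borel \<and>
     (\<exists>\<eta> tr. finite_borel_measure_on S s \<eta> \<and> triples_ok S m s tr \<and>
       (\<forall>x\<in>mspace S. c x \<le> cover_fun S s \<eta> x + (\<Sum>(u, B, t)\<leftarrow>tr. u * indicator B x)) \<and>
       (\<forall>A\<in>sets borel. emeasure (mark_marginal \<eta>) A +
           (\<Sum>(u, B, t)\<leftarrow>tr. ennreal u * emeasure (Lam (submetric S B) t) A)
         \<le> (\<integral>\<^sup>+y. \<psi> y * indicator A y \<partial>lborel)))"

lemma openin_marked_subset:
  "{U. openin (prod_topology (mtopology_of T) (top_of_set {0..r})) U} \<subseteq> Pow (mspace T \<times> {0..r})"
  by (auto dest!: openin_subset)

lemma space_marked_borel [simp]: "space (marked_borel T r) = mspace T \<times> {0..r}"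
  by (simp add: marked_borel_def space_measure_of[OF openin_marked_subset])

lemma open_in_marked_borel:
  assumes "openin (prod_topology (mtopology_of T) (top_of_set {0..r})) U"
  shows "U \<in> sets (marked_borel T r)"
  using assms by (simp add: marked_borel_def sets_measure_of[OF openin_marked_subset] sigma_sets.Basic)

lemma measurable_into_marked_borel:
  assumes "h \<in> space N \<rightarrow> mspace T \<times> {0..r}"
    and "\<And>U. openin (prod_topology (mtopology_of T) (top_of_set {0..r})) U \<Longrightarrow> h -` U \<inter> space N \<in> sets N"
  shows "h \<in> measurable N (marked_borel T r)"
  unfolding marked_borel_def
  by (rule measurable_measure_of[OF openin_marked_subset assms(1)]) (use assms(2) in auto)

lemma finite_borel_measure_onD:
  assumes "finite_borel_measure_on T r \<eta>"
  shows "finite_measure \<eta>" "sets \<eta> = sets (marked_borel T r)" "space \<eta> = mspace T \<times> {0..r}"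
  using assms sets_eq_imp_space_eq[of \<eta> "marked_borel T r"] by (auto simp: finite_borel_measure_on_def)

lemma snd_measurable_marked_borel: "snd \<in> borel_measurable (marked_borel T r)"
proof (rule borel_measurableI)
  fix U :: "real set"
  assume "open U"
  then have "openin (prod_topology (mtopology_of T) (top_of_set {0..r})) (mspace T \<times> ({0..r} \<inter> U))"
    using openin_topspace[of "mtopology_of T"] by (simp add: openin_prod_Times_iff openin_open_Int)
  moreover have "snd -` U \<inter> space (marked_borel T r) = mspace T \<times> ({0..r} \<inter> U)"
    by auto
  ultimately show "snd -` U \<inter> space (marked_borel T r) \<in> sets (marked_borel T r)"
    using open_in_marked_borel by metis
qed

lemma emeasure_mark_marginal:
  assumes "finite_borel_measure_on T r \<eta>" "A \<in> sets borel"
  shows "emeasure (mark_marginal \<eta>) A = emeasure \<eta> (snd -` A \<inter> space \<eta>)"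
proof -
  have "snd \<in> borel_measurable \<eta>"
    using snd_measurable_marked_borel measurable_cong_sets[OF finite_borel_measure_onD(2)[OF assms(1)] refl]
    by blast
  then show ?thesis
    unfolding mark_marginal_def using assms(2) by (simp add: emeasure_distr)
qed

lemma ball_marks_measurable:
  assumes "x \<in> mspace T"
  shows "{(v, s') \<in> mspace T \<times> {0..r}. mdist T x v \<le> s'} \<in> sets (marked_borel T r)"
proof -
  let ?P = "prod_topology (mtopology_of T) (top_of_set {0..r})"
  have "dist (mdist T x v) (mdist T x v') \<le> 1 * mdist T v v'" if "v \<in> mspace T" "v' \<in> mspace T" for v v'
    using mdist_triangle[OF assms that] mdist_triangle[OF assms that(2,1)] mdist_commute[of T v v']
    by (simp add: dist_real_def)
  then have "Lipschitz_continuous_map T euclidean_metric (\<lambda>v. mdist T x v)"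
    unfolding Lipschitz_continuous_map_def by (auto intro!: exI[of _ 1])
  then have "continuous_map (mtopology_of T) euclideanreal (\<lambda>v. mdist T x v)"
    using Lipschitz_continuous_imp_continuous_map by fastforce
  then have "continuous_map ?P euclideanreal (\<lambda>z. mdist T x (fst z))"
    using continuous_map_compose[OF continuous_map_fst] by (fastforce simp: o_def)
  moreover have "continuous_map ?P euclideanreal (\<lambda>z. snd z)"
    by (rule continuous_map_into_fulltopology[OF continuous_map_snd])
  ultimately have cont: "continuous_map ?P euclideanreal (\<lambda>z. mdist T x (fst z) - snd z)"
    by (rule continuous_map_diff)
  have "openin ?P {z \<in> topspace ?P. mdist T x (fst z) - snd z \<in> {0<..}}"
    by (rule openin_continuous_map_preimage[OF cont]) auto
  then have "{z \<in> topspace ?P. mdist T x (fst z) - snd z \<in> {0<..}} \<in> sets (marked_borel T r)"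
    by (rule open_in_marked_borel)
  then have "space (marked_borel T r) - {z \<in> topspace ?P. mdist T x (fst z) - snd z \<in> {0<..}}
      \<in> sets (marked_borel T r)"
    by (rule sets.compl_sets)
  moreover have "space (marked_borel T r) - {z \<in> topspace ?P. mdist T x (fst z) - snd z \<in> {0<..}}
      = {(v, s') \<in> mspace T \<times> {0..r}. mdist T x v \<le> s'}"
    by auto
  ultimately show ?thesis
    by simp
qed

lemma cover_fun_emeasure:
  assumes "finite_borel_measure_on T r \<eta>"
  shows "emeasure \<eta> {(v, s') \<in> mspace T \<times> {0..r}. mdist T x v \<le> s'} = ennreal (cover_fun T r \<eta> x)"
  using finite_borel_measure_onD(1)[OF assms] by (simp add: cover_fun_def finite_measure.emeasure_eq_measure)

definition add_measure :: "'b measure \<Rightarrow> 'b measure \<Rightarrow> 'b measure" where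
  "add_measure M N = measure_of (space M) (sets M) (\<lambda>A. emeasure M A + emeasure N A)"

lemma sets_add_measure [simp]: "sets (add_measure M N) = sets M"
  by (simp add: add_measure_def sets.sets_measure_of_eq)

lemma emeasure_add_measure:
  assumes "sets N = sets M" "A \<in> sets M"
  shows "emeasure (add_measure M N) A = emeasure M A + emeasure N A"
proof (rule emeasure_measure_of[OF add_measure_def])
  show "sets M \<subseteq> Pow (space M)"
    by (rule sets.space_closed)
  show "positive (sets (add_measure M N)) (\<lambda>A. emeasure M A + emeasure N A)"
    by (simp add: positive_def)
  show "countably_additive (sets (add_measure M N)) (\<lambda>A. emeasure M A + emeasure N A)"
  proof (rule countably_additiveI)
    fix F :: "nat \<Rightarrow> 'a set"
    assume F: "range F \<subseteq> sets (add_measure M N)" "disjoint_family F"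
    have "(\<Sum>i. emeasure M (F i)) = emeasure M (\<Union>i. F i)" "(\<Sum>i. emeasure N (F i)) = emeasure N (\<Union>i. F i)"
      using F assms(1) by (auto intro!: suminf_emeasure)
    then show "(\<Sum>i. emeasure M (F i) + emeasure N (F i)) = emeasure M (\<Union>i. F i) + emeasure N (\<Union>i. F i)"
      by (subst suminf_add[symmetric]) auto
  qed
  show "A \<in> sets (add_measure M N)"
    using assms(2) by simp
qed

lemma finite_borel_add:
  assumes "finite_borel_measure_on T r \<eta>" "finite_borel_measure_on T r \<eta>'"
  shows "finite_borel_measure_on T r (add_measure \<eta> \<eta>')"
    "A \<in> sets borel \<Longrightarrow> emeasure (mark_marginal (add_measure \<eta> \<eta>')) A =
        emeasure (mark_marginal \<eta>) A + emeasure (mark_marginal \<eta>') A"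
    "x \<in> mspace T \<Longrightarrow> cover_fun T r (add_measure \<eta> \<eta>') x = cover_fun T r \<eta> x + cover_fun T r \<eta>' x"
proof -
  note 1 = finite_borel_measure_onD[OF assms(1)] and 2 = finite_borel_measure_onD[OF assms(2)]
  have sets_eq: "sets \<eta>' = sets \<eta>"
    using 1 2 by simp
  have space_eq: "space (add_measure \<eta> \<eta>') = space \<eta>" "space \<eta>' = space \<eta>"
    using sets_eq_imp_space_eq[OF sets_add_measure[of \<eta> \<eta>']] 1(3) 2(3) by simp_all
  have "emeasure (add_measure \<eta> \<eta>') (space \<eta>) \<noteq> \<infinity>"
    using emeasure_add_measure[OF sets_eq] finite_measure.emeasure_finite[OF 1(1)]
      finite_measure.emeasure_finite[OF 2(1)] by simp
  then show fin: "finite_borel_measure_on T r (add_measure \<eta> \<eta>')"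
    using 1(2) unfolding space_eq(1)[symmetric] finite_borel_measure_on_def
    by (simp add: finite_measureI)
  show "emeasure (mark_marginal (add_measure \<eta> \<eta>')) A =
        emeasure (mark_marginal \<eta>) A + emeasure (mark_marginal \<eta>') A" if A: "A \<in> sets borel"
  proof -
    have "snd \<in> borel_measurable \<eta>"
      using snd_measurable_marked_borel measurable_cong_sets[OF 1(2) refl] by blast
    then have "snd -` A \<inter> space \<eta> \<in> sets \<eta>"
      using A by (rule measurable_sets)
    then show ?thesis
      unfolding emeasure_mark_marginal[OF fin A] emeasure_mark_marginal[OF assms(1) A]
        emeasure_mark_marginal[OF assms(2) A] space_eq
      by (rule emeasure_add_measure[OF sets_eq])
  qed
  show "cover_fun T r (add_measure \<eta> \<eta>') x = cover_fun T r \<eta> x + cover_fun T r \<eta>' x" if x: "x \<in> mspace T"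
  proof -
    have "ennreal (cover_fun T r (add_measure \<eta> \<eta>') x) =
        ennreal (cover_fun T r \<eta> x) + ennreal (cover_fun T r \<eta>' x)"
      unfolding cover_fun_emeasure[OF fin, symmetric] cover_fun_emeasure[OF assms(1), symmetric]
        cover_fun_emeasure[OF assms(2), symmetric]
      by (rule emeasure_add_measure[OF sets_eq]) (use ball_marks_measurable[OF x] 1 in simp)
    then show ?thesis
      by (simp add: cover_fun_def flip: ennreal_plus)
  qed
qed

lemma finite_borel_scale:
  assumes "finite_borel_measure_on T r \<eta>" "0 \<le> k"
  shows "finite_borel_measure_on T r (scale_measure (ennreal k) \<eta>)"
    "A \<in> sets borel \<Longrightarrow> emeasure (mark_marginal (scale_measure (ennreal k) \<eta>)) A =
        ennreal k * emeasure (mark_marginal \<eta>) A"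
    "cover_fun T r (scale_measure (ennreal k) \<eta>) x = k * cover_fun T r \<eta> x"
proof -
  note 1 = finite_borel_measure_onD[OF assms(1)]
  have "emeasure (scale_measure (ennreal k) \<eta>) (space \<eta>) \<noteq> \<infinity>"
    using finite_measure.emeasure_finite[OF 1(1)] by (simp add: ennreal_mult_eq_top_iff)
  then show fin: "finite_borel_measure_on T r (scale_measure (ennreal k) \<eta>)"
    using 1 by (auto simp: finite_borel_measure_on_def space_scale_measure intro!: finite_measureI)
  show "emeasure (mark_marginal (scale_measure (ennreal k) \<eta>)) A =
        ennreal k * emeasure (mark_marginal \<eta>) A" if "A \<in> sets borel"
    using emeasure_mark_marginal[OF fin that] emeasure_mark_marginal[OF assms(1) that]
    by (simp add: space_scale_measure)
  show "cover_fun T r (scale_measure (ennreal k) \<eta>) x = k * cover_fun T r \<eta> x"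
    using assms(2) by (simp add: cover_fun_def measure_def enn2real_mult)
qed

lemma achievable_add:
  assumes "achievable S m s \<psi> c" "achievable S m s \<psi>' c'"
  shows "achievable S m s (\<lambda>y. \<psi> y + \<psi>' y) (\<lambda>x. c x + c' x)"
proof -
  obtain \<eta> tr where 1: "finite_borel_measure_on S s \<eta>" "triples_ok S m s tr"
    "\<And>x. x \<in> mspace S \<Longrightarrow> c x \<le> cover_fun S s \<eta> x + (\<Sum>(u, B, t)\<leftarrow>tr. u * indicator B x)"
    "\<And>A. A \<in> sets borel \<Longrightarrow> emeasure (mark_marginal \<eta>) A +
       (\<Sum>(u, B, t)\<leftarrow>tr. ennreal u * emeasure (Lam (submetric S B) t) A) \<le> (\<integral>\<^sup>+y. \<psi> y * indicator A y \<partial>lborel)"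
    using assms(1) unfolding achievable_def by blast
  obtain \<eta>' tr' where 2: "finite_borel_measure_on S s \<eta>'" "triples_ok S m s tr'"
    "\<And>x. x \<in> mspace S \<Longrightarrow> c' x \<le> cover_fun S s \<eta>' x + (\<Sum>(u, B, t)\<leftarrow>tr'. u * indicator B x)"
    "\<And>A. A \<in> sets borel \<Longrightarrow> emeasure (mark_marginal \<eta>') A +
       (\<Sum>(u, B, t)\<leftarrow>tr'. ennreal u * emeasure (Lam (submetric S B) t) A) \<le> (\<integral>\<^sup>+y. \<psi>' y * indicator A y \<partial>lborel)"
    using assms(2) unfolding achievable_def by blast
  have meas: "\<psi> \<in> borel_measurable borel" "\<psi>' \<in> borel_measurable borel"
    using assms by (auto simp: achievable_def)
  note add = finite_borel_add[OF 1(1) 2(1)]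
  have "emeasure (mark_marginal (add_measure \<eta> \<eta>')) A +
      (\<Sum>(u, B, t)\<leftarrow>tr @ tr'. ennreal u * emeasure (Lam (submetric S B) t) A)
      \<le> (\<integral>\<^sup>+y. (\<psi> y + \<psi>' y) * indicator A y \<partial>lborel)" if A: "A \<in> sets borel" for A
  proof -
    have "(\<integral>\<^sup>+y. (\<psi> y + \<psi>' y) * indicator A y \<partial>lborel) =
        (\<integral>\<^sup>+y. \<psi> y * indicator A y \<partial>lborel) + (\<integral>\<^sup>+y. \<psi>' y * indicator A y \<partial>lborel)"
      unfolding distrib_right using meas A by (intro nn_integral_add) auto
    moreover have "(e1 + e2) + (t1 + t2) \<le> i1 + i2" if "e1 + t1 \<le> i1" "e2 + t2 \<le> i2"
      for e1 e2 t1 t2 i1 i2 :: ennreal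
      using add_mono[OF that] by (simp add: algebra_simps)
    ultimately show ?thesis
      using 1(4)[OF A] 2(4)[OF A] add(2)[OF A] by simp
  qed
  moreover have "c x + c' x \<le> cover_fun S s (add_measure \<eta> \<eta>') x + (\<Sum>(u, B, t)\<leftarrow>tr @ tr'. u * indicator B x)"
    if "x \<in> mspace S" for x
    using 1(3)[OF that] 2(3)[OF that] add(3)[OF that] by simp
  moreover have "triples_ok S m s (tr @ tr')"
    using 1(2) 2(2) by (auto simp: triples_ok_def)
  moreover have "(\<lambda>y. \<psi> y + \<psi>' y) \<in> borel_measurable borel"
    using meas by measurable
  ultimately show ?thesis
    unfolding achievable_def using add(1) by blast
qed

lemma achievable_zero: "achievable S m s (\<lambda>_. 0) (\<lambda>_. 0)"
proof -
  have fin: "finite_borel_measure_on S s (null_measure (marked_borel S s))"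
    by (auto simp: finite_borel_measure_on_def intro!: finite_measureI)
  moreover have "emeasure (mark_marginal (null_measure (marked_borel S s))) A = 0" if "A \<in> sets borel" for A
    using emeasure_mark_marginal[OF fin that] by simp
  ultimately show ?thesis
    unfolding achievable_def
    by (intro conjI exI[of _ "null_measure (marked_borel S s)"] exI[of _ "[]"])
      (auto simp: triples_ok_def cover_fun_def)
qed

lemma achievable_mono_AE:
  assumes "achievable S m s \<psi> c" "\<And>x. x \<in> mspace S \<Longrightarrow> c' x \<le> c x"
    and "AE y in lborel. \<psi> y \<le> \<psi>' y"
    and "\<psi>' \<in> borel_measurable borel"
  shows "achievable S m s \<psi>' c'"
proof -
  have le: "(\<integral>\<^sup>+y. \<psi> y * indicator A y \<partial>lborel) \<le> (\<integral>\<^sup>+y. \<psi>' y * indicator A y \<partial>lborel)" for A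
    by (rule nn_integral_mono_AE) (use assms(3) in eventually_elim, simp add: mult_right_mono)
  obtain \<eta> tr where 1: "finite_borel_measure_on S s \<eta>" "triples_ok S m s tr"
    "\<And>x. x \<in> mspace S \<Longrightarrow> c x \<le> cover_fun S s \<eta> x + (\<Sum>(u, B, t)\<leftarrow>tr. u * indicator B x)"
    "\<And>A. A \<in> sets borel \<Longrightarrow> emeasure (mark_marginal \<eta>) A +
       (\<Sum>(u, B, t)\<leftarrow>tr. ennreal u * emeasure (Lam (submetric S B) t) A) \<le> (\<integral>\<^sup>+y. \<psi> y * indicator A y \<partial>lborel)"
    using assms(1) unfolding achievable_def by blast
  have "\<forall>x\<in>mspace S. c' x \<le> cover_fun S s \<eta> x + (\<Sum>(u, B, t)\<leftarrow>tr. u * indicator B x)"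
    using 1(3) assms(2) order_trans by blast
  moreover have "\<forall>A\<in>sets borel. emeasure (mark_marginal \<eta>) A +
       (\<Sum>(u, B, t)\<leftarrow>tr. ennreal u * emeasure (Lam (submetric S B) t) A) \<le> (\<integral>\<^sup>+y. \<psi>' y * indicator A y \<partial>lborel)"
    using 1(4) le order_trans by blast
  ultimately show ?thesis
    unfolding achievable_def using 1(1,2) assms(4) by blast
qed

lemma achievable_mono:
  assumes "achievable S m s \<psi> c" "\<And>x. x \<in> mspace S \<Longrightarrow> c' x \<le> c x" "\<And>y. \<psi> y \<le> \<psi>' y"
    and "\<psi>' \<in> borel_measurable borel"
  shows "achievable S m s \<psi>' c'"
  using achievable_mono_AE[OF assms(1,2) _ assms(4)] assms(3) by simp

lemma achievable_scale:
  assumes "achievable S m s \<psi> c" "0 \<le> k"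
  shows "achievable S m s (\<lambda>y. ennreal k * \<psi> y) (\<lambda>x. k * c x)"
proof (cases "k = 0")
  case True
  then show ?thesis
    using achievable_zero by simp
next
  case False
  then have k: "0 < k"
    using assms(2) by simp
  obtain \<eta> tr where 1: "finite_borel_measure_on S s \<eta>" "triples_ok S m s tr"
    "\<And>x. x \<in> mspace S \<Longrightarrow> c x \<le> cover_fun S s \<eta> x + (\<Sum>(u, B, t)\<leftarrow>tr. u * indicator B x)"
    "\<And>A. A \<in> sets borel \<Longrightarrow> emeasure (mark_marginal \<eta>) A +
       (\<Sum>(u, B, t)\<leftarrow>tr. ennreal u * emeasure (Lam (submetric S B) t) A) \<le> (\<integral>\<^sup>+y. \<psi> y * indicator A y \<partial>lborel)"
    using assms(1) unfolding achievable_def by blast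
  have meas: "\<psi> \<in> borel_measurable borel"
    using assms(1) by (simp add: achievable_def)
  note sc = finite_borel_scale[OF 1(1) assms(2)]
  let ?tr = "map (\<lambda>(u, B, t). (k * u, B, t)) tr"
  have sum_u: "(\<Sum>(u, B, t)\<leftarrow>?tr. u * indicator B x) = k * (\<Sum>(u, B, t)\<leftarrow>tr. u * indicator B x)" for x
    by (induction tr) (auto simp: algebra_simps)
  have sum_e: "(\<Sum>(u, B, t)\<leftarrow>?tr. ennreal u * emeasure (Lam (submetric S B) t) A) =
      ennreal k * (\<Sum>(u, B, t)\<leftarrow>tr. ennreal u * emeasure (Lam (submetric S B) t) A)" for A
    by (induction tr) (auto simp: distrib_left ennreal_mult'[OF assms(2)] mult.assoc)
  have "emeasure (mark_marginal (scale_measure (ennreal k) \<eta>)) A +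
      (\<Sum>(u, B, t)\<leftarrow>?tr. ennreal u * emeasure (Lam (submetric S B) t) A)
      \<le> (\<integral>\<^sup>+y. ennreal k * \<psi> y * indicator A y \<partial>lborel)" if A: "A \<in> sets borel" for A
  proof -
    have "(\<integral>\<^sup>+y. ennreal k * \<psi> y * indicator A y \<partial>lborel) = ennreal k * (\<integral>\<^sup>+y. \<psi> y * indicator A y \<partial>lborel)"
      unfolding mult.assoc using meas A by (intro nn_integral_cmult) auto
    then show ?thesis
      unfolding sc(2)[OF A] sum_e distrib_left[symmetric] using mult_left_mono[OF 1(4)[OF A]] by simp
  qed
  moreover have "k * c x \<le> cover_fun S s (scale_measure (ennreal k) \<eta>) x + (\<Sum>(u, B, t)\<leftarrow>?tr. u * indicator B x)"
    if "x \<in> mspace S" for x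
    unfolding sc(3) sum_u distrib_left[symmetric] using 1(3)[OF that] k by simp
  moreover have "triples_ok S m s ?tr"
    using 1(2) k by (auto simp: triples_ok_def)
  moreover have "(\<lambda>y. ennreal k * \<psi> y) \<in> borel_measurable borel"
    using meas by measurable
  ultimately show ?thesis
    unfolding achievable_def using sc(1) by blast
qed

lemma achievable_sum:
  assumes "finite I" "\<And>i. i \<in> I \<Longrightarrow> achievable S m s (\<psi> i) (c i)"
  shows "achievable S m s (\<lambda>y. \<Sum>i\<in>I. \<psi> i y) (\<lambda>x. \<Sum>i\<in>I. c i x)"
  using assms
proof (induction I rule: finite_induct)
  case empty
  then show ?case
    using achievable_zero by simp
next
  case (insert i I)
  then show ?case
    using achievable_add[of S m s "\<psi> i" "c i"] by simp
qed

text \<open>Lebesgue measure on the marks is transported to the balls; a continuous choice of the centres makes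
  this a Borel measure.\<close>

lemma achievable_balls:
  assumes "0 \<le> \<alpha>" "\<beta> \<le> s" "continuous_map (top_of_set {\<alpha>..\<beta>}) (mtopology_of S) z"
  shows "achievable S m s (indicator {\<alpha>..\<beta>})
    (\<lambda>x. measure lborel {r \<in> {\<alpha>..\<beta>}. mdist S x (z r) \<le> r})"
proof -
  let ?N = "restrict_space lborel {\<alpha>..\<beta>}" and ?h = "\<lambda>r. (z r, r)"
  define \<eta> where "\<eta> = distr ?N (marked_borel S s) ?h"
  have z_in: "z r \<in> mspace S" if "r \<in> {\<alpha>..\<beta>}" for r
    using continuous_map_image_subset_topspace[OF assms(3)] that by auto
  have sp: "space ?N = {\<alpha>..\<beta>}"
    by (simp add: space_restrict_space)
  have "continuous_map (top_of_set {\<alpha>..\<beta>}) (top_of_set {0..s}) (\<lambda>r. r)"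
    using assms(1,2) by (intro continuous_map_into_subtopology continuous_map_from_subtopology) auto
  then have cont: "continuous_map (top_of_set {\<alpha>..\<beta>}) (prod_topology (mtopology_of S) (top_of_set {0..s})) ?h"
    using assms(3) by (simp add: continuous_map_pairedI)
  have h: "?h \<in> measurable ?N (marked_borel S s)"
  proof (rule measurable_into_marked_borel)
    show "?h \<in> space ?N \<rightarrow> mspace S \<times> {0..s}"
      using z_in assms(1,2) unfolding sp by auto
    fix U
    assume "openin (prod_topology (mtopology_of S) (top_of_set {0..s})) U"
    then have "openin (top_of_set {\<alpha>..\<beta>}) {r \<in> topspace (top_of_set {\<alpha>..\<beta>}). ?h r \<in> U}"
      by (rule openin_continuous_map_preimage[OF cont])
    then obtain O' where O': "open O'" "{r \<in> {\<alpha>..\<beta>}. ?h r \<in> U} = {\<alpha>..\<beta>} \<inter> O'"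
      by (auto simp: openin_open)
    have "?h -` U \<inter> space ?N = {r \<in> {\<alpha>..\<beta>}. ?h r \<in> U}"
      unfolding sp by auto
    then show "?h -` U \<inter> space ?N \<in> sets ?N"
      using O' by (auto simp: sets_restrict_space)
  qed
  have fin_N: "finite_measure ?N"
    by (rule finite_measureI) (simp add: sp emeasure_restrict_space emeasure_lborel_cbox_eq
      flip: box_real)
  have fin: "finite_borel_measure_on S s \<eta>"
    using finite_measure.finite_measure_distr[OF fin_N h] by (simp add: finite_borel_measure_on_def \<eta>_def)
  have marg: "emeasure (mark_marginal \<eta>) A = (\<integral>\<^sup>+y. indicator {\<alpha>..\<beta>} y * indicator A y \<partial>lborel)"
    if A: "A \<in> sets borel" for A
  proof -
    have "snd -` A \<inter> space (marked_borel S s) \<in> sets (marked_borel S s)"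
      using snd_measurable_marked_borel A by (rule measurable_sets)
    then have "emeasure (mark_marginal \<eta>) A = emeasure ?N (?h -` (snd -` A \<inter> space (marked_borel S s)) \<inter> space ?N)"
      unfolding emeasure_mark_marginal[OF fin A] by (simp add: \<eta>_def emeasure_distr[OF h])
    also have "?h -` (snd -` A \<inter> space (marked_borel S s)) \<inter> space ?N = {\<alpha>..\<beta>} \<inter> A"
      using z_in assms(1,2) unfolding sp by auto
    also have "emeasure ?N ({\<alpha>..\<beta>} \<inter> A) = emeasure lborel ({\<alpha>..\<beta>} \<inter> A)"
      by (rule emeasure_restrict_space) auto
    also have "\<dots> = (\<integral>\<^sup>+y. indicator ({\<alpha>..\<beta>} \<inter> A) y \<partial>lborel)"
      using A by simp
    also have "\<dots> = (\<integral>\<^sup>+y. indicator {\<alpha>..\<beta>} y * indicator A y \<partial>lborel)"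
      by (simp only: indicator_inter_arith)
    finally show ?thesis .
  qed
  have cover: "cover_fun S s \<eta> x = measure lborel {r \<in> {\<alpha>..\<beta>}. mdist S x (z r) \<le> r}" if x: "x \<in> mspace S" for x
  proof -
    let ?K = "{(v, s') \<in> mspace S \<times> {0..s}. mdist S x v \<le> s'}"
    have "cover_fun S s \<eta> x = measure ?N (?h -` ?K \<inter> space ?N)"
      unfolding cover_fun_def \<eta>_def by (rule measure_distr[OF h ball_marks_measurable[OF x]])
    also have "?h -` ?K \<inter> space ?N = {r \<in> {\<alpha>..\<beta>}. mdist S x (z r) \<le> r}"
      using z_in assms(1,2) unfolding sp by auto
    also have "measure ?N \<dots> = measure lborel \<dots>"
      by (rule measure_restrict_space) auto
    finally show ?thesis .
  qed
  have "(indicator {\<alpha>..\<beta>} :: real \<Rightarrow> ennreal) \<in> borel_measurable borel"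
    by simp
  then show ?thesis
    unfolding achievable_def using fin marg cover
    by (intro conjI exI[of _ \<eta>] exI[of _ "[]"]) (auto simp: triples_ok_def)
qed

lemma emeasure_Lam:
  assumes "A \<in> sets borel" "0 < t" "0 \<le> tree_length T"
  shows "emeasure (Lam T t) A = (\<integral>\<^sup>+y. ennreal (tree_length T / t\<^sup>2) * indicator {0..t} y * indicator A y \<partial>lborel)"
proof -
  have "(\<integral>\<^sup>+y. ennreal (tree_length T / t\<^sup>2) * indicator {0..t} y * indicator A y \<partial>lborel) =
      (\<integral>\<^sup>+y. ennreal (tree_length T / t\<^sup>2) * indicator ({0..t} \<inter> A) y \<partial>lborel)"
    by (simp only: indicator_inter_arith mult.assoc)
  also have "\<dots> = ennreal (tree_length T / t\<^sup>2) * emeasure lborel ({0..t} \<inter> A)"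
    using assms(1) by (intro nn_integral_cmult_indicator) auto
  finally have R: "(\<integral>\<^sup>+y. ennreal (tree_length T / t\<^sup>2) * indicator {0..t} y * indicator A y \<partial>lborel) =
      ennreal (tree_length T / t\<^sup>2) * emeasure lborel ({0..t} \<inter> A)" .
  have "emeasure lborel ({0..t} \<inter> A) \<le> emeasure lborel {0..t}"
    by (rule emeasure_mono) auto
  then have "emeasure lborel ({0..t} \<inter> A) < \<infinity>"
    using assms(2) by (simp add: le_less_trans)
  then obtain y where y: "0 \<le> y" "emeasure lborel ({0..t} \<inter> A) = ennreal y"
    by (metis ennreal_cases less_irrefl infinity_ennreal_def)
  have "emeasure (Lam T t) A = ennreal (tree_length T / t) * (emeasure lborel ({0..t} \<inter> A) / ennreal t)"
    unfolding Lam_def using assms(1,2) by (simp add: emeasure_uniform_measure)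
  also have "\<dots> = ennreal (tree_length T / t\<^sup>2) * emeasure lborel ({0..t} \<inter> A)"
    using assms(2,3) y by (simp add: divide_ennreal ennreal_mult[symmetric] power2_eq_square)
  finally show ?thesis
    unfolding R .
qed

text \<open>A sub-tree to which the induction hypothesis applies: its cover is pushed forward along the
  inclusion, which does not change distances or marks.\<close>

lemma achievable_of_cover:
  assumes T: "fractional_marked_ball_cover T \<tau> \<xi>"
    "\<And>A. A \<in> sets borel \<Longrightarrow> emeasure (mark_marginal \<xi>) A \<le> emeasure (Lam T \<tau>) A"
    "0 < \<tau>" "\<tau> \<le> s" "0 \<le> tree_length T"
    and h: "\<And>v. v \<in> mspace T \<Longrightarrow> h v \<in> mspace S"
    "\<And>v w. v \<in> mspace T \<Longrightarrow> w \<in> mspace T \<Longrightarrow> mdist S (h v) (h w) = mdist T v w"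
  shows "achievable S m s (\<lambda>y. ennreal (tree_length T / \<tau>\<^sup>2) * indicator {0..\<tau>} y) (indicator (h ` mspace T))"
proof -
  have fin_\<xi>: "finite_borel_measure_on T \<tau> \<xi>"
    using T(1) by (simp add: fractional_marked_ball_cover_def)
  note \<xi> = finite_borel_measure_onD[OF fin_\<xi>]
  let ?h = "\<lambda>(v, r). (h v, r)"
  define \<eta> where "\<eta> = distr \<xi> (marked_borel S s) ?h"
  have "Lipschitz_continuous_map T S h"
    unfolding Lipschitz_continuous_map_def using h by (auto intro!: exI[of _ 1])
  then have "continuous_map (mtopology_of T) (mtopology_of S) h"
    by (rule Lipschitz_continuous_imp_continuous_map)
  then have "continuous_map (prod_topology (mtopology_of T) (top_of_set {0..\<tau>})) (mtopology_of S) (\<lambda>z. h (fst z))"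
    using continuous_map_compose[OF continuous_map_fst] by (fastforce simp: o_def)
  moreover have "continuous_map (prod_topology (mtopology_of T) (top_of_set {0..\<tau>})) (top_of_set {0..s}) (\<lambda>z. snd z)"
    using continuous_map_into_fulltopology[OF continuous_map_snd] T(4)
    by (intro continuous_map_into_subtopology) (auto simp: o_def)
  ultimately have cont: "continuous_map (prod_topology (mtopology_of T) (top_of_set {0..\<tau>}))
      (prod_topology (mtopology_of S) (top_of_set {0..s})) ?h"
    unfolding case_prod_unfold by (rule continuous_map_pairedI)
  have h_meas: "?h \<in> measurable \<xi> (marked_borel S s)"
  proof (rule measurable_into_marked_borel)
    show "?h \<in> space \<xi> \<rightarrow> mspace S \<times> {0..s}"
      using h(1) T(4) unfolding \<xi>(3) by auto
    fix U
    assume "openin (prod_topology (mtopology_of S) (top_of_set {0..s})) U"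
    then have "openin (prod_topology (mtopology_of T) (top_of_set {0..\<tau>}))
        {z \<in> topspace (prod_topology (mtopology_of T) (top_of_set {0..\<tau>})). ?h z \<in> U}"
      by (rule openin_continuous_map_preimage[OF cont])
    then have "{z \<in> topspace (prod_topology (mtopology_of T) (top_of_set {0..\<tau>})). ?h z \<in> U} \<in> sets \<xi>"
      unfolding \<xi>(2) by (rule open_in_marked_borel)
    moreover have "{z \<in> topspace (prod_topology (mtopology_of T) (top_of_set {0..\<tau>})). ?h z \<in> U} = ?h -` U \<inter> space \<xi>"
      unfolding \<xi>(3) by auto
    ultimately show "?h -` U \<inter> space \<xi> \<in> sets \<xi>"
      by simp
  qed
  have fin: "finite_borel_measure_on S s \<eta>"
    using finite_measure.finite_measure_distr[OF \<xi>(1) h_meas] by (simp add: finite_borel_measure_on_def \<eta>_def)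
  have marg: "emeasure (mark_marginal \<eta>) A \<le>
      (\<integral>\<^sup>+y. ennreal (tree_length T / \<tau>\<^sup>2) * indicator {0..\<tau>} y * indicator A y \<partial>lborel)" if A: "A \<in> sets borel" for A
  proof -
    have "snd -` A \<inter> space (marked_borel S s) \<in> sets (marked_borel S s)"
      using snd_measurable_marked_borel A by (rule measurable_sets)
    then have "emeasure (mark_marginal \<eta>) A = emeasure \<xi> (?h -` (snd -` A \<inter> space (marked_borel S s)) \<inter> space \<xi>)"
      unfolding emeasure_mark_marginal[OF fin A] by (simp add: \<eta>_def emeasure_distr[OF h_meas])
    also have "?h -` (snd -` A \<inter> space (marked_borel S s)) \<inter> space \<xi> = snd -` A \<inter> space \<xi>"
      using h(1) T(4) unfolding \<xi>(3) by auto
    also have "emeasure \<xi> \<dots> = emeasure (mark_marginal \<xi>) A"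
      by (rule emeasure_mark_marginal[OF fin_\<xi> A, symmetric])
    finally show ?thesis
      using T(2)[OF A] emeasure_Lam[OF A T(3,5)] by simp
  qed
  have cover: "1 \<le> cover_fun S s \<eta> (h v)" if v: "v \<in> mspace T" for v
  proof -
    have "cover_fun S s \<eta> (h v) = measure \<xi> (?h -` {(w, s') \<in> mspace S \<times> {0..s}. mdist S (h v) w \<le> s'} \<inter> space \<xi>)"
      unfolding cover_fun_def \<eta>_def by (rule measure_distr[OF h_meas ball_marks_measurable[OF h(1)[OF v]]])
    also have "?h -` {(w, s') \<in> mspace S \<times> {0..s}. mdist S (h v) w \<le> s'} \<inter> space \<xi> =
        {(w, s') \<in> mspace T \<times> {0..\<tau>}. mdist T v w \<le> s'}"
      using h v T(4) unfolding \<xi>(3) by auto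
    finally show ?thesis
      using T(1) v by (simp add: fractional_marked_ball_cover_def cover_fun_def)
  qed
  have "indicator (h ` mspace T) x \<le> cover_fun S s \<eta> x" for x
    using cover by (cases "x \<in> h ` mspace T") (auto simp: cover_fun_def)
  moreover have "(\<lambda>y. ennreal (tree_length T / \<tau>\<^sup>2) * indicator {0..\<tau>} y) \<in> borel_measurable borel"
    by measurable
  ultimately show ?thesis
    unfolding achievable_def using fin marg
    by (intro conjI exI[of _ \<eta>] exI[of _ "[]"]) (auto simp: triples_ok_def)
qed

text \<open>This is the only place where the two ways of using a sub-tree differ. One with fewer leaves is
  covered by the induction hypothesis, one with all \<open>m\<close> leaves is left as a triple, for which it must
  have at most half of the length. Both cost the same density.\<close>

lemma achievable_piece:
  assumes hyp: "m = 2 \<or> (\<forall>j. 2 \<le> j \<and> j < m \<longrightarrow> P_assertion j)"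
    and piece: "piece S B L j" and \<tau>: "0 < \<tau>" "\<tau> \<le> s" "2 * \<tau> \<le> L"
    and j: "j < m \<or> j = m \<and> L \<le> tree_length S / 2"
  shows "achievable S m s (\<lambda>y. ennreal (L / \<tau>\<^sup>2) * indicator {0..\<tau>} y) (indicator B)"
proof -
  obtain W E l where mod: "metric_subtree B S" "tree_model (submetric S B) W E l" "E \<noteq> {}"
    "L = (\<Sum>e\<in>E. l e)" "j = card (graph_leaves W E)"
    using piece unfolding piece_def by blast
  obtain f where "tree_metric W E l (submetric S B) f"
    using mod(2) by (auto simp: tree_model_iff)
  then interpret tree_metric W E l "submetric S B" f .
  have B: "B \<subseteq> mspace S"
    using mod(1) closedin_subset by (fastforce simp: metric_subtree_def)
  then have space_B: "mspace (submetric S B) = B"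
    by auto
  have len_B: "tree_length (submetric S B) = L"
    using tree_length_eq[OF mod(2)] mod(4) by simp
  have leaves_B: "card (tree_leaves (submetric S B)) = j"
    using card_tree_leaves[OF mod(3)] mod(5) by simp
  consider (less) "j < m" | (eq) "j = m" "L \<le> tree_length S / 2"
    using j by blast
  then show ?thesis
  proof cases
    case less
    have j2: "2 \<le> j"
      using two_leaves[OF mod(3)] mod(5) by simp
    then have P: "P_assertion j"
      using hyp less by auto
    define d where "d p q = mdist S (g p) (g q)" for p q
    define T where "T = metric (R, d)"
    have d: "d p q = path_dist W E l p q" if "p \<in> R" "q \<in> R" for p q
      using dist_path[of "g p" "g q"] that g_in[OF that(1)] g_in[OF that(2)] by (simp add: d_def)
    have gS: "g p \<in> mspace S" if "p \<in> R" for p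
      using g_in[OF that] by simp
    have g_inj: "g p = g q \<longleftrightarrow> p = q" if "p \<in> R" "q \<in> R" for p q
      using fg that by metis
    have "Metric_space R d"
      by unfold_locales (auto simp: d_def mdist_commute mdist_triangle gS g_inj)
    then have T: "mspace T = R" "mdist T = d"
      by (simp_all add: T_def Metric_space.mspace_metric Metric_space.mdist_metric)
    have "tree_metric W E l T id"
      using metric_graph_tree_axioms d T by (simp add: tree_metric_def tree_metric_axioms_def)
    then interpret T: tree_metric W E l T id .
    have model_T: "tree_model T W E l"
      using T.tree_metric_axioms by (auto simp: tree_model_iff)
    have len_T: "tree_length T = L"
      using tree_length_eq[OF model_T] mod(4) by simp
    have "finite_metric_tree T" "card (tree_leaves T) = j"
      using model_T T.card_tree_leaves[OF mod(3)] mod(5) by (auto simp: finite_metric_tree_def)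
    then obtain \<xi> where \<xi>: "fractional_marked_ball_cover T \<tau> \<xi>"
      "\<And>A. A \<in> sets borel \<Longrightarrow> emeasure (mark_marginal \<xi>) A \<le> emeasure (Lam T \<tau>) A"
      using P \<tau> len_T unfolding P_assertion_def by blast
    have "g ` mspace T = B"
    proof (rule antisym)
      show "g ` mspace T \<subseteq> B"
        using g_in T(1) by auto
      show "B \<subseteq> g ` mspace T"
      proof
        fix x
        assume "x \<in> B"
        then have "x \<in> mspace (submetric S B)"
          using space_B by simp
        then show "x \<in> g ` mspace T"
          using gf[of x] f_R[of x] T(1) by (metis image_eqI)
      qed
    qed
    moreover have "achievable S m s (\<lambda>y. ennreal (tree_length T / \<tau>\<^sup>2) * indicator {0..\<tau>} y)
        (indicator (g ` mspace T))"
      by (rule achievable_of_cover[OF \<xi> \<tau>(1,2)]) (use len_T \<tau> gS T in \<open>auto simp: d_def\<close>)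
    ultimately show ?thesis
      using len_T by simp
  next
    case eq
    have fin: "finite_borel_measure_on S s (null_measure (marked_borel S s))"
      by (auto simp: finite_borel_measure_on_def intro!: finite_measureI)
    have "triples_ok S m s [(1, B, \<tau>)]"
      using eq mod(1) leaves_B len_B \<tau> by (simp add: triples_ok_def)
    moreover have "emeasure (Lam (submetric S B) \<tau>) A =
        (\<integral>\<^sup>+y. ennreal (L / \<tau>\<^sup>2) * indicator {0..\<tau>} y * indicator A y \<partial>lborel)" if "A \<in> sets borel" for A
      using emeasure_Lam[OF that \<tau>(1), of "submetric S B"] len_B \<tau> by simp
    moreover have "emeasure (mark_marginal (null_measure (marked_borel S s))) A = 0" if "A \<in> sets borel" for A
      using emeasure_mark_marginal[OF fin that] by simp
    moreover have "(\<lambda>y. ennreal (L / \<tau>\<^sup>2) * indicator {0..\<tau>} y) \<in> borel_measurable borel"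
      by measurable
    ultimately show ?thesis
      unfolding achievable_def using fin
      by (intro conjI exI[of _ "null_measure (marked_borel S s)"] exI[of _ "[(1, B, \<tau>)]"])
        (auto simp: cover_fun_def)
  qed
qed

section \<open>Covering a tree by parts of at least half its length\<close>

context metric_graph_tree
begin

definition total :: real where
  "total = (\<Sum>e\<in>E. l e)"

abbreviation len :: "nat set \<Rightarrow> real" where
  "len W \<equiv> (\<Sum>e\<in>inner_edges E W. l e)"

definition branch_len :: "nat \<Rightarrow> nat set \<Rightarrow> real" where
  "branch_len a e = l e + len (fr a e)"

lemma total_split: "a \<in> V \<Longrightarrow> e \<in> E \<Longrightarrow> total = branch_len a e + len (V - fr a e)"
  unfolding total_def branch_len_def by (rule sum_edge_partition)

lemma len_nonneg: "0 \<le> len W"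
  by (rule sum_nonneg) (auto simp: inner_edges_def l_nonneg)

lemma sum_branches:
  assumes "u \<in> V"
  shows "(\<Sum>e\<in>{e \<in> E. u \<in> e}. branch_len u e) = total"
proof -
  let ?I = "{e \<in> E. u \<in> e}" and ?F = "\<lambda>e. insert e (inner_edges E (fr u e))"
  have not_inner: "e' \<notin> inner_edges E (fr u e)" if "u \<in> e'" for e e'
    using that root_not_far by (auto simp: inner_edges_def)
  have F: "(\<Sum>e'\<in>?F e. l e') = branch_len u e" if "e \<in> ?I" for e
    using not_inner[of e e] that by (simp add: branch_len_def)
  have "?F e \<inter> ?F e' = {}" if "e \<in> ?I" "e' \<in> ?I" "e \<noteq> e'" for e e'
  proof (rule ccontr)
    assume "?F e \<inter> ?F e' \<noteq> {}"
    then obtain d where "d \<in> ?F e" "d \<in> ?F e'"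
      by blast
    then have d: "d \<in> E" "d \<subseteq> fr u e" "d \<subseteq> fr u e'"
      using not_inner[of e e'] not_inner[of e' e] that by (auto simp: inner_edges_def)
    then have "d = {}"
      using root_branches_disjoint[of u e e'] that assms by blast
    then show False
      using edge_card[OF d(1)] by simp
  qed
  then have "(\<Sum>e\<in>?I. branch_len u e) = (\<Sum>d\<in>(\<Union>e\<in>?I. ?F e). l d)"
    using F by (subst sum.UNION_disjoint) auto
  also have "(\<Union>e\<in>?I. ?F e) = E"
  proof (rule antisym)
    show "(\<Union>e\<in>?I. ?F e) \<subseteq> E"
      by (auto simp: inner_edges_def)
    show "E \<subseteq> (\<Union>e\<in>?I. ?F e)"
    proof
      fix d
      assume d: "d \<in> E"
      obtain x y where "d = {x, y}" "x \<noteq> y" "x \<in> V" "y \<in> V"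
        using d by (rule edge_ends)
      then obtain y where y: "y \<in> d" "y \<in> V" "y \<noteq> u"
        by auto
      obtain z where z: "{u, z} \<in> E" "(z, y) \<in> (adj (E - {{u, z}}))\<^sup>*"
        using first_step[OF assms y(2)] y(3) by blast
      have "y \<in> fr u {u, z}"
        using far_of_step[OF assms z y(2)] root_not_far by blast
      then have "d \<in> ?F {u, z}"
        using other_edge_meets_far[OF z(1) d _ y(1)] d by (auto simp: inner_edges_def)
      then show "d \<in> (\<Union>e\<in>?I. ?F e)"
        using z(1) by blast
    qed
  qed
  finally show ?thesis
    by (simp add: total_def)
qed

text \<open>Either some vertex has only branches of length at most half the total, or half of the length
  lies beyond an interior point of an edge: a minimal branch longer than half decides which.\<close>

lemma centroid:
  obtains (vertex) u where "u \<in> V" "\<And>e. e \<in> E \<Longrightarrow> u \<in> e \<Longrightarrow> branch_len u e \<le> total / 2"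
    | (edge) a e where "a \<in> V" "e \<in> E" "len (fr a e) < total / 2" "total / 2 < branch_len a e"
proof -
  obtain a where a: "a \<in> V"
    using V_nonempty by auto
  define C where "C = {e \<in> E. total / 2 < branch_len a e}"
  show ?thesis
  proof (cases "C = {}")
    case True
    then have "branch_len a e \<le> total / 2" if "e \<in> E" for e
      using that by (auto simp: C_def not_less)
    then show ?thesis
      using vertex a by blast
  next
    case False
    have "finite C"
      by (simp add: C_def)
    then obtain e where e: "e \<in> C" "\<And>e'. e' \<in> C \<Longrightarrow> card (fr a e) \<le> card (fr a e')"
      using False by (meson arg_min_if_finite arg_min_least)
    then have eE: "e \<in> E" "total / 2 < branch_len a e"
      by (auto simp: C_def)
    show ?thesis
    proof (cases "len (fr a e) < total / 2")
      case True
      then show ?thesis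
        using edge a eE by blast
    next
      case half: False
      obtain u w where uw: "e = {u, w}" "u \<in> V" "w \<in> V" "u \<notin> fr a e" "w \<in> fr a e"
        using a eE(1) by (rule far_ends)
      have "branch_len w e' \<le> total / 2" if e': "e' \<in> E" "w \<in> e'" for e'
      proof (cases "e' = e")
        case True
        have "fr w e = V - fr a e"
          by (rule far_other_root[OF a eE(1) uw(5)])
        then have "branch_len w e = total - len (fr a e)"
          using total_split[OF a eE(1)] by (simp add: branch_len_def)
        then show ?thesis
          using half True by simp
      next
        case False
        have in': "e' \<subseteq> fr a e"
          by (rule other_edge_meets_far[OF eE(1) e'(1) False e'(2) uw(5)])
        have sub: "fr a e' \<subseteq> fr a e"
          by (rule far_subset_of_edge[OF a eE(1) e'(1) in' False])
        have w: "w \<notin> fr a e'"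
        proof
          assume "w \<in> fr a e'"
          then have "e \<subseteq> fr a e'"
            using other_edge_meets_far[OF e'(1) eE(1), of w a] False uw(1) by auto
          then show False
            using sub uw by blast
        qed
        then have "card (fr a e') < card (fr a e)"
          using sub uw(5) by (intro psubset_card_mono) auto
        then have "e' \<notin> C"
          using e(2) by fastforce
        moreover have "fr w e' = fr a e'"
          using far_same_root[OF a] w uw(3) by blast
        ultimately show ?thesis
          using e'(1) by (auto simp: C_def branch_len_def not_less)
      qed
      then show ?thesis
        using vertex uw(3) by blast
    qed
  qed
qed

end

context tree_metric
begin

lemma model: "tree_model M V E l"
  using tree_metric_axioms by (auto simp: tree_model_iff)

lemma tree_length_total: "tree_length M = total"
  using tree_length_eq[OF model] by (simp add: total_def)

lemma spanned_near_iff: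
  assumes "x \<in> mspace M"
  shows "x \<in> spanned (V - fr a e) \<longleftrightarrow> nn a e (f x) = 0"
  using assms R_supp_subset[OF f_R[OF assms]] by (auto simp: spanned_def nn_zero_iff)

text \<open>The branch beyond the interior point of the edge \<open>e\<close> that leaves the length \<open>L\<close> on the far side.\<close>

lemma trimmed_piece:
  assumes "a \<in> V" "e \<in> E" "e = {u, w}" "u \<notin> fr a e" "w \<in> fr a e"
    and "len (fr a e) < L" "L < branch_len a e"
  obtains j where "j \<le> card (graph_leaves V E)"
    "piece M {x \<in> spanned (insert u (fr a e)). l e * f x u \<le> L - len (fr a e)} L j"
proof -
  let ?W = "insert u (fr a e)"
  let ?B = "{x \<in> spanned ?W. l e * f x u \<le> L - len (fr a e)}"
  have "u \<in> V"
    using assms(2,3) edge_card by blast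
  then have W: "?W \<subseteq> V"
    using far_subset by blast
  have tm: "tree_metric ?W (inner_edges E ?W) l (submetric M (spanned ?W)) f"
    by (rule subgraph_tree_metric[OF W]) (use branch_connected[OF assms(1-5)] in auto)
  interpret sub: tree_metric ?W "inner_edges E ?W" l "submetric M (spanned ?W)" f
    by (rule tm)
  define \<tau> where "\<tau> = branch_len a e - L"
  have \<tau>: "0 < \<tau>" "\<tau> < l e" "l e - \<tau> = L - len (fr a e)"
    using assms(6,7) by (simp_all add: \<tau>_def branch_len_def)
  have edges: "inner_edges E ?W = insert e (inner_edges E (fr a e))"
    by (rule branch_edges(1)[OF assms(1-5)])
  have sp: "spanned ?W \<inter> mspace M = spanned ?W"
    by (auto simp: spanned_def)
  have "e \<in> inner_edges E ?W"
    using edges by simp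
  then obtain f' where f': "tree_metric ?W (inner_edges E ?W) (l(e := l e - \<tau>))
      (submetric (submetric M (spanned ?W)) {x \<in> mspace (submetric M (spanned ?W)). l e * f x u \<le> l e - \<tau>}) f'"
    "metric_subtree {x \<in> mspace (submetric M (spanned ?W)). l e * f x u \<le> l e - \<tau>} (submetric M (spanned ?W))"
    using sub.trimmed_tree_metric[OF assms(3) _ branch_edges(2)[OF assms(1-5)] \<tau>(1,2)] by blast
  have B: "{x \<in> mspace (submetric M (spanned ?W)). l e * f x u \<le> l e - \<tau>} = ?B"
    using sp \<tau>(3) by auto
  have "submetric (submetric M (spanned ?W)) ?B = submetric M ?B"
    by (simp add: Int_absorb1 Collect_mono_iff subset_iff)
  then have tm_B: "tree_metric ?W (inner_edges E ?W) (l(e := l e - \<tau>)) (submetric M ?B) f'"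
    using f'(1) unfolding B by simp
  have "closedin (subtopology X (spanned ?W)) ?B"
    using f'(2) unfolding B by (simp add: metric_subtree_def mtopology_of_submetric)
  then have "closedin X ?B"
    using spanned_closed[OF W] closedin_closed_subtopology by blast
  then have st: "metric_subtree ?B M"
    using metric_subtree_of_model[OF tm_B] by blast
  have e_out: "e \<notin> inner_edges E (fr a e)"
    by (rule edge_partition(2)[OF assms(1,2)])
  have "(\<Sum>e'\<in>inner_edges E ?W. (l(e := l e - \<tau>)) e') = (l e - \<tau>) + len (fr a e)"
    unfolding edges using e_out by (simp add: sum.insert_if) (rule sum.cong, auto)
  then have L: "L = (\<Sum>e'\<in>inner_edges E ?W. (l(e := l e - \<tau>)) e')"
    using \<tau>(3) by simp
  have "tree_model (submetric M ?B) ?W (inner_edges E ?W) (l(e := l e - \<tau>))"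
    using tm_B by (auto simp: tree_model_iff)
  moreover have "inner_edges E ?W \<noteq> {}"
    using edges by simp
  ultimately have "piece M ?B L (card (graph_leaves ?W (inner_edges E ?W)))"
    using st L unfolding piece_def by blast
  then show ?thesis
    using that card_branch_leaves_le[OF assms(1-5)] by blast
qed

text \<open>The branches at a centroid \<open>u\<close> are omitted one at a time. A point lies in all but at most one of
  the \<open>k\<close> remaining parts, so each of them gets the weight \<open>1 / (k - 1)\<close>.\<close>

lemma achievable_vertex_centroid:
  assumes hyp: "m = 2 \<or> (\<forall>j. 2 \<le> j \<and> j < m \<longrightarrow> P_assertion j)"
    and m: "m = card (graph_leaves V E)" and "E \<noteq> {}"
    and \<tau>: "0 < \<tau>" "\<tau> \<le> s" "4 * \<tau> \<le> total"
    and u: "u \<in> V" "\<And>e. e \<in> E \<Longrightarrow> u \<in> e \<Longrightarrow> branch_len u e \<le> total / 2"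
  shows "achievable M m s (\<lambda>y. ennreal (total / \<tau>\<^sup>2) * indicator {0..\<tau>} y) (\<lambda>_. 1)"
proof -
  define I where "I = {e \<in> E. u \<in> e}"
  define k where "k = real (card I)"
  have fin: "finite I"
    by (simp add: I_def)
  have total: "0 < total"
    using \<tau> by simp
  have sum_I: "(\<Sum>e\<in>I. branch_len u e) = total"
    using sum_branches[OF u(1)] by (simp add: I_def)
  have k2: "2 \<le> k"
  proof -
    have "(\<Sum>e\<in>I. branch_len u e) \<le> (\<Sum>e\<in>I. total / 2)"
      by (rule sum_mono) (use u(2) in \<open>auto simp: I_def\<close>)
    then have "total * 2 \<le> total * k"
      by (simp add: k_def sum_I mult.commute)
    then show ?thesis
      using total by simp
  qed
  have piece_e: "achievable M m s (\<lambda>y. ennreal ((total - branch_len u e) / \<tau>\<^sup>2) * indicator {0..\<tau>} y)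
      (indicator (spanned (V - fr u e)))" if e: "e \<in> I" for e
  proof -
    have eE: "e \<in> E" "u \<in> e"
      using e by (auto simp: I_def)
    have L: "len (V - fr u e) = total - branch_len u e"
      using total_split[OF u(1) eE(1)] by simp
    have half: "total / 2 \<le> total - branch_len u e"
      using u(2)[OF eE] by simp
    have "inner_edges E (V - fr u e) \<noteq> {}"
      using L half total by force
    then have p: "piece M (spanned (V - fr u e)) (total - branch_len u e)
        (card (graph_leaves (V - fr u e) (inner_edges E (V - fr u e))))"
      using near_piece[OF u(1) eE(1)] L by simp
    have j: "card (graph_leaves (V - fr u e) (inner_edges E (V - fr u e))) < m \<or>
        card (graph_leaves (V - fr u e) (inner_edges E (V - fr u e))) = m \<and>
        total - branch_len u e \<le> tree_length M / 2"
    proof (cases "\<exists>e1\<in>I. \<exists>e2\<in>I. e1 \<noteq> e2 \<and> e1 \<noteq> e \<and> e2 \<noteq> e")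
      case True
      then show ?thesis
        using card_near_leaves_less[OF u(1) eE root_not_far] m by (auto simp: I_def)
    next
      case False
      \<comment> \<open>Only one further branch, which then has exactly half of the total length.\<close>
      have "I - {e} \<noteq> {}"
      proof
        assume "I - {e} = {}"
        then have "I = {e}"
          using e by blast
        then show False
          using k2 by (simp add: k_def)
      qed
      then obtain e' where e': "e' \<in> I" "e' \<noteq> e"
        by blast
      then have "I = {e, e'}"
        using False e by blast
      then have "branch_len u e + branch_len u e' = total"
        using sum_I e'(2) by simp
      then have "total - branch_len u e \<le> total / 2"
        using u(2)[of e'] e'(1) by (simp add: I_def)
      then show ?thesis
        using card_near_leaves_le[OF u(1) eE(1)] m tree_length_total by (simp add: le_less)
    qed
    show ?thesis
      by (rule achievable_piece[OF hyp p \<tau>(1,2) _ j]) (use half \<tau> in simp)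
  qed
  have sum: "achievable M m s
      (\<lambda>y. \<Sum>e\<in>I. ennreal (1 / (k - 1)) * (ennreal ((total - branch_len u e) / \<tau>\<^sup>2) * indicator {0..\<tau>} y))
      (\<lambda>x. \<Sum>e\<in>I. 1 / (k - 1) * indicator (spanned (V - fr u e)) x)"
    by (rule achievable_sum[OF fin], rule achievable_scale[OF piece_e]) (use k2 in auto)
  show ?thesis
  proof (rule achievable_mono[OF sum])
    fix x
    assume x: "x \<in> mspace M"
    define J where "J = {e \<in> I. nn u e (f x) = 0}"
    have "card (I - J) \<le> 1"
    proof -
      have "e = e'" if "e \<in> I - J" "e' \<in> I - J" for e e'
      proof (rule ccontr)
        assume "e \<noteq> e'"
        moreover have "0 < nn u e (f x)"
          using that nn_nonneg[OF f_R[OF x], of u e] by (auto simp: J_def)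
        ultimately show False
          using root_branch_unique[OF u(1), of e e' "f x"] that x by (auto simp: I_def J_def)
      qed
      then show ?thesis
        using fin by (auto simp: card_le_Suc0_iff_eq)
    qed
    moreover have "card I = card J + card (I - J)"
      using fin card_Diff_subset[of J I] card_mono[of I J] by (auto simp: J_def finite_subset)
    ultimately have "k - 1 \<le> card J"
      unfolding k_def by linarith
    then have "1 \<le> real (card J) * (1 / (k - 1))"
      using k2 by (simp add: field_simps)
    also have "real (card J) * (1 / (k - 1)) = (\<Sum>e\<in>J. 1 / (k - 1))"
      by simp
    also have "(\<Sum>e\<in>J. 1 / (k - 1)) = (\<Sum>e\<in>I. 1 / (k - 1) * indicator (spanned (V - fr u e)) x)"
      by (rule sum.mono_neutral_cong_left) (use fin spanned_near_iff[OF x] in \<open>auto simp: J_def\<close>)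
    finally show "1 \<le> (\<Sum>e\<in>I. 1 / (k - 1) * indicator (spanned (V - fr u e)) x)" .
  next
    fix y
    have nonneg: "0 \<le> (total - branch_len u e) / \<tau>\<^sup>2" if "e \<in> I" for e
      using u(2)[of e] that total by (simp add: I_def)
    have "(\<Sum>e\<in>I. (total - branch_len u e)) = (k - 1) * total"
      using sum_I by (simp add: sum_subtractf k_def algebra_simps)
    then have "(\<Sum>e\<in>I. 1 / (k - 1) * ((total - branch_len u e) / \<tau>\<^sup>2)) = total / \<tau>\<^sup>2"
      using k2 by (simp add: sum_distrib_left[symmetric] sum_divide_distrib[symmetric])
    moreover have "(\<Sum>e\<in>I. ennreal (1 / (k - 1)) * (ennreal ((total - branch_len u e) / \<tau>\<^sup>2) * indicator {0..\<tau>} y)) =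
        (\<Sum>e\<in>I. ennreal (1 / (k - 1) * ((total - branch_len u e) / \<tau>\<^sup>2))) * indicator {0..\<tau>} y"
      unfolding sum_distrib_right
      by (rule sum.cong) (use k2 nonneg in \<open>auto simp: ennreal_mult mult.assoc simp del: times_divide_eq_left times_divide_eq_right\<close>)
    moreover have "(\<Sum>e\<in>I. ennreal (1 / (k - 1) * ((total - branch_len u e) / \<tau>\<^sup>2))) =
        ennreal (\<Sum>e\<in>I. 1 / (k - 1) * ((total - branch_len u e) / \<tau>\<^sup>2))"
      by (rule sum_ennreal, rule mult_nonneg_nonneg) (use k2 nonneg in auto)
    ultimately show "(\<Sum>e\<in>I. ennreal (1 / (k - 1)) * (ennreal ((total - branch_len u e) / \<tau>\<^sup>2) * indicator {0..\<tau>} y))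
        \<le> ennreal (total / \<tau>\<^sup>2) * indicator {0..\<tau>} y"
      by simp
  next
    show "(\<lambda>y. ennreal (total / \<tau>\<^sup>2) * indicator {0..\<tau>} y) \<in> borel_measurable borel"
      by measurable
  qed
qed

text \<open>The two halves of the tree on either side of the interior point together use exactly the
  budget. Since each has half of the length, it does not matter whether one of them still has
  \<open>m\<close> leaves.\<close>

lemma achievable_edge_centroid:
  assumes hyp: "m = 2 \<or> (\<forall>j. 2 \<le> j \<and> j < m \<longrightarrow> P_assertion j)"
    and m: "m = card (graph_leaves V E)"
    and \<tau>: "0 < \<tau>" "\<tau> \<le> s" "4 * \<tau> \<le> total"
    and e: "a \<in> V" "e \<in> E" "len (fr a e) < total / 2" "total / 2 < branch_len a e"
  shows "achievable M m s (\<lambda>y. ennreal (total / \<tau>\<^sup>2) * indicator {0..\<tau>} y) (\<lambda>_. 1)"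
proof -
  obtain u w where uw: "e = {u, w}" "u \<in> V" "w \<in> V" "u \<notin> fr a e" "w \<in> fr a e" "u \<noteq> w"
    using e(1,2) by (rule far_ends)
  have wu: "e = {w, u}"
    using uw(1) by (simp add: insert_commute)
  have fw: "fr w e = V - fr a e"
    by (rule far_other_root[OF e(1,2) uw(5)])
  have lens: "total = l e + len (fr a e) + len (fr w e)"
    using total_split[OF e(1,2)] by (simp add: branch_len_def fw)
  let ?B1 = "{x \<in> spanned (insert u (fr a e)). l e * f x u \<le> total / 2 - len (fr a e)}"
  let ?B2 = "{x \<in> spanned (insert w (fr w e)). l e * f x w \<le> total / 2 - len (fr w e)}"
  obtain j1 where j1: "j1 \<le> card (graph_leaves V E)" "piece M ?B1 (total / 2) j1"
    using trimmed_piece[OF e(1,2) uw(1,4,5) e(3,4)] by blast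
  obtain j2 where j2: "j2 \<le> card (graph_leaves V E)" "piece M ?B2 (total / 2) j2"
  proof -
    have *: "w \<notin> fr w e" "u \<in> fr w e"
      using root_not_far uw fw by auto
    have "len (fr w e) < total / 2" "total / 2 < branch_len w e"
      using lens e(3,4) by (simp_all add: branch_len_def)
    then show ?thesis
      using trimmed_piece[OF uw(3) e(2) wu *] that by blast
  qed
  have ach: "achievable M m s (\<lambda>y. ennreal (total / 2 / \<tau>\<^sup>2) * indicator {0..\<tau>} y) (indicator B)"
    if "j \<le> card (graph_leaves V E)" "piece M B (total / 2) j" for B j
    by (rule achievable_piece[OF hyp that(2) \<tau>(1,2)]) (use \<tau> that(1) m tree_length_total in auto)
  have sum: "achievable M m s (\<lambda>y. ennreal (total / 2 / \<tau>\<^sup>2) * indicator {0..\<tau>} y +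
      ennreal (total / 2 / \<tau>\<^sup>2) * indicator {0..\<tau>} y) (\<lambda>x. indicator ?B1 x + indicator ?B2 x)"
    by (rule achievable_add[OF ach[OF j1] ach[OF j2]])
  show ?thesis
  proof (rule achievable_mono[OF sum])
    fix x
    assume x: "x \<in> mspace M"
    have "x \<in> ?B1 \<or> x \<in> ?B2"
    proof (cases "supp (f x) = e")
      case True
      have "f x u = 1 - f x w"
        using edge_pt_of_supp(2)[OF f_R[OF x], of u w] True uw by auto
      then have "f x u + f x w = 1"
        by simp
      then have "l e * f x u + l e * f x w = l e"
        by (metis distrib_left mult.right_neutral)
      then have "l e * f x u \<le> total / 2 - len (fr a e) \<or> l e * f x w \<le> total / 2 - len (fr w e)"
        using lens by linarith
      moreover have "supp (f x) \<subseteq> insert u (fr a e)" "supp (f x) \<subseteq> insert w (fr w e)"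
        using True uw fw by auto
      ultimately show ?thesis
        using x by (auto simp: spanned_def)
    next
      case False
      have "nn a e (f x) = 0 \<or> nn a e (f x) = 1"
        using nn_frac_supp[OF e(2) f_R[OF x], of a] False nn_nonneg[OF f_R[OF x], of a e]
          nn_le_1[OF f_R[OF x], of a e] by linarith
      then have "supp (f x) \<subseteq> fr w e \<or> supp (f x) \<subseteq> fr a e"
        using nn_zero_iff[OF f_R[OF x]] nn_one_iff[OF f_R[OF x]] R_supp_subset[OF f_R[OF x]] fw by blast
      moreover have "x \<in> ?B1" if s: "supp (f x) \<subseteq> fr a e"
      proof -
        have "f x u = 0"
          using s uw(4) by (auto simp: supp_def)
        then show ?thesis
          using s x e(3) by (auto simp: spanned_def)
      qed
      moreover have "x \<in> ?B2" if s: "supp (f x) \<subseteq> fr w e"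
      proof -
        have "f x w = 0"
          using s root_not_far[of w e] by (auto simp: supp_def)
        then show ?thesis
          using s x lens e(4) by (auto simp: spanned_def branch_len_def)
      qed
      ultimately show ?thesis
        by blast
    qed
    then show "1 \<le> (indicator ?B1 x :: real) + indicator ?B2 x"
      by (auto simp: indicator_def)
  next
    fix y
    have "ennreal (total / 2 / \<tau>\<^sup>2) + ennreal (total / 2 / \<tau>\<^sup>2) = ennreal (total / \<tau>\<^sup>2)"
      using \<tau> by (simp flip: ennreal_plus)
    then show "ennreal (total / 2 / \<tau>\<^sup>2) * indicator {0..\<tau>} y + ennreal (total / 2 / \<tau>\<^sup>2) * indicator {0..\<tau>} y
        \<le> ennreal (total / \<tau>\<^sup>2) * indicator {0..\<tau>} y"
      unfolding distrib_right[symmetric] by simp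
  next
    show "(\<lambda>y. ennreal (total / \<tau>\<^sup>2) * indicator {0..\<tau>} y) \<in> borel_measurable borel"
      by measurable
  qed
qed

text \<open>Every part that occurs has at least half of the length of the tree and can therefore be used at
  level \<open>\<tau>\<close>; this is where \<open>4 * \<tau> \<le> total\<close> enters.\<close>

lemma achievable_long:
  assumes hyp: "m = 2 \<or> (\<forall>j. 2 \<le> j \<and> j < m \<longrightarrow> P_assertion j)"
    and m: "m = card (graph_leaves V E)" and "E \<noteq> {}"
    and \<tau>: "0 < \<tau>" "\<tau> \<le> s" "4 * \<tau> \<le> total"
  shows "achievable M m s (\<lambda>y. ennreal (total / \<tau>\<^sup>2) * indicator {0..\<tau>} y) (\<lambda>_. 1)"
proof (cases rule: centroid)
  case (vertex u)
  then show ?thesis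
    using achievable_vertex_centroid assms by blast
next
  case (edge a e)
  then show ?thesis
    using achievable_edge_centroid assms by blast
qed

end

section \<open>A longest path and the heights above it\<close>

lemma finite_maximal:
  fixes F :: "'b \<Rightarrow> real"
  assumes "finite A" "A \<noteq> {}"
  shows "\<exists>v\<in>A. \<forall>y\<in>A. F y \<le> F v"
proof -
  have "Max (F ` A) \<in> F ` A"
    using assms by (intro Max_in) auto
  then obtain v where "v \<in> A" "F v = Max (F ` A)"
    by auto
  then show ?thesis
    using assms(1) by (intro bexI[of _ v]) (auto intro: Max_ge)
qed

context metric_graph_tree
begin

definition path_edges :: "nat \<Rightarrow> nat \<Rightarrow> nat set set" where
  "path_edges a b = {e \<in> E. b \<in> fr a e}"

text \<open>The position \<open>pos a b p\<close> is the distance from \<open>a\<close> of the point where the branch containing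
  \<open>p\<close> is attached to the path from \<open>a\<close> to \<open>b\<close>, and \<open>height a b p\<close> is the distance of \<open>p\<close> from that
  point of attachment.\<close>

definition pos :: "nat \<Rightarrow> nat \<Rightarrow> (nat \<Rightarrow> real) \<Rightarrow> real" where
  "pos a b p = (\<Sum>e\<in>path_edges a b. l e * nn a e p)"

definition height :: "nat \<Rightarrow> nat \<Rightarrow> (nat \<Rightarrow> real) \<Rightarrow> real" where
  "height a b p = (\<Sum>e\<in>E - path_edges a b. l e * nn a e p)"

definition path_len :: "nat \<Rightarrow> nat \<Rightarrow> real" where
  "path_len a b = (\<Sum>e\<in>path_edges a b. l e)"

lemma path_edges_subset: "path_edges a b \<subseteq> E"
  by (auto simp: path_edges_def)

lemma path_edge_nonneg: "e \<in> path_edges a b \<Longrightarrow> 0 \<le> l e"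
  by (auto simp: path_edges_def l_nonneg)

lemma finite_path_edges [simp]: "finite (path_edges a b)"
  using path_edges_subset finite_E by (rule finite_subset)

lemma sum_path_edges: "(\<Sum>e\<in>E. F e) = (\<Sum>e\<in>path_edges a b. F e) + (\<Sum>e\<in>E - path_edges a b. F e)"
  using sum.subset_diff[OF path_edges_subset finite_E, of F a b] by (simp add: add.commute)

lemma path_len_le_total: "path_len a b \<le> total"
  unfolding path_len_def total_def by (rule sum_mono2) (auto simp: path_edges_def l_nonneg)

lemma height_nonneg: "p \<in> R \<Longrightarrow> 0 \<le> height a b p"
  unfolding height_def by (rule sum_nonneg) (auto simp: l_nonneg nn_nonneg)

lemma height_zero_iff:
  assumes "p \<in> R"
  shows "height a b p = 0 \<longleftrightarrow> (\<forall>e\<in>E - path_edges a b. nn a e p = 0)"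
proof -
  have nz: "l e \<noteq> 0" if "e \<in> E" for e
    using l_pos[OF that] by simp
  have "height a b p = 0 \<longleftrightarrow> (\<forall>e\<in>E - path_edges a b. l e * nn a e p = 0)"
    unfolding height_def by (rule sum_nonneg_eq_0_iff) (auto simp: l_nonneg nn_nonneg[OF assms])
  also have "\<dots> \<longleftrightarrow> (\<forall>e\<in>E - path_edges a b. nn a e p = 0)"
    using nz by auto
  finally show ?thesis .
qed

lemma nn_path_end:
  assumes "b \<in> V" "e \<in> E"
  shows "nn a e (vertex_pt b) = (if e \<in> path_edges a b then 1 else 0)"
  using assms by (simp add: nn_vertex path_edges_def)

lemma ed_path_start:
  assumes "a \<in> V" "p \<in> R"
  shows "ed a (vertex_pt a) p = pos a b p + height a b p"
  unfolding edge_dist_def pos_def height_def sum_path_edges[of _ a b]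
  by (intro arg_cong2[of _ _ _ _ "(+)"] sum.cong)
    (use assms nn_nonneg[OF assms(2)] in \<open>auto simp: nn_root\<close>)

lemma ed_path_end:
  assumes "a \<in> V" "b \<in> V" "p \<in> R"
  shows "ed a (vertex_pt b) p = path_len a b - pos a b p + height a b p"
proof -
  have "(\<Sum>e\<in>path_edges a b. l e * \<bar>nn a e (vertex_pt b) - nn a e p\<bar>) =
      (\<Sum>e\<in>path_edges a b. l e - l e * nn a e p)"
    by (rule sum.cong) (use assms nn_le_1[OF assms(3)] path_edges_subset[of a b] in
        \<open>auto simp: nn_path_end algebra_simps subset_eq\<close>)
  moreover have "(\<Sum>e\<in>E - path_edges a b. l e * \<bar>nn a e (vertex_pt b) - nn a e p\<bar>) =
      (\<Sum>e\<in>E - path_edges a b. l e * nn a e p)"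
    by (rule sum.cong) (use assms nn_nonneg[OF assms(3)] in \<open>auto simp: nn_path_end\<close>)
  ultimately show ?thesis
    unfolding edge_dist_def pos_def height_def path_len_def sum_path_edges[of _ a b]
    by (simp add: sum_subtractf)
qed

text \<open>Of two nested far sides the smaller one is entered only after the edge of the larger one has been
  crossed completely.\<close>

lemma nn_chain:
  assumes "a \<in> V" "e \<in> E" "e' \<in> E" "e \<noteq> e'" "fr a e \<subseteq> fr a e'" "p \<in> R" "0 < nn a e p"
  shows "nn a e' p = 1"
proof -
  obtain v where v: "v \<in> supp p" "v \<in> fr a e"
    using nn_pos_meets[OF assms(7)] by blast
  show ?thesis
  proof (cases rule: R_cases[OF assms(6)])
    case (1 x)
    then have "supp p \<subseteq> fr a e'"
      using v assms(5) by auto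
    then show ?thesis
      by (rule nn_one[OF assms(6)])
  next
    case 2
    have "supp p \<noteq> e'"
    proof
      assume "supp p = e'"
      then have "e' \<subseteq> fr a e"
        using other_edge_meets_far[OF assms(2,3) _ _ v(2)] v(1) assms(4) by blast
      moreover obtain u w where "e' = {u, w}" "u \<notin> fr a e'"
        using far_ends[OF assms(1,3)] by blast
      ultimately show False
        using assms(5) by blast
    qed
    then have "supp p \<subseteq> fr a e'"
      using other_edge_meets_far[OF assms(3) 2 _ v(1)] v(2) assms(5) by blast
    then show ?thesis
      by (rule nn_one[OF assms(6)])
  qed
qed

lemma path_edges_nested:
  assumes "a \<in> V" "e \<in> path_edges a b" "e' \<in> path_edges a b"
  shows "fr a e \<subseteq> fr a e' \<or> fr a e' \<subseteq> fr a e"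
  using laminar[OF assms(1), of e e'] assms(2,3) by (auto simp: path_edges_def)

text \<open>Along the path the coordinates of two points are ordered in the same way on all edges, so
  the absolute values add up without cancellation.\<close>

lemma ed_pos_height:
  assumes "a \<in> V" "p \<in> R" "q \<in> R"
  shows "ed a p q = \<bar>pos a b p - pos a b q\<bar> +
    (\<Sum>e\<in>E - path_edges a b. l e * \<bar>nn a e p - nn a e q\<bar>)"
proof -
  have ordered: "(\<forall>e\<in>path_edges a b. nn a e p \<le> nn a e q) \<or> (\<forall>e\<in>path_edges a b. nn a e q \<le> nn a e p)"
  proof (rule ccontr)
    assume "\<not> ?thesis"
    then obtain e e' where e: "e \<in> path_edges a b" "e' \<in> path_edges a b"
      "nn a e q < nn a e p" "nn a e' p < nn a e' q"
      by (auto simp: not_le)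
    then have ne: "e \<noteq> e'"
      by auto
    have E: "e \<in> E" "e' \<in> E"
      using e path_edges_subset by auto
    have pos: "0 < nn a e p" "0 < nn a e' q" "nn a e q < 1" "nn a e' p < 1"
      using e nn_nonneg[OF assms(3), of a e] nn_nonneg[OF assms(2), of a e']
        nn_le_1[OF assms(2), of a e] nn_le_1[OF assms(3), of a e'] by linarith+
    from path_edges_nested[OF assms(1) e(1,2)] show False
    proof
      assume "fr a e \<subseteq> fr a e'"
      from nn_chain[OF assms(1) E ne this assms(2) pos(1)] pos(4) show False
        by simp
    next
      assume "fr a e' \<subseteq> fr a e"
      from nn_chain[OF assms(1) E(2,1) ne[symmetric] this assms(3) pos(2)] pos(3) show False
        by simp
    qed
  qed
  have "(\<Sum>e\<in>path_edges a b. l e * \<bar>nn a e p - nn a e q\<bar>) = \<bar>pos a b p - pos a b q\<bar>"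
    using ordered
  proof
    assume le: "\<forall>e\<in>path_edges a b. nn a e p \<le> nn a e q"
    then have "(\<Sum>e\<in>path_edges a b. l e * \<bar>nn a e p - nn a e q\<bar>) =
        (\<Sum>e\<in>path_edges a b. l e * nn a e q - l e * nn a e p)"
      by (intro sum.cong) (auto simp: algebra_simps)
    moreover have "pos a b p \<le> pos a b q"
      unfolding pos_def by (rule sum_mono) (use le path_edge_nonneg in \<open>auto intro!: mult_left_mono\<close>)
    ultimately show ?thesis
      by (simp add: pos_def sum_subtractf)
  next
    assume le: "\<forall>e\<in>path_edges a b. nn a e q \<le> nn a e p"
    then have "(\<Sum>e\<in>path_edges a b. l e * \<bar>nn a e p - nn a e q\<bar>) =
        (\<Sum>e\<in>path_edges a b. l e * nn a e p - l e * nn a e q)"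
      by (intro sum.cong) (auto simp: algebra_simps)
    moreover have "pos a b q \<le> pos a b p"
      unfolding pos_def by (rule sum_mono) (use le path_edge_nonneg in \<open>auto intro!: mult_left_mono\<close>)
    ultimately show ?thesis
      by (simp add: pos_def sum_subtractf)
  qed
  then show ?thesis
    unfolding edge_dist_def sum_path_edges[of _ a b] by simp
qed

lemma ed_to_path:
  assumes "a \<in> V" "p \<in> R" "q \<in> R" "height a b q = 0"
  shows "ed a p q = \<bar>pos a b p - pos a b q\<bar> + height a b p"
proof -
  have "(\<Sum>e\<in>E - path_edges a b. l e * \<bar>nn a e p - nn a e q\<bar>) = height a b p"
    unfolding height_def
    by (rule sum.cong) (use assms height_zero_iff[OF assms(3)] nn_nonneg[OF assms(2)] in auto)
  then show ?thesis
    using ed_pos_height[OF assms(1-3), of b] by simp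
qed

lemma path_next_edge:
  assumes "a \<in> V" "b \<in> V" "v \<in> V" "v \<noteq> b" "height a b (vertex_pt v) = 0"
  obtains w where "{v, w} \<in> path_edges a b" "w \<in> V" "v \<noteq> w" "v \<notin> fr a {v, w}" "w \<in> fr a {v, w}"
    "height a b (vertex_pt w) = 0" "pos a b (vertex_pt w) = pos a b (vertex_pt v) + l {v, w}"
proof -
  obtain w where w: "{v, w} \<in> E" "w \<in> V" "v \<noteq> w"
    "nn a {v, w} (vertex_pt v) \<noteq> nn a {v, w} (vertex_pt b)"
    "nn a {v, w} (vertex_pt w) = nn a {v, w} (vertex_pt b)"
    "\<And>e. e \<in> E \<Longrightarrow> e \<noteq> {v, w} \<Longrightarrow> nn a e (vertex_pt w) = nn a e (vertex_pt v)"
    using step_vertices[OF assms(1,3,2,4)] by blast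
  have vR: "vertex_pt v \<in> R" and wR: "vertex_pt w \<in> R"
    using assms(3) w(2) vertex_pt_R by auto
  have zero: "\<And>e. e \<in> E - path_edges a b \<Longrightarrow> nn a e (vertex_pt v) = 0"
    using assms(5) height_zero_iff[OF vR] by blast
  have path: "{v, w} \<in> path_edges a b"
    using zero[of "{v, w}"] w(1,4) nn_path_end[OF assms(2) w(1), of a] by (auto split: if_splits)
  then have ends: "v \<notin> fr a {v, w}" "w \<in> fr a {v, w}"
    using w(4,5) nn_path_end[OF assms(2) w(1), of a] assms(3) w(2)
    by (auto simp: nn_vertex split: if_splits)
  have "height a b (vertex_pt w) = 0"
    unfolding height_zero_iff[OF wR] using zero w(6) path by fastforce
  moreover have "pos a b (vertex_pt w) = pos a b (vertex_pt v) + l {v, w}"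
  proof -
    have "pos a b (vertex_pt w) - pos a b (vertex_pt v) =
        (\<Sum>e\<in>path_edges a b. if e = {v, w} then l e else 0)"
      unfolding pos_def sum_subtractf[symmetric]
    proof (rule sum.cong[OF refl])
      fix e
      assume "e \<in> path_edges a b"
      then have "e \<in> E"
        using path_edges_subset by blast
      then show "l e * nn a e (vertex_pt w) - l e * nn a e (vertex_pt v) = (if e = {v, w} then l e else 0)"
        using w(6)[of e] ends assms(3) w(2) by (cases "e = {v, w}") (auto simp: nn_vertex)
    qed
    also have "\<dots> = l {v, w}"
      using path by (simp add: sum.delta)
    finally show ?thesis
      by simp
  qed
  ultimately show ?thesis
    using that path w(2,3) ends by blast
qed

lemma path_previous_edge:
  assumes "a \<in> V" "v \<in> V" "v \<noteq> a" "height a b (vertex_pt v) = 0"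
  obtains w where "{v, w} \<in> path_edges a b" "w \<in> V" "w \<notin> fr a {v, w}" "v \<in> fr a {v, w}"
proof -
  obtain w where w: "{v, w} \<in> E" "w \<in> V" "v \<noteq> w"
    "nn a {v, w} (vertex_pt v) \<noteq> nn a {v, w} (vertex_pt a)"
    "nn a {v, w} (vertex_pt w) = nn a {v, w} (vertex_pt a)"
    using step_vertices[OF assms(1,2,1,3)] by blast
  have "v \<in> fr a {v, w}" "w \<notin> fr a {v, w}"
    using w assms(1,2) by (auto simp: nn_vertex root_not_far split: if_splits)
  moreover have "{v, w} \<in> path_edges a b"
  proof (rule ccontr)
    assume "{v, w} \<notin> path_edges a b"
    then have "nn a {v, w} (vertex_pt v) = 0"
      using assms(4) height_zero_iff[OF vertex_pt_R[OF assms(2)]] w(1) by blast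
    then show False
      using w(4) nn_root[OF assms(1)] by simp
  qed
  ultimately show ?thesis
    using that w(2) by blast
qed

lemma pos_height_edge_pt:
  "pos a b (edge_pt x y \<theta>) = (1 - \<theta>) * pos a b (vertex_pt x) + \<theta> * pos a b (vertex_pt y)"
  "height a b (edge_pt x y \<theta>) = (1 - \<theta>) * height a b (vertex_pt x) + \<theta> * height a b (vertex_pt y)"
  unfolding pos_def height_def nn_edge_pt sum_distrib_left sum.distrib[symmetric]
  by (auto intro!: sum.cong simp: algebra_simps)

text \<open>The point at position \<open>z\<close> lies on the path edge that follows the last vertex of the path with
  position at most \<open>z\<close>.\<close>

lemma path_point_exists:
  assumes "a \<in> V" "b \<in> V" "0 \<le> z" "z \<le> path_len a b"
  shows "\<exists>q\<in>R. height a b q = 0 \<and> pos a b q = z"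
proof -
  define A where "A = {v \<in> V. height a b (vertex_pt v) = 0 \<and> pos a b (vertex_pt v) \<le> z}"
  have "pos a b (vertex_pt a) = 0" "height a b (vertex_pt a) = 0"
    using assms(1) by (auto simp: pos_def height_def nn_root)
  then have "a \<in> A"
    using assms by (simp add: A_def)
  then have A: "finite A" "A \<noteq> {}"
    by (auto simp: A_def)
  obtain v where v: "v \<in> A" "\<And>y. y \<in> A \<Longrightarrow> pos a b (vertex_pt y) \<le> pos a b (vertex_pt v)"
    using finite_maximal[OF A, of "\<lambda>v. pos a b (vertex_pt v)"] by blast
  have vV: "v \<in> V" and hv: "height a b (vertex_pt v) = 0" and pv: "pos a b (vertex_pt v) \<le> z"
    using v(1) by (auto simp: A_def)
  show ?thesis
  proof (cases "pos a b (vertex_pt v) = z")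
    case True
    then show ?thesis
      using vV hv vertex_pt_R by blast
  next
    case False
    have "pos a b (vertex_pt b) = path_len a b"
      unfolding pos_def path_len_def
      by (rule sum.cong) (use assms(2) in \<open>auto simp: nn_vertex path_edges_def\<close>)
    then have "v \<noteq> b"
      using False pv assms(4) by auto
    then obtain w where w: "{v, w} \<in> path_edges a b" "w \<in> V" "height a b (vertex_pt w) = 0"
      "pos a b (vertex_pt w) = pos a b (vertex_pt v) + l {v, w}"
      using path_next_edge[OF assms(1,2) vV _ hv] by metis
    have e: "{v, w} \<in> E"
      using w(1) path_edges_subset by blast
    have "w \<notin> A"
      using v(2)[of w] w(4) l_pos[OF e] by auto
    then have gt: "z < pos a b (vertex_pt v) + l {v, w}"
      using w by (simp add: A_def)
    define \<theta> where "\<theta> = (z - pos a b (vertex_pt v)) / l {v, w}"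
    have \<theta>: "0 \<le> \<theta>" "\<theta> \<le> 1" "\<theta> * l {v, w} = z - pos a b (vertex_pt v)"
      using pv gt l_pos[OF e] by (auto simp: \<theta>_def)
    have "pos a b (edge_pt v w \<theta>) = z" "height a b (edge_pt v w \<theta>) = 0"
      unfolding pos_height_edge_pt using w(3,4) hv \<theta>(3) by (auto simp: algebra_simps)
    then show ?thesis
      using edge_pt_R[OF e \<theta>(1,2)] by blast
  qed
qed

definition path_pt :: "nat \<Rightarrow> nat \<Rightarrow> real \<Rightarrow> nat \<Rightarrow> real" where
  "path_pt a b z = (SOME q. q \<in> R \<and> height a b q = 0 \<and> pos a b q = z)"

lemma path_pt:
  assumes "a \<in> V" "b \<in> V" "0 \<le> z" "z \<le> path_len a b"
  shows "path_pt a b z \<in> R" "height a b (path_pt a b z) = 0" "pos a b (path_pt a b z) = z"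
proof -
  have "\<exists>q. q \<in> R \<and> height a b q = 0 \<and> pos a b q = z"
    using path_point_exists[OF assms] by blast
  from someI_ex[OF this]
  show "path_pt a b z \<in> R" "height a b (path_pt a b z) = 0" "pos a b (path_pt a b z) = z"
    unfolding path_pt_def by auto
qed

lemma ed_path_pt:
  assumes "a \<in> V" "b \<in> V" "0 \<le> z" "z \<le> path_len a b" "p \<in> R"
  shows "ed a p (path_pt a b z) = \<bar>pos a b p - z\<bar> + height a b p"
  using ed_to_path[OF assms(1,5) path_pt(1,2)[OF assms(1-4)]] path_pt(3)[OF assms(1-4)] by simp

text \<open>Coordinates are affine along an edge. So the distance to a fixed point is convex there and is
  largest at vertices, and a longest path can be found between vertices.\<close>

lemma ed_convex:
  assumes "0 \<le> \<theta>" "\<theta> \<le> 1"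
  shows "ed r p (edge_pt x y \<theta>) \<le> (1 - \<theta>) * ed r p (vertex_pt x) + \<theta> * ed r p (vertex_pt y)"
proof -
  have "l e * \<bar>nn r e p - nn r e (edge_pt x y \<theta>)\<bar> \<le>
      (1 - \<theta>) * (l e * \<bar>nn r e p - nn r e (vertex_pt x)\<bar>) + \<theta> * (l e * \<bar>nn r e p - nn r e (vertex_pt y)\<bar>)"
    if "e \<in> E" for e
  proof -
    have "nn r e p - nn r e (edge_pt x y \<theta>) =
        (1 - \<theta>) * (nn r e p - nn r e (vertex_pt x)) + \<theta> * (nn r e p - nn r e (vertex_pt y))"
      by (simp add: nn_edge_pt algebra_simps)
    then have "\<bar>nn r e p - nn r e (edge_pt x y \<theta>)\<bar> \<le>
        \<bar>(1 - \<theta>) * (nn r e p - nn r e (vertex_pt x))\<bar> + \<bar>\<theta> * (nn r e p - nn r e (vertex_pt y))\<bar>"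
      by (metis abs_triangle_ineq)
    also have "\<dots> = (1 - \<theta>) * \<bar>nn r e p - nn r e (vertex_pt x)\<bar> + \<theta> * \<bar>nn r e p - nn r e (vertex_pt y)\<bar>"
      using assms by (simp add: abs_mult)
    finally have "l e * \<bar>nn r e p - nn r e (edge_pt x y \<theta>)\<bar> \<le>
        l e * ((1 - \<theta>) * \<bar>nn r e p - nn r e (vertex_pt x)\<bar> + \<theta> * \<bar>nn r e p - nn r e (vertex_pt y)\<bar>)"
      using l_nonneg[OF that] by (rule mult_left_mono)
    then show ?thesis
      by (simp add: algebra_simps)
  qed
  then show ?thesis
    unfolding edge_dist_def sum_distrib_left sum.distrib[symmetric] by (rule sum_mono)
qed

lemma ed_le_at_vertices:
  assumes "\<And>v. v \<in> V \<Longrightarrow> ed r p (vertex_pt v) \<le> B" "q \<in> R"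
  shows "ed r p q \<le> B"
proof (cases rule: R_cases[OF assms(2)])
  case (1 v)
  then show ?thesis
    using assms(1) by simp
next
  case 2
  then obtain x y where xy: "supp q = {x, y}" "x \<noteq> y" "x \<in> V" "y \<in> V"
    by (rule edge_ends)
  note q = edge_pt_of_supp[OF assms(2) equalityD1[OF xy(1)] xy(2-4)]
  have "ed r p q \<le> (1 - q y) * ed r p (vertex_pt x) + q y * ed r p (vertex_pt y)"
    using ed_convex[OF q(3,4), of r p x y] q(1) by simp
  also have "\<dots> \<le> (1 - q y) * B + q y * B"
    using assms(1) xy(3,4) q(3,4) by (intro add_mono mult_left_mono) auto
  also have "\<dots> = B"
    by (simp add: algebra_simps)
  finally show ?thesis .
qed

text \<open>No point is farther from \<open>a\<close> or from \<open>b\<close> than the length of the path between them. In terms of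
  position and height these are two linear inequalities.\<close>

lemma longest_path:
  obtains a b where "a \<in> V" "b \<in> V"
    "\<And>p. p \<in> R \<Longrightarrow> height a b p \<le> pos a b p"
    "\<And>p. p \<in> R \<Longrightarrow> pos a b p + height a b p \<le> path_len a b"
proof -
  obtain r where r: "r \<in> V"
    using V_nonempty by blast
  define F where "F = (\<lambda>(x, y). ed r (vertex_pt x) (vertex_pt y))"
  have "finite (V \<times> V)" "V \<times> V \<noteq> {}"
    using r by auto
  then obtain c where c: "c \<in> V \<times> V" "\<And>c'. c' \<in> V \<times> V \<Longrightarrow> F c' \<le> F c"
    using finite_maximal by meson
  obtain a b where ab: "c = (a, b)" "a \<in> V" "b \<in> V"
    using c(1) by auto
  have root: "ed r p q = ed a p q" if "p \<in> R" "q \<in> R" for p q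
    using path_dist_eq[OF r that] path_dist_eq[OF ab(2) that] by simp
  have max: "ed a (vertex_pt x) (vertex_pt y) \<le> ed a (vertex_pt a) (vertex_pt b)" if "x \<in> V" "y \<in> V" for x y
    using c(2)[of "(x, y)"] that ab root vertex_pt_R by (simp add: F_def)
  have D: "ed a (vertex_pt a) (vertex_pt b) = path_len a b"
    using ed_path_end[OF ab(2,3) vertex_pt_R[OF ab(2)]] ab(2)
    by (simp add: ed_sym[of a "vertex_pt a"] pos_def height_def nn_root)
  have far_a: "ed a (vertex_pt a) p \<le> path_len a b" and far_b: "ed a (vertex_pt b) p \<le> path_len a b"
    if "p \<in> R" for p
    using max[OF ab(2)] max[OF ab(3)] D ed_le_at_vertices[OF _ that, of a] by metis+
  show ?thesis
  proof (rule that[OF ab(2,3)])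
    fix p
    assume p: "p \<in> R"
    show "height a b p \<le> pos a b p"
      using far_b[OF p] ed_path_end[OF ab(2,3) p] by simp
    show "pos a b p + height a b p \<le> path_len a b"
      using far_a[OF p] ed_path_start[OF ab(2) p, of b] by simp
  qed
qed

end

context tree_metric
begin

lemma near_midpoint:
  assumes "a \<in> V" "b \<in> V" "x \<in> mspace M"
    and "height a b (f x) \<le> pos a b (f x)" "pos a b (f x) + height a b (f x) \<le> path_len a b"
  shows "mdist M x (g (path_pt a b (path_len a b / 2))) \<le> path_len a b / 2"
proof -
  have D: "0 \<le> path_len a b"
    unfolding path_len_def by (rule sum_nonneg) (auto simp: path_edges_def l_nonneg)
  then have "mdist M x (g (path_pt a b (path_len a b / 2))) =
      \<bar>pos a b (f x) - path_len a b / 2\<bar> + height a b (f x)"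
    using assms(3) ed_path_pt[OF assms(1,2), of "path_len a b / 2" "f x"]
      path_pt(1)[OF assms(1,2), of "path_len a b / 2"] dist_ed[OF assms(1,3)] by simp
  then show ?thesis
    using assms(4,5) by (auto simp: abs_if)
qed

text \<open>The centre is the midpoint of a longest path, and a path is at most as long as the whole tree.\<close>

lemma center_exists: "\<exists>c\<in>mspace M. \<forall>x\<in>mspace M. mdist M x c \<le> total / 2"
proof -
  obtain a b where ab: "a \<in> V" "b \<in> V"
    "\<And>p. p \<in> R \<Longrightarrow> height a b p \<le> pos a b p"
    "\<And>p. p \<in> R \<Longrightarrow> pos a b p + height a b p \<le> path_len a b"
    using longest_path by blast
  have D: "0 \<le> path_len a b"
    unfolding path_len_def by (rule sum_nonneg) (auto simp: path_edges_def l_nonneg)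
  have "mdist M x (g (path_pt a b (path_len a b / 2))) \<le> total / 2" if "x \<in> mspace M" for x
    using near_midpoint[OF ab(1,2) that] ab(3,4) that path_len_le_total[of a b] by force
  moreover have "g (path_pt a b (path_len a b / 2)) \<in> mspace M"
    using D path_pt(1)[OF ab(1,2)] by simp
  ultimately show ?thesis
    by blast
qed

end

lemma piece_center:
  assumes "piece M B L j"
  shows "\<exists>c\<in>mspace M. \<forall>x\<in>B. mdist M x c \<le> L / 2"
proof -
  obtain W E l where W: "tree_model (submetric M B) W E l" "L = (\<Sum>e\<in>E. l e)"
    using assms unfolding piece_def by blast
  then obtain f where "tree_metric W E l (submetric M B) f"
    using tree_model_iff by blast
  then interpret B: tree_metric W E l "submetric M B" f .
  have "B \<subseteq> mspace M"
    using assms closedin_subset[of "mtopology_of M" B] by (auto simp: piece_def metric_subtree_def)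
  then have ms: "B \<inter> mspace M = B"
    by blast
  have "\<exists>c\<in>B. \<forall>x\<in>B. mdist M x c \<le> L / 2"
    using B.center_exists by (simp add: ms mdist_submetric W(2) B.total_def)
  then show ?thesis
    using \<open>B \<subseteq> mspace M\<close> by blast
qed

section \<open>Branches along a longest path\<close>

text \<open>From here on \<open>a\<close> and \<open>b\<close> are the ends of a longest path.\<close>

locale diametral_tree = tree_metric V E l M f
  for V :: "nat set" and E :: "nat set set" and l :: "nat set \<Rightarrow> real"
    and M :: "'a metric" and f :: "'a \<Rightarrow> nat \<Rightarrow> real" +
  fixes a b :: nat
  assumes a_V: "a \<in> V" and b_V: "b \<in> V"
    and height_le_pos: "p \<in> R \<Longrightarrow> height a b p \<le> pos a b p"
    and pos_height_le: "p \<in> R \<Longrightarrow> pos a b p + height a b p \<le> path_len a b"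
begin

abbreviation "spine \<equiv> path_edges a b"
abbreviation "wd \<equiv> pos a b"
abbreviation "ht \<equiv> height a b"
abbreviation "D \<equiv> path_len a b"

text \<open>Two points have the same foot when the branches containing them are attached to the path at
  the same point.\<close>

definition same_foot :: "(nat \<Rightarrow> real) \<Rightarrow> (nat \<Rightarrow> real) \<Rightarrow> bool" where
  "same_foot p q \<longleftrightarrow> (\<forall>e\<in>spine. nn a e p = nn a e q)"

definition junctions :: "nat set" where
  "junctions = {u \<in> V. u \<noteq> a \<and> u \<noteq> b \<and> ht (vertex_pt u) = 0 \<and> (\<exists>e\<in>E - spine. u \<in> e)}"

definition next_edge :: "nat \<Rightarrow> nat set" where
  "next_edge u = (SOME e. e \<in> spine \<and> u \<in> e \<and> u \<notin> fr a e)"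

definition prev_edge :: "nat \<Rightarrow> nat set" where
  "prev_edge u = (SOME e. e \<in> spine \<and> u \<in> e \<and> u \<in> fr a e)"

text \<open>Cutting the path just after the junction \<open>u\<close> leaves a left part, cutting it just before \<open>u\<close> a
  right part. They overlap in the branches attached at \<open>u\<close>.\<close>

definition left_part :: "nat \<Rightarrow> nat set" where
  "left_part u = V - fr a (next_edge u)"

definition right_part :: "nat \<Rightarrow> nat set" where
  "right_part u = fr a (prev_edge u)"

definition overlap :: "nat \<Rightarrow> real" where
  "overlap u = len (left_part u \<inter> right_part u)"

lemma finite_junctions [simp]: "finite junctions"
  by (simp add: junctions_def)

lemma junctionD:
  assumes "u \<in> junctions"
  shows "u \<in> V" "u \<noteq> a" "u \<noteq> b" "ht (vertex_pt u) = 0" "vertex_pt u \<in> R"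
  using assms vertex_pt_R by (auto simp: junctions_def)

lemma path_E: "e \<in> spine \<Longrightarrow> e \<in> E"
  using path_edges_subset by blast

lemma b_far: "e \<in> spine \<Longrightarrow> b \<in> fr a e"
  by (simp add: path_edges_def)

lemma next_edge:
  assumes "u \<in> junctions"
  shows "next_edge u \<in> spine" "u \<in> next_edge u" "u \<notin> fr a (next_edge u)"
proof -
  obtain w where "{u, w} \<in> spine" "u \<notin> fr a {u, w}"
    using path_next_edge[OF a_V b_V junctionD(1,3,4)[OF assms]] by metis
  then have "\<exists>e. e \<in> spine \<and> u \<in> e \<and> u \<notin> fr a e"
    by blast
  from someI_ex[OF this] show "next_edge u \<in> spine" "u \<in> next_edge u" "u \<notin> fr a (next_edge u)"
    unfolding next_edge_def by auto
qed

lemma prev_edge: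
  assumes "u \<in> junctions"
  shows "prev_edge u \<in> spine" "u \<in> prev_edge u" "u \<in> fr a (prev_edge u)"
proof -
  obtain w where "{u, w} \<in> spine" "u \<in> fr a {u, w}"
    using path_previous_edge[OF a_V junctionD(1,2,4)[OF assms]] by metis
  then have "\<exists>e. e \<in> spine \<and> u \<in> e \<and> u \<in> fr a e"
    by blast
  from someI_ex[OF this] show "prev_edge u \<in> spine" "u \<in> prev_edge u" "u \<in> fr a (prev_edge u)"
    unfolding prev_edge_def by auto
qed

lemma next_prev:
  assumes "u \<in> junctions"
  shows "next_edge u \<noteq> prev_edge u" "fr a (next_edge u) \<subseteq> fr a (prev_edge u)"
proof -
  show "next_edge u \<noteq> prev_edge u"
    using next_edge(3)[OF assms] prev_edge(3)[OF assms] by metis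
  show "fr a (next_edge u) \<subseteq> fr a (prev_edge u)"
    using path_edges_nested[OF a_V next_edge(1)[OF assms] prev_edge(1)[OF assms]]
      next_edge(3)[OF assms] prev_edge(3)[OF assms] by blast
qed

lemma off_path_edge:
  assumes "u \<in> junctions"
  obtains e where "e \<in> E" "u \<in> e" "e \<noteq> next_edge u" "e \<noteq> prev_edge u"
proof -
  obtain e where "e \<in> E" "e \<notin> spine" "u \<in> e"
    using assms by (auto simp: junctions_def)
  then show ?thesis
    using that[of e] next_edge(1)[OF assms] prev_edge(1)[OF assms] by blast
qed

lemma next_end_far:
  assumes "u \<in> junctions"
  obtains z where "next_edge u = {u, z}" "z \<in> fr a (next_edge u)"
proof -
  obtain x z where "next_edge u = {x, z}" "x \<notin> fr a (next_edge u)" "z \<in> fr a (next_edge u)"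
    using far_ends[OF a_V path_E[OF next_edge(1)[OF assms]]] by blast
  then show ?thesis
    using that[of z] next_edge(2,3)[OF assms] by (metis insertE singletonD)
qed

lemma prev_end_near:
  assumes "u \<in> junctions"
  obtains z where "prev_edge u = {u, z}" "z \<notin> fr a (prev_edge u)"
proof -
  obtain z x where "prev_edge u = {z, x}" "x \<in> fr a (prev_edge u)" "z \<notin> fr a (prev_edge u)"
    using far_ends[OF a_V path_E[OF prev_edge(1)[OF assms]]] by blast
  then have "prev_edge u = {x, z}" "x \<in> fr a (prev_edge u)" "z \<notin> fr a (prev_edge u)"
    by (simp_all add: insert_commute)
  then show ?thesis
    using that[of z] prev_edge(2,3)[OF assms] by (metis insertE singletonD)
qed

text \<open>No edge of the path lies strictly between the two path edges at a junction.\<close>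

lemma overlap_vertex_foot:
  assumes u: "u \<in> junctions" and y: "y \<in> left_part u \<inter> right_part u" and e: "e \<in> spine"
  shows "y \<in> fr a e \<longleftrightarrow> u \<in> fr a e"
proof -
  note n = next_edge[OF u] and p = prev_edge[OF u]
  have y': "y \<in> V" "y \<notin> fr a (next_edge u)" "y \<in> fr a (prev_edge u)"
    using y by (auto simp: left_part_def right_part_def)
  show ?thesis
  proof (cases "e = next_edge u \<or> e = prev_edge u")
    case True
    then show ?thesis
      using y' n p by auto
  next
    case False
    consider "fr a e \<subseteq> fr a (next_edge u)" | "fr a (prev_edge u) \<subseteq> fr a e"
      | "fr a (next_edge u) \<subseteq> fr a e" "fr a e \<subseteq> fr a (prev_edge u)"
      using path_edges_nested[OF a_V e n(1)] path_edges_nested[OF a_V e p(1)] by blast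
    then show ?thesis
    proof cases
      case 1
      then show ?thesis
        using y' n by blast
    next
      case 2
      then show ?thesis
        using y' p by blast
    next
      case 3
      show ?thesis
      proof (cases "u \<in> fr a e")
        case True
        obtain z where z: "prev_edge u = {u, z}" "z \<notin> fr a (prev_edge u)"
          using prev_end_near[OF u] .
        have "prev_edge u \<subseteq> fr a e"
          by (rule other_edge_meets_far[OF path_E[OF e] path_E[OF p(1)] _ p(2) True]) (use False in auto)
        then show ?thesis
          using z 3(2) by blast
      next
        case u_near: False
        obtain z where z: "next_edge u = {u, z}" "z \<in> fr a (next_edge u)"
          using next_end_far[OF u] .
        have "next_edge u \<subseteq> fr a e"
        proof (rule other_edge_meets_far[OF path_E[OF e] path_E[OF n(1)]])
          show "z \<in> fr a e"
            using z(2) 3(1) by blast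
          show "z \<in> next_edge u"
            using z(1) by simp
        qed (use False in auto)
        then show ?thesis
          using u_near n(2) by blast
      qed
    qed
  qed
qed

lemma overlap_edges_off_path:
  assumes "u \<in> junctions"
  shows "inner_edges E (left_part u \<inter> right_part u) \<inter> spine = {}"
proof -
  have False if e: "e \<in> spine" "e \<subseteq> left_part u \<inter> right_part u" for e
  proof -
    obtain x y where "e = {x, y}" "x \<notin> fr a e" "y \<in> fr a e"
      using far_ends[OF a_V path_E[OF e(1)]] by blast
    then show False
      using overlap_vertex_foot[OF assms _ e(1)] e(2) by blast
  qed
  then show ?thesis
    by (auto simp: inner_edges_def)
qed

lemma path_vertex_unique:
  assumes "u \<in> V" "u' \<in> V" "ht (vertex_pt u) = 0" "ht (vertex_pt u') = 0"
    and "same_foot (vertex_pt u) (vertex_pt u')"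
  shows "u = u'"
proof (rule ccontr)
  assume ne: "u \<noteq> u'"
  obtain z where z: "{u, z} \<in> E" "nn a {u, z} (vertex_pt u) \<noteq> nn a {u, z} (vertex_pt u')"
    using step_vertices[OF a_V assms(1,2) ne] by blast
  show False
  proof (cases "{u, z} \<in> spine")
    case True
    then show False
      using z(2) assms(5) by (simp add: same_foot_def)
  next
    case False
    then have "nn a {u, z} (vertex_pt u) = 0" "nn a {u, z} (vertex_pt u') = 0"
      using assms(3,4) height_zero_iff[OF vertex_pt_R[OF assms(1)]]
        height_zero_iff[OF vertex_pt_R[OF assms(2)]] z(1) by blast+
    then show False
      using z(2) by simp
  qed
qed

lemma overlap_edges_disjoint:
  assumes u: "u \<in> junctions" and u': "u' \<in> junctions" and ne: "u \<noteq> u'"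
  shows "inner_edges E (left_part u \<inter> right_part u) \<inter>
    inner_edges E (left_part u' \<inter> right_part u') = {}"
proof (rule ccontr)
  assume "\<not> ?thesis"
  then obtain e where e: "e \<in> E" "e \<subseteq> left_part u \<inter> right_part u" "e \<subseteq> left_part u' \<inter> right_part u'"
    by (auto simp: inner_edges_def)
  then obtain y where y: "y \<in> left_part u \<inter> right_part u" "y \<in> left_part u' \<inter> right_part u'"
    using edge_ends by blast
  have "same_foot (vertex_pt u) (vertex_pt u')"
    using overlap_vertex_foot[OF u y(1)] overlap_vertex_foot[OF u' y(2)]
      junctionD(1)[OF u] junctionD(1)[OF u'] by (auto simp: same_foot_def nn_vertex)
  then show False
    using path_vertex_unique junctionD[OF u] junctionD[OF u'] ne by blast
qed

text \<open>The overlaps at different junctions consist of different branches, and the path itself does not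
  contribute to any of them.\<close>

lemma sum_overlap: "(\<Sum>u\<in>junctions. overlap u) \<le> total - D"
proof -
  let ?O = "\<lambda>u. inner_edges E (left_part u \<inter> right_part u)"
  have "(\<Sum>u\<in>junctions. overlap u) = (\<Sum>e\<in>(\<Union>u\<in>junctions. ?O u). l e)"
    unfolding overlap_def by (rule sum.UNION_disjoint[symmetric]) (auto simp: overlap_edges_disjoint)
  also have "\<dots> \<le> (\<Sum>e\<in>E - spine. l e)"
    by (rule sum_mono2) (use overlap_edges_off_path in \<open>auto simp: inner_edges_def l_nonneg\<close>)
  also have "\<dots> = total - D"
    unfolding total_def path_len_def sum_path_edges[of l a b] by simp
  finally show ?thesis .
qed

text \<open>The two parts contain every edge, and those in the overlap twice.\<close>

lemma len_parts:
  assumes u: "u \<in> junctions"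
  shows "len (left_part u) + len (right_part u) = total + overlap u"
proof -
  have "e \<in> inner_edges E (left_part u) \<union> inner_edges E (right_part u)" if e: "e \<in> E" for e
  proof (cases "e = next_edge u")
    case True
    obtain z where "next_edge u = {u, z}" "z \<in> fr a (next_edge u)"
      using next_end_far[OF u] .
    then show ?thesis
      using True e next_prev(2)[OF u] prev_edge(3)[OF u] by (auto simp: inner_edges_def right_part_def)
  next
    case False
    then show ?thesis
      using other_edge_far[OF path_E[OF next_edge(1)[OF u]] e False] edge_card[OF e] next_prev(2)[OF u] e
      by (auto simp: inner_edges_def right_part_def left_part_def)
  qed
  then have un: "inner_edges E (left_part u) \<union> inner_edges E (right_part u) = E"
    by (auto simp: inner_edges_def)
  have int: "inner_edges E (left_part u) \<inter> inner_edges E (right_part u) =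
      inner_edges E (left_part u \<inter> right_part u)"
    by (auto simp: inner_edges_def)
  show ?thesis
    using sum.union_inter[of "inner_edges E (left_part u)" "inner_edges E (right_part u)" l]
    unfolding un int total_def overlap_def by simp
qed

lemma parts_cover:
  assumes "u \<in> junctions" "p \<in> R"
  shows "nn a (next_edge u) p = 0 \<or> nn a (prev_edge u) p = 1"
  using nn_chain[OF a_V path_E[OF next_edge(1)] path_E[OF prev_edge(1)] next_prev(1,2) assms(2)]
    nn_nonneg[OF assms(2), of a "next_edge u"] assms(1) by force

text \<open>The edges between \<open>a\<close> and a point of the left part belong to the left part, those between \<open>b\<close>
  and a point of the right part to the right part. So the parts are at least as long as these
  connections.\<close>

lemma left_edge:
  assumes "u \<in> junctions" "p \<in> R" "nn a (next_edge u) p = 0" "e \<in> E" "0 < nn a e p"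
  shows "e \<subseteq> left_part u"
proof -
  have n: "next_edge u \<in> E"
    using next_edge(1)[OF assms(1)] path_E by blast
  have ne: "e \<noteq> next_edge u"
    using assms(3,5) by auto
  have "\<not> e \<subseteq> fr a (next_edge u)"
  proof
    assume "e \<subseteq> fr a (next_edge u)"
    from far_subset_of_edge[OF a_V n assms(4) this ne] nn_pos_meets[OF assms(5)]
      nn_zero_iff[OF assms(2)] assms(3) show False
      by blast
  qed
  then show ?thesis
    using other_edge_far[OF n assms(4) ne] edge_card[OF assms(4)] by (auto simp: left_part_def)
qed

lemma right_edge:
  assumes "u \<in> junctions" "p \<in> R" "nn a (prev_edge u) p = 1" "e \<in> E"
    and "if e \<in> spine then nn a e p < 1 else 0 < nn a e p"
  shows "e \<subseteq> right_part u"
proof -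
  have pr: "prev_edge u \<in> spine" "prev_edge u \<in> E"
    using prev_edge(1)[OF assms(1)] path_E by auto
  have ne: "e \<noteq> prev_edge u"
    using assms(3,5) pr by auto
  have sub: "supp p \<subseteq> fr a (prev_edge u)"
    using assms(2,3) nn_one_iff by blast
  have "e \<inter> fr a (prev_edge u) \<noteq> {}"
  proof
    assume "e \<inter> fr a (prev_edge u) = {}"
    from far_subset_or_disjoint[OF a_V pr(2) assms(4) this] show False
    proof
      assume far: "fr a (prev_edge u) \<subseteq> fr a e"
      then have "e \<in> spine" "nn a e p = 1"
        using b_far[OF pr(1)] assms(4) nn_one[OF assms(2)] sub by (auto simp: path_edges_def)
      then show False
        using assms(5) by simp
    next
      assume disj: "fr a (prev_edge u) \<inter> fr a e = {}"
      then have "e \<notin> spine"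
        using b_far[OF pr(1)] b_far[of e] by blast
      then show False
        using assms(5) nn_pos_meets[of a e p] sub disj by auto
    qed
  qed
  then show ?thesis
    using other_edge_far[OF pr(2) assms(4) ne] by (auto simp: right_part_def)
qed

lemma nn_sum_le_len:
  assumes "p \<in> R" "F \<subseteq> E" "\<And>e. e \<in> F \<Longrightarrow> 0 \<le> c e \<and> c e \<le> 1"
    and "\<And>e. e \<in> F \<Longrightarrow> 0 < c e \<Longrightarrow> e \<subseteq> W"
  shows "(\<Sum>e\<in>F. l e * c e) \<le> len W"
proof -
  have "(\<Sum>e\<in>F. l e * c e) = (\<Sum>e\<in>F \<inter> inner_edges E W. l e * c e)"
  proof (rule sum.mono_neutral_right)
    show "\<forall>e\<in>F - F \<inter> inner_edges E W. l e * c e = 0"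
    proof
      fix e
      assume "e \<in> F - F \<inter> inner_edges E W"
      then have "e \<in> F" "\<not> 0 < c e"
        using assms(2,4) by (auto simp: inner_edges_def)
      then show "l e * c e = 0"
        using assms(3)[of e] by simp
    qed
  qed (use finite_subset[OF assms(2)] in auto)
  also have "\<dots> \<le> (\<Sum>e\<in>F \<inter> inner_edges E W. l e)"
    by (rule sum_mono) (use assms(2,3) l_nonneg in \<open>auto intro!: mult_left_le\<close>)
  also have "\<dots> \<le> len W"
    by (rule sum_mono2) (use l_nonneg in \<open>auto simp: inner_edges_def\<close>)
  finally show ?thesis .
qed

lemma left_len:
  assumes "u \<in> junctions" "p \<in> R" "nn a (next_edge u) p = 0"
  shows "wd p + ht p \<le> len (left_part u)"
proof -
  have "wd p + ht p = (\<Sum>e\<in>E. l e * nn a e p)"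
    unfolding pos_def height_def sum_path_edges[of _ a b] ..
  also have "\<dots> \<le> len (left_part u)"
    by (rule nn_sum_le_len[OF assms(2)]) (use left_edge[OF assms] nn_nonneg nn_le_1 assms(2) in auto)
  finally show ?thesis .
qed

lemma right_len:
  assumes "u \<in> junctions" "p \<in> R" "nn a (prev_edge u) p = 1"
  shows "D - wd p + ht p \<le> len (right_part u)"
proof -
  define c where "c = (\<lambda>e. if e \<in> spine then 1 - nn a e p else nn a e p)"
  have "D - wd p = (\<Sum>e\<in>spine. l e * c e)"
    unfolding pos_def path_len_def sum_subtractf[symmetric]
    by (rule sum.cong) (auto simp: c_def algebra_simps)
  moreover have "ht p = (\<Sum>e\<in>E - spine. l e * c e)"
    unfolding height_def by (rule sum.cong) (auto simp: c_def)
  ultimately have "D - wd p + ht p = (\<Sum>e\<in>E. l e * c e)"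
    unfolding sum_path_edges[of _ a b] by simp
  also have "\<dots> \<le> len (right_part u)"
  proof (rule nn_sum_le_len[OF assms(2)])
    show "e \<subseteq> right_part u" if "e \<in> E" "0 < c e" for e
      using right_edge[OF assms that(1)] that(2) by (simp add: c_def split: if_splits)
  qed (use nn_nonneg nn_le_1 assms(2) in \<open>auto simp: c_def\<close>)
  finally show ?thesis .
qed

lemma height_le_overlap:
  assumes "u \<in> junctions" "p \<in> R" "nn a (next_edge u) p = 0" "nn a (prev_edge u) p = 1"
  shows "ht p \<le> overlap u"
  unfolding height_def overlap_def
  by (rule nn_sum_le_len[OF assms(2)])
    (use left_edge[OF assms(1-3)] right_edge[OF assms(1,2,4)] nn_nonneg nn_le_1 assms(2) in auto)

lemma junction_in_both:
  assumes "u \<in> junctions" "p \<in> R" "same_foot p (vertex_pt u)"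
  shows "nn a (next_edge u) p = 0" "nn a (prev_edge u) p = 1" "wd p = wd (vertex_pt u)"
proof -
  show "nn a (next_edge u) p = 0" "nn a (prev_edge u) p = 1"
    using assms(3) next_edge[OF assms(1)] prev_edge[OF assms(1)] junctionD(1)[OF assms(1)]
    by (auto simp: same_foot_def nn_vertex)
  show "wd p = wd (vertex_pt u)"
    unfolding pos_def by (rule sum.cong) (use assms(3) in \<open>auto simp: same_foot_def\<close>)
qed

text \<open>The foot of a point off the path is the near end of the edge off the path with the largest far
  side among those that separate the point from the root.\<close>

lemma foot_exists:
  assumes p: "p \<in> R" "0 < ht p"
  obtains u where "u \<in> junctions" "same_foot p (vertex_pt u)"
proof -
  define A where "A = {e \<in> E - spine. 0 < nn a e p}"
  have "A \<noteq> {}"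
  proof
    assume "A = {}"
    then have "\<forall>e\<in>E - spine. nn a e p = 0"
      using nn_nonneg[OF p(1)] by (auto simp: A_def not_less intro: antisym)
    then show False
      using height_zero_iff[OF p(1), of a b] p(2) by simp
  qed
  moreover have "finite A"
    by (simp add: A_def)
  ultimately obtain e where e: "e \<in> A" "\<And>e'. e' \<in> A \<Longrightarrow> real (card (fr a e')) \<le> real (card (fr a e))"
    using finite_maximal[of A "\<lambda>e. real (card (fr a e))"] by blast
  have eE: "e \<in> E" "e \<notin> spine" and pos_e: "0 < nn a e p"
    using e(1) by (auto simp: A_def)
  obtain u w where uw: "e = {u, w}" "u \<in> V" "u \<notin> fr a e" "w \<in> fr a e"
    using far_ends[OF a_V eE(1)] by blast
  have ht_u: "ht (vertex_pt u) = 0"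
  proof -
    have "nn a e' (vertex_pt u) = 0" if e': "e' \<in> E - spine" for e'
    proof (rule ccontr)
      assume "nn a e' (vertex_pt u) \<noteq> 0"
      then have u: "u \<in> fr a e'"
        using uw(2) by (simp add: nn_vertex split: if_splits)
      then have ne: "e \<noteq> e'"
        using uw(3) by blast
      then have "e \<subseteq> fr a e'"
        using other_edge_meets_far[of e' e u a] e' eE u uw(1) by blast
      from far_subset_of_edge[OF a_V _ eE(1) this ne] have sub: "fr a e \<subseteq> fr a e'"
        using e' by blast
      then have less: "card (fr a e) < card (fr a e')"
        using u uw(3) by (intro psubset_card_mono) auto
      have "0 < nn a e' p"
        using nn_pos_meets[OF pos_e] sub nn_pos_of_meets[OF p(1)] by blast
      then show False
        using e(2)[of e'] e' less by (simp add: A_def)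
    qed
    then show ?thesis
      using height_zero_iff[OF vertex_pt_R[OF uw(2)]] by blast
  qed
  have foot: "nn a e' p = nn a e' (vertex_pt u)" if e': "e' \<in> spine" for e'
  proof -
    have ne: "e \<noteq> e'" "e' \<in> E"
      using e' eE path_E by auto
    show ?thesis
    proof (cases "u \<in> fr a e'")
      case True
      then have "e \<subseteq> fr a e'"
        using other_edge_meets_far[OF ne(2) eE(1) ne(1), of u a] uw(1) by blast
      then have "fr a e \<subseteq> fr a e'"
        using far_subset_of_edge[OF a_V ne(2) eE(1) _ ne(1)] by blast
      from nn_chain[OF a_V eE(1) ne(2,1) this p(1) pos_e] show ?thesis
        using True uw(2) by (simp add: nn_vertex)
    next
      case False
      then have disj_e: "e \<inter> fr a e' = {}"
        using other_edge_far[OF ne(2) eE(1) ne(1), of a] uw(1) by blast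
      have "\<not> fr a e' \<subseteq> fr a e"
        using b_far[OF e'] eE by (auto simp: path_edges_def)
      then have disj: "fr a e' \<inter> fr a e = {}"
        using far_subset_or_disjoint[OF a_V ne(2) eE(1) disj_e] by blast
      have "\<not> 0 < nn a e' p"
      proof
        assume "0 < nn a e' p"
        then obtain x y where xy: "x \<in> supp p" "x \<in> fr a e'" "y \<in> supp p" "y \<in> fr a e"
          using nn_pos_meets[OF pos_e] nn_pos_meets[of a e' p] by blast
        show False
        proof (cases rule: R_cases[OF p(1)])
          case (1 v)
          then show False
            using xy disj by auto
        next
          case 2
          then show False
            using other_edge_meets_far[OF eE(1) 2 _ xy(3,4)] disj_e disj xy by blast
        qed
      qed
      then show ?thesis
        using False uw(2) nn_nonneg[OF p(1), of a e'] by (simp add: nn_vertex)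
    qed
  qed
  then have same: "same_foot p (vertex_pt u)"
    by (simp add: same_foot_def)
  have wd: "wd p = wd (vertex_pt u)"
    unfolding pos_def by (rule sum.cong) (use foot in auto)
  \<comment> \<open>At the ends of a longest path nothing is attached.\<close>
  have "u \<noteq> a"
  proof
    assume "u = a"
    then have "wd p = 0"
      unfolding wd by (simp add: pos_def nn_root[OF a_V])
    then show False
      using height_le_pos[OF p(1)] p(2) by simp
  qed
  moreover have "u \<noteq> b"
  proof
    assume "u = b"
    then have "wd p = D"
      unfolding pos_def path_len_def
      by (intro sum.cong) (auto simp: foot nn_path_end[OF b_V path_E])
    then show False
      using pos_height_le[OF p(1)] p(2) by simp
  qed
  ultimately have "u \<in> junctions"
    using ht_u uw(1,2) eE by (auto simp: junctions_def)
  then show ?thesis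
    using that same by blast
qed

text \<open>At a junction at least three edges meet: two of the path and one further edge. So both parts have
  fewer leaves than the tree.\<close>

lemma left_piece:
  assumes u: "u \<in> junctions" and "0 < len (left_part u)"
  obtains j where "j < card (graph_leaves V E)" "piece M (spanned (left_part u)) (len (left_part u)) j"
proof -
  obtain e where e: "e \<in> E" "u \<in> e" "e \<noteq> next_edge u" "e \<noteq> prev_edge u"
    using off_path_edge[OF u] .
  have nE: "next_edge u \<in> E" "prev_edge u \<in> E"
    using next_edge(1)[OF u] prev_edge(1)[OF u] path_E by auto
  have "inner_edges E (V - fr a (next_edge u)) \<noteq> {}"
    using assms(2) by (force simp: left_part_def)
  from near_piece[OF a_V nE(1) this]
    card_near_leaves_less[OF a_V nE(1) next_edge(2,3)[OF u] e(1) nE(2) e(4,3) _ e(2) prev_edge(2)[OF u]]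
    next_prev(1)[OF u]
  show ?thesis
    using that unfolding left_part_def by metis
qed

lemma right_piece:
  assumes u: "u \<in> junctions" and "0 < len (right_part u)"
  obtains j where "j < card (graph_leaves V E)" "piece M (spanned (right_part u)) (len (right_part u)) j"
proof -
  obtain e where e: "e \<in> E" "u \<in> e" "e \<noteq> next_edge u" "e \<noteq> prev_edge u"
    using off_path_edge[OF u] .
  have nE: "next_edge u \<in> E" "prev_edge u \<in> E"
    using next_edge(1)[OF u] prev_edge(1)[OF u] path_E by auto
  have fb: "fr b (prev_edge u) = V - right_part u"
    using far_other_root[OF a_V nE(2) b_far[OF prev_edge(1)[OF u]]] by (simp add: right_part_def)
  then have right: "right_part u = V - fr b (prev_edge u)"
    using far_subset by (auto simp: right_part_def)
  have "u \<notin> fr b (prev_edge u)"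
    using fb prev_edge(3)[OF u] by (simp add: right_part_def)
  note less = card_near_leaves_less[OF b_V nE(2) prev_edge(2)[OF u] this e(1) nE(1) e(3,4)
      next_prev(1)[OF u] e(2) next_edge(2)[OF u]]
  have "inner_edges E (V - fr b (prev_edge u)) \<noteq> {}"
    using assms(2) by (force simp: right)
  from near_piece[OF b_V nE(2) this] less show ?thesis
    using that unfolding right by metis
qed

end

section \<open>Budgets of constant density\<close>

definition dens :: "real \<Rightarrow> real \<Rightarrow> real \<Rightarrow> real \<Rightarrow> ennreal" where
  "dens K \<alpha> \<beta> = (\<lambda>y. ennreal K * indicator {\<alpha>..\<beta>} y)"

lemma dens_measurable [simp]: "dens K \<alpha> \<beta> \<in> borel_measurable borel"
  unfolding dens_def by measurable

lemma dens_add: "0 \<le> K \<Longrightarrow> 0 \<le> K' \<Longrightarrow> dens K \<alpha> \<beta> y + dens K' \<alpha> \<beta> y = dens (K + K') \<alpha> \<beta> y"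
  by (simp add: dens_def ennreal_plus distrib_right)

lemma achievable_dens_scale:
  assumes "achievable S m s (dens K \<alpha> \<beta>) c" "0 \<le> k" "0 \<le> K"
  shows "achievable S m s (dens (k * K) \<alpha> \<beta>) (\<lambda>x. k * c x)"
  using achievable_scale[OF assms(1,2)] assms(2,3) by (simp add: dens_def ennreal_mult mult.assoc)

lemma achievable_dens_add:
  assumes "achievable S m s (dens K \<alpha> \<beta>) c" "achievable S m s (dens K' \<alpha> \<beta>) c'" "0 \<le> K" "0 \<le> K'"
  shows "achievable S m s (dens (K + K') \<alpha> \<beta>) (\<lambda>x. c x + c' x)"
  using achievable_add[OF assms(1,2)] dens_add[OF assms(3,4)] by simp

lemma achievable_dens_sum:
  assumes "finite I" "\<And>i. i \<in> I \<Longrightarrow> achievable S m s (dens (K i) \<alpha> \<beta>) (c i)" "\<And>i. i \<in> I \<Longrightarrow> 0 \<le> K i"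
  shows "achievable S m s (dens (\<Sum>i\<in>I. K i) \<alpha> \<beta>) (\<lambda>x. \<Sum>i\<in>I. c i x)"
proof -
  have "(\<Sum>i\<in>I. dens (K i) \<alpha> \<beta> y) = dens (\<Sum>i\<in>I. K i) \<alpha> \<beta> y" for y
    using assms(3) by (simp add: dens_def sum_distrib_right[symmetric] sum_ennreal)
  then show ?thesis
    using achievable_sum[of I S m s "\<lambda>i. dens (K i) \<alpha> \<beta>" c] assms(1,2) by simp
qed

text \<open>The two intervals of marks share a single point, which has measure zero.\<close>

lemma achievable_dens_stack:
  assumes "achievable S m s (dens K \<alpha> \<gamma>) c" "achievable S m s (dens K \<gamma> \<beta>) c'" "\<alpha> \<le> \<gamma>" "\<gamma> \<le> \<beta>"
  shows "achievable S m s (dens K \<alpha> \<beta>) (\<lambda>x. c x + c' x)"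
proof (rule achievable_mono_AE[OF achievable_add[OF assms(1,2)]])
  have "AE y in lborel. y \<noteq> \<gamma>"
    by (rule AE_lborel_singleton)
  then show "AE y in lborel. dens K \<alpha> \<gamma> y + dens K \<gamma> \<beta> y \<le> dens K \<alpha> \<beta> y"
    by eventually_elim (use assms(3,4) in \<open>auto simp: dens_def indicator_def\<close>)
qed auto

lemma achievable_dens_balls:
  assumes "0 \<le> \<alpha>" "\<beta> \<le> s" "0 \<le> K"
    and "\<And>r. r \<in> {\<alpha>..\<beta>} \<Longrightarrow> z r \<in> mspace S"
    and "\<And>r r'. r \<in> {\<alpha>..\<beta>} \<Longrightarrow> r' \<in> {\<alpha>..\<beta>} \<Longrightarrow> mdist S (z r) (z r') \<le> dist r r'"
  shows "achievable S m s (dens K \<alpha> \<beta>) (\<lambda>x. K * measure lborel {r \<in> {\<alpha>..\<beta>}. mdist S x (z r) \<le> r})"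
proof -
  have "Lipschitz_continuous_map (submetric euclidean_metric {\<alpha>..\<beta>}) S z"
    unfolding Lipschitz_continuous_map_def using assms(4,5) by (auto intro!: exI[of _ 1])
  then have "continuous_map (top_of_set {\<alpha>..\<beta>}) (mtopology_of S) z"
    using Lipschitz_continuous_imp_continuous_map by (fastforce simp: mtopology_of_submetric)
  from achievable_scale[OF achievable_balls[OF assms(1,2) this] assms(3)] show ?thesis
    by (simp add: dens_def)
qed

text \<open>A part shorter than twice the largest mark is covered at the level given by its own length,
  and the marks above half its length serve as radii of balls around its centre. In this way the
  density \<open>4 / (4 * \<sigma> - L)\<close> gives one covering, and \<open>(\<sigma> + L / 2) / \<sigma>\<^sup>2\<close> is an upper bound for it that is
  linear in \<open>L\<close>.\<close>

lemma achievable_part: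
  assumes hyp: "m = 2 \<or> (\<forall>j. 2 \<le> j \<and> j < m \<longrightarrow> P_assertion j)"
    and p: "piece M B L j" "j < m" and L: "0 < L" and \<sigma>: "0 < \<sigma>" "\<sigma> \<le> s"
  shows "achievable M m s (dens (max L (\<sigma> + L / 2) / \<sigma>\<^sup>2) 0 \<sigma>) (indicator B)"
proof (cases "2 * \<sigma> \<le> L")
  case True
  then have "max L (\<sigma> + L / 2) = L"
    by simp
  then show ?thesis
    using achievable_piece[OF hyp p(1) \<sigma> True] p(2) by (simp add: dens_def)
next
  case False
  define q where "q = (\<sigma> + L / 2) / \<sigma>\<^sup>2"
  have q: "0 < q" "max L (\<sigma> + L / 2) / \<sigma>\<^sup>2 = q"
    using False L \<sigma> by (auto simp: q_def add_pos_pos)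
  have "achievable M m s (dens (L / (L / 2)\<^sup>2) 0 (L / 2)) (indicator B)"
    using achievable_piece[OF hyp p(1), of "L / 2" s] p(2) L \<sigma> False by (simp add: dens_def)
  from achievable_dens_scale[OF this, of "q * L / 4"]
  have low: "achievable M m s (dens q 0 (L / 2)) (\<lambda>x. q * L / 4 * indicator B x)"
    using L q(1) by (simp add: power2_eq_square field_simps)
  obtain c where c: "c \<in> mspace M" "\<And>x. x \<in> B \<Longrightarrow> mdist M x c \<le> L / 2"
    using piece_center[OF p(1)] by blast
  have "achievable M m s (dens q (L / 2) \<sigma>)
      (\<lambda>x. q * measure lborel {r \<in> {L / 2..\<sigma>}. mdist M x c \<le> r})"
  proof (rule achievable_dens_balls)
    show "mdist M c c \<le> dist r r'" for r r' :: real
      using Metric_space.mdist_zero[OF Metric_space_mspace_mdist c(1)] by simp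
  qed (use c(1) L \<sigma> q(1) in auto)
  from achievable_dens_stack[OF low this]
  have both: "achievable M m s (dens q 0 \<sigma>)
      (\<lambda>x. q * L / 4 * indicator B x + q * measure lborel {r \<in> {L / 2..\<sigma>}. mdist M x c \<le> r})"
    using L False by simp
  show ?thesis
    unfolding q(2)
  proof (rule achievable_mono[OF both])
    fix x
    show "indicator B x \<le> q * L / 4 * indicator B x + q * measure lborel {r \<in> {L / 2..\<sigma>}. mdist M x c \<le> r}"
    proof (cases "x \<in> B")
      case True
      then have "{r \<in> {L / 2..\<sigma>}. mdist M x c \<le> r} = {L / 2..\<sigma>}"
        using c(2) by force
      then have "measure lborel {r \<in> {L / 2..\<sigma>}. mdist M x c \<le> r} = \<sigma> - L / 2"
        using False by simp
      moreover have "1 \<le> q * L / 4 + q * (\<sigma> - L / 2)"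
      proof -
        have "L * L \<le> 2 * \<sigma> * L"
          using False L by (intro mult_right_mono) auto
        then have "\<sigma>\<^sup>2 \<le> (\<sigma> + L / 2) * (\<sigma> - L / 4)"
          by (simp add: algebra_simps power2_eq_square)
        then have "1 \<le> q * (\<sigma> - L / 4)"
          using \<sigma> by (simp add: q_def)
        then show ?thesis
          by (simp add: algebra_simps)
      qed
      ultimately show ?thesis
        using True by simp
    next
      case False
      then show ?thesis
        using q(1) by simp
    qed
  qed auto
qed

section \<open>Mixing the coverings\<close>

text \<open>For \<open>0 \<le> h\<close>, the length of the part of the interval from \<open>w - h\<close> to \<open>w + h\<close> that lies between
  \<open>2 * t\<close> and \<open>2 * \<sigma>\<close>.\<close>

definition zone :: "real \<Rightarrow> real \<Rightarrow> real \<Rightarrow> real \<Rightarrow> real" where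
  "zone t \<sigma> w h = max (2 * t) (min (w + h) (2 * \<sigma>)) - max (2 * t) (min (w - h) (2 * \<sigma>))"

lemma zone_nonneg: "0 \<le> h \<Longrightarrow> 0 \<le> zone t \<sigma> w h"
  by (auto simp: zone_def)

lemma zone_mono: "h \<le> h' \<Longrightarrow> zone t \<sigma> w h \<le> zone t \<sigma> w h'"
  by (auto simp: zone_def)

lemma zone_zero [simp]: "zone t \<sigma> w 0 = 0"
  by (simp add: zone_def)

text \<open>Here \<open>d\<close> is the height of the branches at a junction at position \<open>w\<close>, and \<open>x\<close> and \<open>y\<close> are the
  lengths of the two parts. Such a covering costs the overlap \<open>e\<close> and the surcharges on parts
  shorter than \<open>2 * \<sigma>\<close>. The surcharges are bounded by the pieces of the window from \<open>2 * t\<close> to \<open>2 * \<sigma>\<close>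
  that the interval around \<open>w\<close> leaves uncovered on either side: high branches fill the window, low
  ones need a small weight.\<close>

lemma zone_price:
  assumes t: "0 \<le> t" "t < \<sigma>" and d: "0 \<le> d" "d \<le> e"
    and x: "w + d \<le> x" and y: "2 * (\<sigma> + t) - w + d \<le> y"
  shows "zone t \<sigma> w d * (e + (max x (\<sigma> + x / 2) - x) + (max y (\<sigma> + y / 2) - y)) \<le> 2 * (\<sigma> - t) * e"
proof -
  define P where "P = max 0 (2 * \<sigma> - w - d)"
  define Q where "Q = max 0 (w - d - 2 * t)"
  let ?Z = "zone t \<sigma> w d"
  have Z: "0 \<le> ?Z"
    using d by (simp add: zone_nonneg)
  have exc: "e + (max x (\<sigma> + x / 2) - x) + (max y (\<sigma> + y / 2) - y) \<le> e + P / 2 + Q / 2"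
  proof -
    have "max x (\<sigma> + x / 2) - x \<le> P / 2" "max y (\<sigma> + y / 2) - y \<le> Q / 2"
      using x y by (auto simp: P_def Q_def max_def)
    then show ?thesis
      by linarith
  qed
  have "?Z * (e + P / 2 + Q / 2) \<le> 2 * (\<sigma> - t) * e"
  proof -
    have "?Z = 0 \<or> ?Z = 2 * (\<sigma> - t) - (P + Q)"
    proof (cases "w + d \<le> 2 * t \<or> 2 * \<sigma> \<le> w - d")
      case True
      then show ?thesis
        using d t by (auto simp: zone_def max_def min_def)
    next
      case False
      then have "max (2 * t) (min (w + d) (2 * \<sigma>)) = 2 * \<sigma> - P"
        "max (2 * t) (min (w - d) (2 * \<sigma>)) = 2 * t + Q"
        using t by (auto simp: P_def Q_def max_def min_def)
      then show ?thesis
        by (simp add: zone_def)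
    qed
    moreover have "?Z \<le> 2 * d"
      using d(1) by (auto simp: zone_def max_def min_def)
    ultimately consider "?Z = 0" | "P + Q \<le> 2 * (\<sigma> - t) - ?Z" "?Z \<le> 2 * e"
      using d by linarith
    then show ?thesis
    proof cases
      case 1
      then show ?thesis
        using t d by simp
    next
      case 2
      have "?Z * (P + Q) \<le> 2 * e * (P + Q)"
        using 2(2) by (intro mult_right_mono) (auto simp: P_def Q_def)
      also have "\<dots> \<le> 2 * e * (2 * (\<sigma> - t) - ?Z)"
        using 2(1) d by (intro mult_left_mono) auto
      finally show ?thesis
        by (simp add: algebra_simps)
    qed
  qed
  then show ?thesis
    using mult_left_mono[OF exc Z] by linarith
qed

context diametral_tree
begin

lemma path_pt_dist:
  assumes "0 \<le> z" "z \<le> D" "0 \<le> z'" "z' \<le> D"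
  shows "mdist M (g (path_pt a b z)) (g (path_pt a b z')) = \<bar>z - z'\<bar>"
  using assms ed_path_pt[OF a_V b_V assms(3,4), of "path_pt a b z"] path_pt[OF a_V b_V]
  by (simp add: dist_g[OF a_V])

lemma dist_path_pt:
  assumes "0 \<le> z" "z \<le> D" "x \<in> mspace M"
  shows "mdist M x (g (path_pt a b z)) = \<bar>wd (f x) - z\<bar> + ht (f x)"
  using ed_path_pt[OF a_V b_V assms(1,2), of "f x"] path_pt[OF a_V b_V assms(1,2)] assms(3)
  by (simp add: dist_ed[OF a_V])

text \<open>The marks up to \<open>t\<close> pay for a covering by large parts. A mark \<open>r\<close> above \<open>t\<close> pays for the
  two balls of radius \<open>r\<close> that just reach the two ends of the longest path. A point is missed by the
  balls to the extent to which the branch containing it is long.\<close>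

lemma achievable_balls_from_ends:
  assumes hyp: "m = 2 \<or> (\<forall>j. 2 \<le> j \<and> j < m \<longrightarrow> P_assertion j)"
    and m: "m = card (graph_leaves V E)" and E: "E \<noteq> {}"
    and \<sigma>: "0 < \<sigma>" "\<sigma> \<le> s" and t: "D = 2 * (\<sigma> + t)" "0 \<le> t" "t < \<sigma>"
  shows "achievable M m s (dens (total / \<sigma>\<^sup>2) 0 \<sigma>) (\<lambda>x. 1 + (total - D) * (\<sigma> - t) / (2 * \<sigma>\<^sup>2) -
    total * zone t \<sigma> (wd (f x)) (ht (f x)) / (4 * \<sigma>\<^sup>2))"
proof -
  define K where "K = total / \<sigma>\<^sup>2"
  have total: "0 < total" "4 * t \<le> total"
    using path_len_le_total[of a b] t \<sigma> by auto
  have K: "0 < K"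
    using total \<sigma> by (simp add: K_def)
  have low: "achievable M m s (dens K 0 t) (\<lambda>_. t\<^sup>2 / \<sigma>\<^sup>2)"
  proof (cases "t = 0")
    case True
    then show ?thesis
      using achievable_mono[OF achievable_zero[of M m s], of "\<lambda>_. 0" "dens K 0 t"] by simp
  next
    case False
    then have "achievable M m s (dens (total / t\<^sup>2) 0 t) (\<lambda>_. 1)"
      using achievable_long[OF hyp m E, of t s] t \<sigma> total by (simp add: dens_def)
    from achievable_dens_scale[OF this, of "t\<^sup>2 / \<sigma>\<^sup>2"] show ?thesis
      using False total by (simp add: K_def)
  qed
  let ?A = "\<lambda>x. measure lborel {r \<in> {t..\<sigma>}. mdist M x (g (path_pt a b r)) \<le> r}"
  let ?B = "\<lambda>x. measure lborel {r \<in> {t..\<sigma>}. mdist M x (g (path_pt a b (D - r))) \<le> r}"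
  have "achievable M m s (dens (K / 2) t \<sigma>) (\<lambda>x. K / 2 * ?A x)"
    by (rule achievable_dens_balls) (use t \<sigma> K path_pt(1)[OF a_V b_V] in \<open>auto simp: path_pt_dist dist_real_def\<close>)
  moreover have "achievable M m s (dens (K / 2) t \<sigma>) (\<lambda>x. K / 2 * ?B x)"
    by (rule achievable_dens_balls) (use t \<sigma> K path_pt(1)[OF a_V b_V] in \<open>auto simp: path_pt_dist dist_real_def\<close>)
  ultimately have "achievable M m s (dens (K / 2 + K / 2) t \<sigma>) (\<lambda>x. K / 2 * ?A x + K / 2 * ?B x)"
    by (rule achievable_dens_add) (use K in auto)
  from achievable_dens_stack[OF low, unfolded field_sum_of_halves, OF this[unfolded field_sum_of_halves]]
  have all: "achievable M m s (dens K 0 \<sigma>) (\<lambda>x. t\<^sup>2 / \<sigma>\<^sup>2 + (K / 2 * ?A x + K / 2 * ?B x))"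
    using t by simp
  show ?thesis
    unfolding K_def[symmetric]
  proof (rule achievable_mono[OF all])
    fix x
    assume x: "x \<in> mspace M"
    define w where "w = wd (f x)"
    define h where "h = ht (f x)"
    have h: "0 \<le> h" "h \<le> w" "w + h \<le> D"
      using height_nonneg height_le_pos pos_height_le x by (auto simp: w_def h_def)
    have left: "\<bar>w - r\<bar> + h \<le> r \<longleftrightarrow> w + h \<le> 2 * r"
      and right: "\<bar>w - (D - r)\<bar> + h \<le> r \<longleftrightarrow> D - w + h \<le> 2 * r" for r
      using h by (auto simp: abs_if split: if_splits)
    have "{r \<in> {t..\<sigma>}. mdist M x (g (path_pt a b r)) \<le> r} = {max t ((w + h) / 2)..\<sigma>}"
      using t \<sigma> left by (auto simp: dist_path_pt x w_def[symmetric] h_def[symmetric])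
    then have A: "?A x = max 0 (\<sigma> - max t ((w + h) / 2))"
      by (simp add: content_real_if max_def)
    have "{r \<in> {t..\<sigma>}. mdist M x (g (path_pt a b (D - r))) \<le> r} = {max t ((D - w + h) / 2)..\<sigma>}"
      using t \<sigma> right by (auto simp: dist_path_pt x w_def[symmetric] h_def[symmetric])
    then have B: "?B x = max 0 (\<sigma> - max t ((D - w + h) / 2))"
      by (simp add: content_real_if max_def)
    have "?A x + ?B x = \<sigma> - t - zone t \<sigma> w h / 2"
    proof -
      have "?A x = \<sigma> - max (2 * t) (min (w + h) (2 * \<sigma>)) / 2"
        unfolding A using t by (auto simp: max_def min_def)
      moreover have "?B x = max (2 * t) (min (w - h) (2 * \<sigma>)) / 2 - t"
        unfolding B using t by (auto simp: max_def min_def field_simps)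
      ultimately show ?thesis
        by (simp add: zone_def diff_divide_distrib)
    qed
    then have "K / 2 * ?A x + K / 2 * ?B x = K / 2 * (\<sigma> - t - zone t \<sigma> w h / 2)"
      by (simp add: distrib_left[symmetric])
    also have "t\<^sup>2 / \<sigma>\<^sup>2 + \<dots> = 1 + (total - D) * (\<sigma> - t) / (2 * \<sigma>\<^sup>2) - total * zone t \<sigma> w h / (4 * \<sigma>\<^sup>2)"
    proof -
      have "t\<^sup>2 + total * (\<sigma> - t - zone t \<sigma> w h / 2) / 2 =
          \<sigma>\<^sup>2 + (total - D) * (\<sigma> - t) / 2 - total * zone t \<sigma> w h / 4"
        unfolding t(1) by (simp add: algebra_simps power2_eq_square add_divide_distrib diff_divide_distrib)
      then have "(t\<^sup>2 + total * (\<sigma> - t - zone t \<sigma> w h / 2) / 2) / \<sigma>\<^sup>2 =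
          (\<sigma>\<^sup>2 + (total - D) * (\<sigma> - t) / 2 - total * zone t \<sigma> w h / 4) / \<sigma>\<^sup>2"
        by (rule arg_cong)
      then show ?thesis
        using \<sigma>(1) by (simp add: K_def add_divide_distrib diff_divide_distrib mult_ac)
    qed
    finally show "1 + (total - D) * (\<sigma> - t) / (2 * \<sigma>\<^sup>2) - total * zone t \<sigma> (wd (f x)) (ht (f x)) / (4 * \<sigma>\<^sup>2)
        \<le> t\<^sup>2 / \<sigma>\<^sup>2 + (K / 2 * ?A x + K / 2 * ?B x)"
      by (simp add: w_def h_def)
  qed auto
qed

lemma in_left_part: "x \<in> mspace M \<Longrightarrow> x \<in> spanned (left_part u) \<longleftrightarrow> nn a (next_edge u) (f x) = 0"
  unfolding left_part_def by (rule spanned_near_iff)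

lemma in_right_part: "x \<in> mspace M \<Longrightarrow> x \<in> spanned (right_part u) \<longleftrightarrow> nn a (prev_edge u) (f x) = 1"
  unfolding right_part_def by (simp add: spanned_def nn_one_iff)

lemma part_len_pos:
  assumes u: "u \<in> junctions"
  shows "0 < len (left_part u)" "0 < len (right_part u)"
proof -
  note n = next_edge[OF u] and p = prev_edge[OF u] and ju = junctionD[OF u]
  have foot: "nn a (next_edge u) (vertex_pt u) = 0" "nn a (prev_edge u) (vertex_pt u) = 1"
    using n p ju(1) by (auto simp: nn_vertex)
  have "prev_edge u \<in> inner_edges E (left_part u)"
    using left_edge[OF u ju(5) foot(1) path_E[OF p(1)]] foot(2) path_E[OF p(1)] by (simp add: inner_edges_def)
  then show "0 < len (left_part u)"
    by (intro sum_pos2[of _ "prev_edge u"]) (auto simp: inner_edges_def l_pos l_nonneg)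
  have "next_edge u \<in> inner_edges E (right_part u)"
    using right_edge[OF u ju(5) foot(2) path_E[OF n(1)]] foot(1) n(1) path_E[OF n(1)] by (simp add: inner_edges_def)
  then show "0 < len (right_part u)"
    by (intro sum_pos2[of _ "next_edge u"]) (auto simp: inner_edges_def l_pos l_nonneg)
qed

text \<open>What one covering of both parts costs, as a multiple of the density \<open>1 / \<sigma>\<^sup>2\<close>.\<close>

definition price :: "real \<Rightarrow> nat \<Rightarrow> real" where
  "price \<sigma> u = max (len (left_part u)) (\<sigma> + len (left_part u) / 2) +
    max (len (right_part u)) (\<sigma> + len (right_part u) / 2)"

lemma achievable_both_parts:
  assumes hyp: "m = 2 \<or> (\<forall>j. 2 \<le> j \<and> j < m \<longrightarrow> P_assertion j)"
    and m: "m = card (graph_leaves V E)" and \<sigma>: "0 < \<sigma>" "\<sigma> \<le> s" and u: "u \<in> junctions"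
  shows "achievable M m s (dens (price \<sigma> u / \<sigma>\<^sup>2) 0 \<sigma>)
    (\<lambda>x. indicator (spanned (left_part u)) x + indicator (spanned (right_part u)) x)"
proof -
  obtain j where j: "j < card (graph_leaves V E)" "piece M (spanned (left_part u)) (len (left_part u)) j"
    using left_piece[OF u part_len_pos(1)[OF u]] .
  obtain k where k: "k < card (graph_leaves V E)" "piece M (spanned (right_part u)) (len (right_part u)) k"
    using right_piece[OF u part_len_pos(2)[OF u]] .
  note achievable_dens_add[OF achievable_part[OF hyp j(2) _ part_len_pos(1)[OF u] \<sigma>]
      achievable_part[OF hyp k(2) _ part_len_pos(2)[OF u] \<sigma>]]
  then show ?thesis
    using j(1) k(1) m \<sigma>(1) part_len_pos[OF u]
    by (simp add: price_def add_divide_distrib le_max_iff_disj)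
qed

text \<open>The largest height above \<open>u\<close> that the lengths of the parts and of their overlap allow.\<close>

definition reach :: "nat \<Rightarrow> real" where
  "reach u = min (overlap u) (min (len (left_part u) - wd (vertex_pt u))
    (len (right_part u) - (D - wd (vertex_pt u))))"

lemma height_le_reach:
  assumes "u \<in> junctions" "p \<in> R" "same_foot p (vertex_pt u)"
  shows "ht p \<le> reach u"
  using junction_in_both[OF assms] left_len[OF assms(1,2)] right_len[OF assms(1,2)]
    height_le_overlap[OF assms(1,2)] by (simp add: reach_def)

lemma reach_nonneg: "u \<in> junctions \<Longrightarrow> 0 \<le> reach u"
  using height_le_reach[of u "vertex_pt u"] junctionD[of u] by (simp add: same_foot_def)

lemma total_le_price:
  assumes "u \<in> junctions"
  shows "total \<le> price \<sigma> u"
  using len_parts[OF assms] len_nonneg[of "left_part u \<inter> right_part u"]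
  by (simp add: price_def overlap_def)

text \<open>The balls from the two ends leave a deficit at the points of long branches. At every junction
  the coverings of the left and of the right part, which count the branches there twice, are added with
  a weight that makes up for the deficit, and the mixture is rescaled to the available budget. The
  rescaling is paid by the gain \<open>(total - D) * (\<sigma> - t)\<close> of the balls, since the overlaps have total
  length at most \<open>total - D\<close>.\<close>

lemma achievable_medium:
  assumes hyp: "m = 2 \<or> (\<forall>j. 2 \<le> j \<and> j < m \<longrightarrow> P_assertion j)"
    and m: "m = card (graph_leaves V E)" and E: "E \<noteq> {}"
    and \<sigma>: "0 < \<sigma>" "\<sigma> \<le> s" "2 * \<sigma> \<le> D" "D < 4 * \<sigma>"
  shows "achievable M m s (dens (total / \<sigma>\<^sup>2) 0 \<sigma>) (\<lambda>_. 1)"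
proof -
  define t where "t = D / 2 - \<sigma>"
  have t: "D = 2 * (\<sigma> + t)" "0 \<le> t" "t < \<sigma>"
    using \<sigma> by (auto simp: t_def)
  have total: "0 < total" "D \<le> total"
    using path_len_le_total[of a b] \<sigma> by linarith+
  define \<zeta> where "\<zeta> = (\<lambda>u. zone t \<sigma> (wd (vertex_pt u)) (reach u))"
  define c where "c = (\<lambda>u. total * \<zeta> u / (4 * \<sigma>\<^sup>2))"
  define Z where "Z = (\<Sum>u\<in>junctions. \<zeta> u * price \<sigma> u / (4 * \<sigma>\<^sup>2))"
  let ?\<iota> = "\<lambda>u x. (indicator (spanned (left_part u)) x + indicator (spanned (right_part u)) x :: real)"
  let ?z = "\<lambda>x. total * zone t \<sigma> (wd (f x)) (ht (f x)) / (4 * \<sigma>\<^sup>2)"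
  have \<zeta>: "0 \<le> \<zeta> u" if "u \<in> junctions" for u
    using zone_nonneg[OF reach_nonneg[OF that]] by (simp add: \<zeta>_def)
  have c: "0 \<le> c u" if "u \<in> junctions" for u
    using \<zeta>[OF that] total by (simp add: c_def)
  have price: "0 \<le> price \<sigma> u" if "u \<in> junctions" for u
    using total_le_price[OF that, of \<sigma>] total by linarith
  have Z: "0 \<le> Z"
    unfolding Z_def by (rule sum_nonneg) (use \<zeta> price in auto)
  have "achievable M m s (dens (\<Sum>u\<in>junctions. c u * (price \<sigma> u / \<sigma>\<^sup>2)) 0 \<sigma>) (\<lambda>x. \<Sum>u\<in>junctions. c u * ?\<iota> u x)"
    by (rule achievable_dens_sum[OF finite_junctions],
        rule achievable_dens_scale[OF achievable_both_parts[OF hyp m \<sigma>(1,2)]])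
      (use c price in auto)
  from achievable_dens_add[OF achievable_balls_from_ends[OF hyp m E \<sigma>(1,2) t] this]
  have "achievable M m s (dens (total / \<sigma>\<^sup>2 + (\<Sum>u\<in>junctions. c u * (price \<sigma> u / \<sigma>\<^sup>2))) 0 \<sigma>)
      (\<lambda>x. 1 + (total - D) * (\<sigma> - t) / (2 * \<sigma>\<^sup>2) - ?z x + (\<Sum>u\<in>junctions. c u * ?\<iota> u x))"
    using total c price by (simp add: sum_nonneg)
  moreover have "total / \<sigma>\<^sup>2 + (\<Sum>u\<in>junctions. c u * (price \<sigma> u / \<sigma>\<^sup>2)) = (1 + Z) * (total / \<sigma>\<^sup>2)"
  proof -
    have "(\<Sum>u\<in>junctions. c u * (price \<sigma> u / \<sigma>\<^sup>2)) = Z * (total / \<sigma>\<^sup>2)"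
      unfolding Z_def sum_distrib_right by (rule sum.cong) (auto simp: c_def mult_ac)
    then show ?thesis
      by (simp add: distrib_right add_divide_distrib)
  qed
  ultimately have "achievable M m s (dens ((1 + Z) * (total / \<sigma>\<^sup>2)) 0 \<sigma>)
      (\<lambda>x. 1 + (total - D) * (\<sigma> - t) / (2 * \<sigma>\<^sup>2) - ?z x + (\<Sum>u\<in>junctions. c u * ?\<iota> u x))"
    by simp
  from achievable_dens_scale[OF this, of "1 / (1 + Z)"]
  have mix: "achievable M m s (dens (total / \<sigma>\<^sup>2) 0 \<sigma>)
      (\<lambda>x. 1 / (1 + Z) * (1 + (total - D) * (\<sigma> - t) / (2 * \<sigma>\<^sup>2) - ?z x + (\<Sum>u\<in>junctions. c u * ?\<iota> u x)))"
    using Z total by simp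
  show ?thesis
  proof (rule achievable_mono[OF mix])
    fix x
    assume x: "x \<in> mspace M"
    have \<iota>: "1 \<le> ?\<iota> u x" if u: "u \<in> junctions" for u
      using parts_cover[OF u f_R[OF x]] in_left_part[OF x, of u] in_right_part[OF x, of u]
      by (auto simp: indicator_def)
    have c_le: "c u \<le> c u * ?\<iota> u x" if "u \<in> junctions" for u
      using mult_left_mono[OF \<iota>[OF that] c[OF that]] by simp
    have gain: "(\<Sum>u\<in>junctions. c u) + ?z x \<le> (\<Sum>u\<in>junctions. c u * ?\<iota> u x)"
    proof (cases "ht (f x) = 0")
      case True
      have "(\<Sum>u\<in>junctions. c u) \<le> (\<Sum>u\<in>junctions. c u * ?\<iota> u x)"
        by (rule sum_mono[OF c_le])
      then show ?thesis
        using True by simp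
    next
      case False
      then have "0 < ht (f x)"
        using height_nonneg[OF f_R[OF x], of a b] by simp
      then obtain v where v: "v \<in> junctions" "same_foot (f x) (vertex_pt v)"
        using foot_exists[OF f_R[OF x]] by blast
      note both = junction_in_both[OF v(1) f_R[OF x] v(2)]
      have "x \<in> spanned (left_part v)" "x \<in> spanned (right_part v)"
        using both(1,2) in_left_part[OF x] in_right_part[OF x] by auto
      then have two: "?\<iota> v x = 2"
        by simp
      have "?z x \<le> c v"
        unfolding c_def \<zeta>_def both(3)
        using zone_mono[OF height_le_reach[OF v(1) f_R[OF x] v(2)], of t \<sigma>] total
        by (intro divide_right_mono mult_left_mono) auto
      then have "(\<Sum>u\<in>junctions. c u) + ?z x \<le> (\<Sum>u\<in>junctions. c u) + c v"
        by simp
      also have "\<dots> = 2 * c v + (\<Sum>u\<in>junctions - {v}. c u)"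
        using sum.remove[OF finite_junctions v(1), of c] by simp
      also have "\<dots> \<le> c v * ?\<iota> v x + (\<Sum>u\<in>junctions - {v}. c u * ?\<iota> u x)"
        using two by (intro add_mono sum_mono c_le) auto
      also have "\<dots> = (\<Sum>u\<in>junctions. c u * ?\<iota> u x)"
        using sum.remove[OF finite_junctions v(1), of "\<lambda>u. c u * ?\<iota> u x"] by simp
      finally show ?thesis .
    qed
    have "(\<Sum>u\<in>junctions. \<zeta> u * (price \<sigma> u - total)) \<le> (\<Sum>u\<in>junctions. 2 * (\<sigma> - t) * overlap u)"
    proof (rule sum_mono)
      fix u
      assume u: "u \<in> junctions"
      have "price \<sigma> u - total = overlap u +
          (max (len (left_part u)) (\<sigma> + len (left_part u) / 2) - len (left_part u)) +
          (max (len (right_part u)) (\<sigma> + len (right_part u) / 2) - len (right_part u))"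
        using len_parts[OF u] by (simp add: price_def)
      moreover have "reach u \<le> overlap u" "wd (vertex_pt u) + reach u \<le> len (left_part u)"
        "2 * (\<sigma> + t) - wd (vertex_pt u) + reach u \<le> len (right_part u)"
        unfolding reach_def t(1)[symmetric] by linarith+
      ultimately show "\<zeta> u * (price \<sigma> u - total) \<le> 2 * (\<sigma> - t) * overlap u"
        using zone_price[OF t(2,3) reach_nonneg[OF u]] by (simp add: \<zeta>_def)
    qed
    also have "\<dots> \<le> 2 * (\<sigma> - t) * (total - D)"
      unfolding sum_distrib_left[symmetric] using sum_overlap t by (intro mult_left_mono) auto
    finally have "(\<Sum>u\<in>junctions. \<zeta> u * (price \<sigma> u - total)) / (4 * \<sigma>\<^sup>2) \<le> 2 * (\<sigma> - t) * (total - D) / (4 * \<sigma>\<^sup>2)"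
      by (rule divide_right_mono) simp
    moreover have "(\<Sum>u\<in>junctions. \<zeta> u * (price \<sigma> u - total)) / (4 * \<sigma>\<^sup>2) = Z - (\<Sum>u\<in>junctions. c u)"
      unfolding Z_def c_def sum_divide_distrib sum_subtractf[symmetric]
      by (rule sum.cong) (auto simp: diff_divide_distrib algebra_simps)
    moreover have "2 * (\<sigma> - t) * (total - D) / (4 * \<sigma>\<^sup>2) = (total - D) * (\<sigma> - t) / (2 * \<sigma>\<^sup>2)"
      using mult_divide_mult_cancel_left[of 2 "(total - D) * (\<sigma> - t)" "2 * \<sigma>\<^sup>2"]
      by (simp only: mult_ac)
    ultimately have "1 + Z \<le> 1 + (total - D) * (\<sigma> - t) / (2 * \<sigma>\<^sup>2) - ?z x + (\<Sum>u\<in>junctions. c u * ?\<iota> u x)"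
      using gain by linarith
    then show "1 \<le> 1 / (1 + Z) * (1 + (total - D) * (\<sigma> - t) / (2 * \<sigma>\<^sup>2) - ?z x + (\<Sum>u\<in>junctions. c u * ?\<iota> u x))"
      using Z by (simp add: field_simps)
  qed auto
qed

lemma path_len_pos:
  assumes "E \<noteq> {}"
  shows "0 < D"
proof -
  obtain e where e: "e \<in> E"
    using assms by blast
  obtain w where w: "w \<in> V" "w \<in> fr a e"
    using far_ends[OF a_V e] by blast
  have "l e \<le> ed a (vertex_pt a) (vertex_pt w)"
    using ed_ge_edge[OF e, of a "vertex_pt a" "vertex_pt w"] w by (simp add: nn_vertex nn_root[OF a_V])
  also have "\<dots> \<le> D"
    using ed_path_start[OF a_V vertex_pt_R[OF w(1)], of b] pos_height_le[OF vertex_pt_R[OF w(1)]] by simp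
  finally show ?thesis
    using l_pos[OF e] by simp
qed

lemma achievable_one:
  assumes hyp: "m = 2 \<or> (\<forall>j. 2 \<le> j \<and> j < m \<longrightarrow> P_assertion j)"
    and m: "m = card (graph_leaves V E)" and E: "E \<noteq> {}"
    and s: "0 < s" "2 * s \<le> total"
  shows "achievable M m s (dens (total / s\<^sup>2) 0 s) (\<lambda>_. 1)"
proof -
  consider "4 * s \<le> total" | "2 * s \<le> D" "D < 4 * s" | "D < 2 * s"
    using path_len_le_total[of a b] by linarith
  then show ?thesis
  proof cases
    case 1
    then show ?thesis
      using achievable_long[OF hyp m E s(1) order_refl] by (simp add: dens_def)
  next
    case 2
    then show ?thesis
      using achievable_medium[OF hyp m E s(1) order_refl] by simp
  next
    case 3
    \<comment> \<open>Marks above half the diameter are radii of balls around the midpoint that contain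
      everything; below, the diameter is exactly twice the largest mark.\<close>
    define \<sigma> where "\<sigma> = D / 2"
    have \<sigma>: "0 < \<sigma>" "\<sigma> < s" "D = 2 * \<sigma>"
      using 3 path_len_pos[OF E] by (auto simp: \<sigma>_def)
    define c where "c = g (path_pt a b (D / 2))"
    have c: "c \<in> mspace M" "mdist M c c = 0"
      using \<sigma> path_pt(1)[OF a_V b_V, of "D / 2"] by (simp_all add: c_def)
    have "achievable M m s (dens (total / \<sigma>\<^sup>2) 0 \<sigma>) (\<lambda>_. 1)"
      using achievable_medium[OF hyp m E \<sigma>(1), of s] \<sigma> by simp
    from achievable_dens_scale[OF this, of "\<sigma>\<^sup>2 / s\<^sup>2"]
    have low: "achievable M m s (dens (total / s\<^sup>2) 0 \<sigma>) (\<lambda>_. \<sigma>\<^sup>2 / s\<^sup>2)"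
      using \<sigma>(1) s by simp
    have "achievable M m s (dens (total / s\<^sup>2) \<sigma> s)
        (\<lambda>x. total / s\<^sup>2 * measure lborel {r \<in> {\<sigma>..s}. mdist M x c \<le> r})"
    proof (rule achievable_dens_balls)
      show "mdist M c c \<le> dist r r'" for r r' :: real
        unfolding c(2) by (rule zero_le_dist)
    qed (use \<sigma> s c(1) in auto)
    from achievable_dens_stack[OF low this]
    have all: "achievable M m s (dens (total / s\<^sup>2) 0 s)
        (\<lambda>x. \<sigma>\<^sup>2 / s\<^sup>2 + total / s\<^sup>2 * measure lborel {r \<in> {\<sigma>..s}. mdist M x c \<le> r})"
      using \<sigma> by simp
    show ?thesis
    proof (rule achievable_mono[OF all])
      fix x
      assume x: "x \<in> mspace M"
      have "mdist M x c \<le> \<sigma>"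
        using near_midpoint[OF a_V b_V x height_le_pos pos_height_le] x by (simp add: c_def \<sigma>_def)
      then have "{r \<in> {\<sigma>..s}. mdist M x c \<le> r} = {\<sigma>..s}"
        by auto
      then have "measure lborel {r \<in> {\<sigma>..s}. mdist M x c \<le> r} = s - \<sigma>"
        using \<sigma>(2) by simp
      moreover have "s\<^sup>2 \<le> \<sigma>\<^sup>2 + total * (s - \<sigma>)"
      proof -
        have "(s + \<sigma>) * (s - \<sigma>) \<le> total * (s - \<sigma>)"
          using \<sigma> s by (intro mult_right_mono) auto
        then show ?thesis
          by (simp add: algebra_simps power2_eq_square)
      qed
      ultimately show "1 \<le> \<sigma>\<^sup>2 / s\<^sup>2 + total / s\<^sup>2 * measure lborel {r \<in> {\<sigma>..s}. mdist M x c \<le> r}"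
        using s(1) by (simp add: add_divide_distrib[symmetric])
    qed auto
  qed
qed

end

theorem lemma3p12:
  fixes m :: nat and S :: "'a metric" and s :: real
  assumes "2 \<le> m"
    and "m = 2 \<or> (\<forall>j. 2 \<le> j \<and> j < m \<longrightarrow> P_assertion j)"
    and "finite_metric_tree S"
    and "card (tree_leaves S) = m"
    and "0 < s"
    and "2 * s \<le> tree_length S"
  shows "\<exists>(\<eta> :: ('a \<times> real) measure) (n :: nat) (u :: nat \<Rightarrow> real) (B :: nat \<Rightarrow> 'a set) (t :: nat \<Rightarrow> real).
    finite_borel_measure_on S s \<eta> \<and>
    (\<forall>\<beta><n. 0 < u \<beta> \<and> metric_subtree (B \<beta>) S) \<and>
    (\<forall>x\<in>mspace S. 1 \<le> cover_fun S s \<eta> x + (\<Sum>\<beta> | \<beta> < n \<and> x \<in> B \<beta>. u \<beta>)) \<and>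
    (\<forall>A\<in>sets borel.
       emeasure (mark_marginal \<eta>) A
         + (\<Sum>\<beta><n. ennreal (u \<beta>) * emeasure (Lam (submetric S (B \<beta>)) (t \<beta>)) A)
       \<le> emeasure (Lam S s) A) \<and>
    (\<forall>\<beta><n.
       card (tree_leaves (submetric S (B \<beta>))) = m \<and>
       0 < t \<beta> \<and> t \<beta> \<le> s \<and>
       tree_length (submetric S (B \<beta>)) \<le> tree_length S / 2 \<and>
       2 * t \<beta> \<le> tree_length (submetric S (B \<beta>)))"
proof -
  obtain V E l f where "tree_metric V E l S f"
    using assms(3) unfolding finite_metric_tree_def tree_model_iff by blast
  then interpret tree_metric V E l S f .
  have "0 < (\<Sum>e\<in>E. l e)"
    using assms(5,6) unfolding tree_length_total total_def by simp
  then have E: "E \<noteq> {}"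
    by auto
  have m: "m = card (graph_leaves V E)"
    using assms(4) card_tree_leaves[OF E] by simp
  obtain a b where ab: "a \<in> V" "b \<in> V"
    "\<And>p. p \<in> R \<Longrightarrow> height a b p \<le> pos a b p"
    "\<And>p. p \<in> R \<Longrightarrow> pos a b p + height a b p \<le> path_len a b"
    using longest_path by blast
  interpret diametral_tree V E l S f a b
    by unfold_locales (use ab in auto)
  have "achievable S m s (dens (tree_length S / s\<^sup>2) 0 s) (\<lambda>_. 1)"
    using achievable_one[OF assms(2) m E assms(5)] assms(6) by (simp add: tree_length_total)
  then obtain \<eta> tr where \<eta>: "finite_borel_measure_on S s \<eta>" "triples_ok S m s tr"
    "\<And>x. x \<in> mspace S \<Longrightarrow> 1 \<le> cover_fun S s \<eta> x + (\<Sum>(u, B, t)\<leftarrow>tr. u * indicator B x)"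
    "\<And>A. A \<in> sets borel \<Longrightarrow> emeasure (mark_marginal \<eta>) A +
       (\<Sum>(u, B, t)\<leftarrow>tr. ennreal u * emeasure (Lam (submetric S B) t) A)
       \<le> (\<integral>\<^sup>+y. dens (tree_length S / s\<^sup>2) 0 s y * indicator A y \<partial>lborel)"
    unfolding achievable_def by blast
  define n where "n = length tr"
  define u where "u = (\<lambda>\<beta>. fst (tr ! \<beta>))"
  define B where "B = (\<lambda>\<beta>. fst (snd (tr ! \<beta>)))"
  define t where "t = (\<lambda>\<beta>. snd (snd (tr ! \<beta>)))"
  have ok: "0 < u \<beta> \<and> metric_subtree (B \<beta>) S \<and> card (tree_leaves (submetric S (B \<beta>))) = m \<and>
      0 < t \<beta> \<and> t \<beta> \<le> s \<and> tree_length (submetric S (B \<beta>)) \<le> tree_length S / 2 \<and>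
      2 * t \<beta> \<le> tree_length (submetric S (B \<beta>))" if "\<beta> < n" for \<beta>
  proof -
    have "(u \<beta>, B \<beta>, t \<beta>) \<in> set tr"
      using that by (simp add: u_def B_def t_def n_def)
    then show ?thesis
      using \<eta>(2) unfolding triples_ok_def by fast
  qed
  have sum_list: "(\<Sum>(u, B, t)\<leftarrow>tr. F u B t) = (\<Sum>\<beta><n. F (u \<beta>) (B \<beta>) (t \<beta>))"
    for F :: "real \<Rightarrow> 'a set \<Rightarrow> real \<Rightarrow> 'c::comm_monoid_add"
    by (simp add: sum_list_sum_nth n_def u_def B_def t_def case_prod_beta atLeast0LessThan)
  have cover: "1 \<le> cover_fun S s \<eta> x + (\<Sum>\<beta> | \<beta> < n \<and> x \<in> B \<beta>. u \<beta>)" if "x \<in> mspace S" for x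
  proof -
    have "(\<Sum>(u, B, t)\<leftarrow>tr. u * indicator B x) = (\<Sum>\<beta><n. u \<beta> * indicator (B \<beta>) x)"
      by (rule sum_list)
    also have "\<dots> = (\<Sum>\<beta> | \<beta> < n \<and> x \<in> B \<beta>. u \<beta>)"
      by (rule sum.mono_neutral_cong_right) auto
    finally show ?thesis
      using \<eta>(3)[OF that] by simp
  qed
  have marginal: "emeasure (mark_marginal \<eta>) A +
      (\<Sum>\<beta><n. ennreal (u \<beta>) * emeasure (Lam (submetric S (B \<beta>)) (t \<beta>)) A) \<le> emeasure (Lam S s) A"
    if "A \<in> sets borel" for A
    using \<eta>(4)[OF that] emeasure_Lam[OF that assms(5), of S] assms(5,6)
      sum_list[of "\<lambda>u B t. ennreal u * emeasure (Lam (submetric S B) t) A"] by (simp add: dens_def)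
  show ?thesis
    by (rule exI[of _ \<eta>], rule exI[of _ n], rule exI[of _ u], rule exI[of _ B], rule exI[of _ t])
      (use \<eta>(1) ok cover marginal in blast)
qed

end
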